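(* Let $S$ be a generalized step-reinforced random walk with reinforcement parameter $\alpha\in[0,1)$ and step distribution $\mu$ on $G$. Fix integers $m\ge0$ and $n\ge1$, and call $\{m+1,\ldots,m+n\}$ the block. Let $J_{m,n}=|\mathscr{I}_{m+n}\cap\{m+1,\ldots,m+n\}|$. Let $\mathcal{G}_{m,n}$ be the $\sigma$-algebra generated by $\mathcal{A}_m$, the pairs $(\xi_j,u_j)_{2\le j\le m+n}$, and the labels $g_j$ of the vertices $j$ of the block that are not in $\mathscr{I}_{m+n}$. (i) Conditionally on $\mathcal{G}_{m,n}$, the labels $g_j$ at the $J_{m,n}$ isolated vertices $j\in\mathscr{I}_{m+n}$ of the block are independent with law $\mu$; all other steps $X_j$ in the block are $\mathcal{G}_{m,n}$-measurable; and, starting from $S_m$, the conditional law of the walk on the block is that of a time-inhomogeneous Markov chain whose transition kernel at time $j$ is $P_\mu$ if $j\in\mathscr{I}_{m+n}$ and the translation kernel $P^{(X_j)}$ if $j\notin\mathscr{I}_{m+n}$. (ii) If $G$ is countably infinite and $q:=\|P_\mu\|_{L^2(G)\to L^2(G)}<1$, then almost surely $$\sup_{x\in G}\mathbb{P}(S_{m+n}=x\mid\mathcal{A}_m)\le q^{(1-\alpha)n/8}+2e^{-(1-\alpha)n/18}.$$ (iii) If $G$ is finite of size $N$, $\pi$ is the uniform distribution on $G$, and $\|P_\mu|_{L^2_0(G)}\|\le q_0$ for some $q_0\in(0,1)$, where $L^2_0(G)$ is the subspace of $L^2(G)$ of functions with mean zero, then almost surely $$\bigl\|\mathcal{L}(S_{m+n}\mid\mathcal{A}_m)-\pi\bigr\|_{\mathrm{TV}}\le\frac12\sqrt{N-1}\,q_0^{(1-\alpha)n/8}+2e^{-(1-\alpha)n/18}.$$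 All three assertions remain valid when $m$ is replaced by any almost surely finite stopping time for $(\mathcal{A}_m)_{m\ge0}$. The bounds in (ii) and (iii) also hold with $\mathcal{H}_m$ in place of $\mathcal{A}_m$, including at almost surely finite stopping times for $(\mathcal{H}_m)_{m\ge0}$.
   Context: Generalized step-reinforced random walk (SRRW). $G$ is either $(\mathbb{R}^d,+)$ with the Borel $\sigma$-algebra or a discrete group, with identity $e_G$; $\mu$ is a probability measure on $G$. Let $(g_n)_{n\ge1}$ be i.i.d. with law $\mu$, $(\xi_n)_{n\ge2}$ i.i.d. Bernoulli with parameter $\alpha$, and $(u_n)_{n\ge2}$ independent with $u_n$ uniform on $\{1,\ldots,n-1\}$; these three sequences are mutually independent. The transformations $(T_n)_{n\ge2}$ are of one of two types. (a) They are random measurable transformations of $G$, with $(\omega,g)\mapsto T_n(\omega,g)$ jointly measurable, such that the sequence $(T_n)$ is independent of the other three sequences, so that all four sequences are mutually independent (no independence among the $T_n$ is required); in this case put $\Theta=(T_n)_{n\ge2}$. (b) More generally, $\Theta$ is a random element independent of the three mutually independent sequences $(g_n),(\xi_n),(u_n)$, and $T_n(g)=\mathscr{T}_n(\Theta,(\xi_j,u_j)_{2\le j<n},g)$ for measurable maps $\mathscr{T}_n$. Set $S_0=e_G$, $X_1=g_1$, and for $n\ge2$ set $X_n=g_n$ if $\xi_n=0$ and $X_n=T_n(X_{u_n})$ if $\xi_n=1$. Put $S_n=X_1\cdots X_n$. Forest. $\mathscr{F}_n$ is the random forest on vertex set $\{1,\ldots,n\}$ in which, for $2\le j\le n$, the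 edge between $j$ and $u_j$ is present if and only if $\xi_j=1$ (there are no other edges). $\mathscr{I}_n\subseteq\{1,\ldots,n\}$ is the set of isolated vertices of $\mathscr{F}_n$ (vertices whose connected component is a single vertex). The variable $g_j$ is called the label of $j$. Filtrations. $\mathcal{A}_m=\sigma(\Theta,(g_j)_{1\le j\le m},(\xi_j,u_j)_{2\le j\le m})$ and $\mathcal{H}_m=\sigma(X_1,\ldots,X_m)$ for $m\ge0$ ($\mathcal{H}_0$ trivial). Kernels. $P_\mu$ is the transition kernel of right multiplication by a $\mu$-distributed element: $P_\mu(x,y)=\mu(x^{-1}y)$ for discrete $G$, and $P_\mu(x,B)=\mu(B-x)$ for Borel $B$ when $G=\mathbb{R}^d$. $P^{(g)}$ is the deterministic kernel moving $x$ to $x\cdot g$. For countable $G$, $L^2(G)$ is the real Hilbert space of square-summable functions with respect to counting measure, $P_\mu$ acts by $P_\mu f(x)=\sum_yP_\mu(x,y)f(y)$, and $\|\cdot\|$ denotes the operator norm. $\|\cdot\|_{\mathrm{TV}}$ is the total variation distance, and $\mathcal{L}(\cdot\mid\cdot)$ denotes conditional law. *)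

theory Defs
  imports
    "HOL-Probability.Probability"
    "HOL-Library.Extended_Nat"
    "HOL-Algebra.Group"
begin

section \<open>The state space\<close>

definition vector_group :: "(real ^ 'd) monoid" where
  "vector_group = \<lparr>carrier = UNIV, mult = (+), one = 0\<rparr>"

text \<open>
  \<open>G\<close> is \<open>(\<real>\<^sup>d, +)\<close> with its Borel sets, up to renaming of the elements; for
  \<open>G = vector_group\<close> and \<open>E = borel\<close> one takes \<open>\<phi> = id\<close>.
\<close>

definition euclidean_state_space :: "'d::finite itself \<Rightarrow> 'a monoid \<Rightarrow> 'a measure \<Rightarrow> bool" where
  "euclidean_state_space _ G E \<longleftrightarrow>
     (\<exists>\<phi> :: 'a \<Rightarrow> real ^ 'd. \<phi> \<in> iso G vector_group \<and>
        sets E = sets (vimage_algebra (carrier G) \<phi> borel))"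

text \<open>
  Measurability of the multiplication with respect to the product of the two power set
  algebras is automatic for countable \<open>G\<close>. For a discrete group of large cardinality it can
  fail, and then the products \<open>S\<^sub>n\<close> need not be random variables at all.
\<close>

definition discrete_state_space :: "'a monoid \<Rightarrow> 'a measure \<Rightarrow> bool" where
  "discrete_state_space G E \<longleftrightarrow>
     sets E = Pow (carrier G) \<and> (\<lambda>(x, y). x \<otimes>\<^bsub>G\<^esub> y) \<in> E \<Otimes>\<^sub>M E \<rightarrow>\<^sub>M E"

lemma euclidean_state_space_vector_group:
  "euclidean_state_space TYPE('d::finite) (vector_group :: (real ^ 'd) monoid) borel"
proof -
  have "(\<lambda>x. x) \<in> iso vector_group (vector_group :: (real ^ 'd) monoid)"
    by (auto simp: iso_def hom_def vector_group_def bij_betw_def)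
  moreover have "sets (borel :: (real ^ 'd) measure) =
      sets (vimage_algebra (carrier vector_group) (\<lambda>x. x) borel)"
    by (subst sets_vimage_algebra2) (auto simp: vector_group_def)
  ultimately show ?thesis unfolding euclidean_state_space_def by blast
qed

lemma discrete_state_space_countable:
  assumes "group G" "countable (carrier G)"
  shows "discrete_state_space G (count_space (carrier G))"
proof -
  interpret group G by fact
  have "(\<lambda>(x, y). x \<otimes>\<^bsub>G\<^esub> y)
      \<in> count_space (carrier G \<times> carrier G) \<rightarrow>\<^sub>M count_space (carrier G)"
    by auto
  with assms(2) show ?thesis
    by (simp add: discrete_state_space_def pair_measure_countable)
qed

section \<open>Generated \<open>\<sigma>\<close>-algebras, stopping times, conditional probabilities\<close>

definition generated :: "'w measure \<Rightarrow> 'b measure \<Rightarrow> 'i set \<Rightarrow> ('i \<Rightarrow> 'w \<Rightarrow> 'b) \<Rightarrow> 'w measure" where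
  "generated M N I Y = sigma (space M) (\<Union>i\<in>I. {Y i -` B \<inter> space M | B. B \<in> sets N})"

definition extended_filtration ::
    "'w measure \<Rightarrow> (nat \<Rightarrow> 'w measure) \<Rightarrow> enat \<Rightarrow> 'w measure" where
  "extended_filtration M F t =
     (case t of enat m \<Rightarrow> F m | \<infinity> \<Rightarrow> sigma (space M) (\<Union>m. sets (F m)))"

text \<open>
  The \<open>\<sigma>\<close>-algebra \<open>B\<close> and the random time \<open>\<tau>\<close> form an admissible pair for the filtration
  \<open>F\<close>: either \<open>\<tau>\<close> is a constant \<open>m\<close> and \<open>B = F m\<close>, or \<open>\<tau>\<close> is an almost surely finite
  stopping time and \<open>B\<close> is the associated \<open>\<sigma>\<close>-algebra. The value that \<open>the_enat\<close>
  assigns to \<open>\<tau>\<close> on the null event of an infinite stopping time is irrelevant.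
\<close>

definition fixed_or_stopping ::
    "'w measure \<Rightarrow> (nat \<Rightarrow> 'w measure) \<Rightarrow> 'w measure \<Rightarrow> ('w \<Rightarrow> nat) \<Rightarrow> bool" where
  "fixed_or_stopping M F B \<tau> \<longleftrightarrow>
     (\<exists>m. B = F m \<and> \<tau> = (\<lambda>_. m)) \<or>
     (\<exists>\<sigma> :: 'w \<Rightarrow> enat.
        stopping_time (extended_filtration M F) \<sigma> \<and> (AE \<omega> in M. \<sigma> \<omega> < \<infinity>) \<and>
        B = filtration.pre_sigma (space M) (extended_filtration M F) \<sigma> \<and>
        \<tau> = (\<lambda>\<omega>. the_enat (\<sigma> \<omega>)))"

definition prob_given :: "'w measure \<Rightarrow> 'w measure \<Rightarrow> 'w set \<Rightarrow> 'w \<Rightarrow> real" where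
  "prob_given M B A = real_cond_exp M B (indicator A)"

text \<open>\<open>\<kappa>\<close> is a (regular) conditional law of \<open>Y\<close> given \<open>B\<close>.\<close>

definition is_cond_law ::
    "'w measure \<Rightarrow> 'w measure \<Rightarrow> ('w \<Rightarrow> 'b) \<Rightarrow> 'b measure \<Rightarrow> ('w \<Rightarrow> 'b measure) \<Rightarrow> bool" where
  "is_cond_law M B Y N \<kappa> \<longleftrightarrow>
     Y \<in> M \<rightarrow>\<^sub>M N \<and> \<kappa> \<in> B \<rightarrow>\<^sub>M prob_algebra N \<and>
     (\<forall>A\<in>sets N. AE \<omega> in M. prob_given M B (Y -` A \<inter> space M) \<omega> = measure (\<kappa> \<omega>) A)"

text \<open>
  Total variation distance of two laws on \<open>E\<close>, given as set functions, so that it applies to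
  \<open>A \<mapsto> P(Y \<in> A | B)(\<omega>)\<close>. The latter is almost surely a probability measure when the state
  space is finite, which is the only case where it is used.
\<close>

definition tv_dist :: "'a measure \<Rightarrow> ('a set \<Rightarrow> real) \<Rightarrow> ('a set \<Rightarrow> real) \<Rightarrow> real" where
  "tv_dist E p q = (SUP A\<in>sets E. \<bar>p A - q A\<bar>)"

section \<open>Kernels and the operator norm\<close>

definition mult_kernel :: "'a monoid \<Rightarrow> 'a measure \<Rightarrow> 'a measure \<Rightarrow> 'a \<Rightarrow> 'a measure" where
  "mult_kernel G E \<mu> x = distr \<mu> E (\<lambda>y. x \<otimes>\<^bsub>G\<^esub> y)"

definition translation_kernel :: "'a monoid \<Rightarrow> 'a measure \<Rightarrow> 'a \<Rightarrow> 'a \<Rightarrow> 'a measure" where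
  "translation_kernel G E y x = return E (x \<otimes>\<^bsub>G\<^esub> y)"

text \<open>
  Law of the path (positions at times \<open>0, ..., n\<close>) of the time-inhomogeneous Markov chain
  started at \<open>x\<close> whose step from time \<open>k - 1\<close> to time \<open>k\<close> is governed by the kernel \<open>K k\<close>.
\<close>

primrec markov_law ::
    "'a measure \<Rightarrow> (nat \<Rightarrow> 'a \<Rightarrow> 'a measure) \<Rightarrow> 'a \<Rightarrow> nat \<Rightarrow> (nat \<Rightarrow> 'a) measure" where
  "markov_law E K x 0 = return (\<Pi>\<^sub>M k\<in>{0..0}. E) (\<lambda>k\<in>{0..0}. x)"
| "markov_law E K x (Suc n) =
     bind (markov_law E K x n)
       (\<lambda>p. distr (K (Suc n) (p n)) (\<Pi>\<^sub>M k\<in>{0..Suc n}. E) (\<lambda>y. p(Suc n := y)))"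

definition ell2 :: "'a set \<Rightarrow> ('a \<Rightarrow> real) set" where
  "ell2 C = {f. (\<forall>x. x \<notin> C \<longrightarrow> f x = 0) \<and> (\<lambda>x. (f x)\<^sup>2) summable_on C}"

definition ell2_norm :: "'a set \<Rightarrow> ('a \<Rightarrow> real) \<Rightarrow> real" where
  "ell2_norm C f = sqrt (\<Sum>\<^sub>\<infinity>x\<in>C. (f x)\<^sup>2)"

definition ell2_mean_zero :: "'a set \<Rightarrow> ('a \<Rightarrow> real) set" where
  "ell2_mean_zero C = {f \<in> ell2 C. (\<Sum>x\<in>C. f x) = 0}"

definition kernel_operator ::
    "'a set \<Rightarrow> ('a \<Rightarrow> 'a measure) \<Rightarrow> ('a \<Rightarrow> real) \<Rightarrow> 'a \<Rightarrow> real" where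
  "kernel_operator C P f x = (if x \<in> C then \<Sum>\<^sub>\<infinity>y\<in>C. measure (P x) {y} * f y else 0)"

text \<open>
  Norm of an operator restricted to the subspace \<open>V\<close>. The operator of \<open>mult_kernel\<close> is a
  contraction, so the supremum is over a bounded set, which contains 0.
\<close>

definition ell2_opnorm ::
    "'a set \<Rightarrow> ('a \<Rightarrow> real) set \<Rightarrow> (('a \<Rightarrow> real) \<Rightarrow> 'a \<Rightarrow> real) \<Rightarrow> real" where
  "ell2_opnorm C V P = (SUP f\<in>{f\<in>V. ell2_norm C f \<le> 1}. ell2_norm C (P f))"

section \<open>The walk, the forest and the filtrations\<close>

primrec walk :: "'a monoid \<Rightarrow> (nat \<Rightarrow> 'w \<Rightarrow> 'a) \<Rightarrow> nat \<Rightarrow> 'w \<Rightarrow> 'a" where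
  "walk G X 0 \<omega> = \<one>\<^bsub>G\<^esub>"
| "walk G X (Suc n) \<omega> = walk G X n \<omega> \<otimes>\<^bsub>G\<^esub> X (Suc n) \<omega>"

definition forest_edges ::
    "(nat \<Rightarrow> 'w \<Rightarrow> bool) \<Rightarrow> (nat \<Rightarrow> 'w \<Rightarrow> nat) \<Rightarrow> nat \<Rightarrow> 'w \<Rightarrow> (nat \<times> nat) set" where
  "forest_edges \<xi> u n \<omega> = {(j, u j \<omega>) | j. 2 \<le> j \<and> j \<le> n \<and> \<xi> j \<omega>}"

definition component ::
    "(nat \<Rightarrow> 'w \<Rightarrow> bool) \<Rightarrow> (nat \<Rightarrow> 'w \<Rightarrow> nat) \<Rightarrow> nat \<Rightarrow> 'w \<Rightarrow> nat \<Rightarrow> nat set" where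
  "component \<xi> u n \<omega> v =
     {w \<in> {1..n}. (v, w) \<in> (forest_edges \<xi> u n \<omega> \<union> (forest_edges \<xi> u n \<omega>)\<inverse>)\<^sup>*}"

definition isolated ::
    "(nat \<Rightarrow> 'w \<Rightarrow> bool) \<Rightarrow> (nat \<Rightarrow> 'w \<Rightarrow> nat) \<Rightarrow> nat \<Rightarrow> 'w \<Rightarrow> nat set" where
  "isolated \<xi> u n \<omega> = {v \<in> {1..n}. component \<xi> u n \<omega> v = {v}}"

definition full_filtration ::
    "'w measure \<Rightarrow> 'a measure \<Rightarrow> 't measure \<Rightarrow> ('w \<Rightarrow> 't) \<Rightarrow> (nat \<Rightarrow> 'w \<Rightarrow> 'a) \<Rightarrow>
     (nat \<Rightarrow> 'w \<Rightarrow> bool) \<Rightarrow> (nat \<Rightarrow> 'w \<Rightarrow> nat) \<Rightarrow> nat \<Rightarrow> 'w measure" where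
  "full_filtration M E N \<Theta> g \<xi> u m = sigma (space M)
     (sets (vimage_algebra (space M) \<Theta> N)
      \<union> sets (generated M E {1..m} g)
      \<union> sets (generated M (count_space UNIV) {2..m} (\<lambda>j \<omega>. (\<xi> j \<omega>, u j \<omega>))))"

definition step_filtration ::
    "'w measure \<Rightarrow> 'a measure \<Rightarrow> (nat \<Rightarrow> 'w \<Rightarrow> 'a) \<Rightarrow> nat \<Rightarrow> 'w measure" where
  "step_filtration M E X m = generated M E {1..m} X"

text \<open>
  The \<open>\<sigma>\<close>-algebra generated by \<open>B\<close>, the pairs \<open>(\<xi>\<^sub>j, u\<^sub>j)\<close> with \<open>2 \<le> j \<le> \<tau> + n\<close> and the
  labels \<open>g\<^sub>j\<close> of the non-isolated vertices \<open>j\<close> of the block \<open>{\<tau> + 1, ..., \<tau> + n}\<close>. As the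
  index ranges are random, each variable contributes only its events on the part of the
  sample space where it is revealed.
\<close>

definition block_sigma ::
    "'w measure \<Rightarrow> 'a measure \<Rightarrow> (nat \<Rightarrow> 'w \<Rightarrow> 'a) \<Rightarrow>
     (nat \<Rightarrow> 'w \<Rightarrow> bool) \<Rightarrow> (nat \<Rightarrow> 'w \<Rightarrow> nat) \<Rightarrow> 'w measure \<Rightarrow> ('w \<Rightarrow> nat) \<Rightarrow> nat \<Rightarrow> 'w measure" where
  "block_sigma M E g \<xi> u B \<tau> n = sigma (space M)
     (sets B
      \<union> {{\<omega> \<in> space M. j \<le> \<tau> \<omega> + n \<and> (\<xi> j \<omega>, u j \<omega>) \<in> C} | j C. 2 \<le> j}
      \<union> {{\<omega> \<in> space M. j \<in> {\<tau> \<omega> + 1..\<tau> \<omega> + n} - isolated \<xi> u (\<tau> \<omega> + n) \<omega> \<and> g j \<omega> \<in> A}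
           | j A. A \<in> sets E})"

text \<open>
  The random transformations are \<open>T\<^sub>n(x) = \<T> n (\<Theta>, (\<xi>\<^sub>j, u\<^sub>j)\<^sub>2\<^sub>\<le>\<^sub>j\<^sub><\<^sub>n, x)\<close>. Transformations that
  are jointly measurable and independent of the three other sequences are the special case
  of lemma \<open>srrw_independent_transformations\<close> below.
\<close>

locale srrw = prob_space M + group G
  for M :: "'w measure" and G :: "'a monoid" +
  fixes E :: "'a measure" and \<mu> :: "'a measure" and \<alpha> :: real
    and N :: "'t measure" and \<Theta> :: "'w \<Rightarrow> 't"
    and \<T> :: "nat \<Rightarrow> 't \<times> (nat \<Rightarrow> bool \<times> nat) \<times> 'a \<Rightarrow> 'a"
    and g :: "nat \<Rightarrow> 'w \<Rightarrow> 'a" and \<xi> :: "nat \<Rightarrow> 'w \<Rightarrow> bool" and u :: "nat \<Rightarrow> 'w \<Rightarrow> nat"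
    and X :: "nat \<Rightarrow> 'w \<Rightarrow> 'a"
  assumes space_E: "space E = carrier G"
    and step_law: "prob_space \<mu>" "sets \<mu> = sets E"
    and \<alpha>: "0 \<le> \<alpha>" "\<alpha> < 1"
    and g_indep: "indep_vars (\<lambda>_. E) g {1..}"
    and g_law: "\<And>n. 1 \<le> n \<Longrightarrow> distr M E (g n) = \<mu>"
    and \<xi>_indep: "indep_vars (\<lambda>_. count_space UNIV) \<xi> {2..}"
    and \<xi>_law: "\<And>n. 2 \<le> n \<Longrightarrow> distr M (count_space UNIV) (\<xi> n) = measure_pmf (bernoulli_pmf \<alpha>)"
    and u_indep: "indep_vars (\<lambda>_. count_space UNIV) u {2..}"
    and u_range: "\<And>n \<omega>. 2 \<le> n \<Longrightarrow> \<omega> \<in> space M \<Longrightarrow> u n \<omega> \<in> {1..<n}"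
    and u_law: "\<And>n. 2 \<le> n \<Longrightarrow>
      distr M (count_space UNIV) (u n) = measure_pmf (pmf_of_set {1..<n})"
    and \<Theta>_measurable: "\<Theta> \<in> M \<rightarrow>\<^sub>M N"
    and sequences_indep: "indep_sets (\<lambda>i::nat.
        [sets (generated M E {1..} g),
         sets (generated M (count_space UNIV) {2..} \<xi>),
         sets (generated M (count_space UNIV) {2..} u),
         sets (vimage_algebra (space M) \<Theta> N)] ! i) {0, 1, 2, 3}"
    and \<T>_measurable: "\<And>n. 2 \<le> n \<Longrightarrow>
      \<T> n \<in> N \<Otimes>\<^sub>M (\<Pi>\<^sub>M j\<in>{2..<n}. count_space UNIV) \<Otimes>\<^sub>M E \<rightarrow>\<^sub>M E"
    and X_first: "\<And>\<omega>. \<omega> \<in> space M \<Longrightarrow> X 1 \<omega> = g 1 \<omega>"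
    and X_step: "\<And>n \<omega>. 2 \<le> n \<Longrightarrow> \<omega> \<in> space M \<Longrightarrow>
      X n \<omega> = (if \<xi> n \<omega>
               then \<T> n (\<Theta> \<omega>, (\<lambda>j\<in>{2..<n}. (\<xi> j \<omega>, u j \<omega>)), X (u n \<omega>) \<omega>)
               else g n \<omega>)"

text \<open>
  The case of a sequence \<open>T\<close> of jointly measurable random transformations independent of the
  other three sequences. The \<open>\<sigma>\<close>-algebra carrying the randomness of \<open>T\<close> is called \<open>B\<close>;
  joint measurability with respect to \<open>B\<close> cannot be replaced by measurability of each
  \<open>T n \<cdot> x\<close>, because for uncountable \<open>G\<close> independence of the evaluations alone does not
  control \<open>T n \<omega>\<close> at a random point.
\<close>

lemma srrw_independent_transformations:
  fixes T :: "nat \<Rightarrow> 'w \<Rightarrow> 'a \<Rightarrow> 'a" and B :: "'w measure"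
  assumes "prob_space M" "group G" "space E = carrier G" "prob_space \<mu>" "sets \<mu> = sets E"
    and "0 \<le> \<alpha>" "\<alpha> < 1"
    and "prob_space.indep_vars M (\<lambda>_. E) g {1..}"
    and "\<And>n. 1 \<le> n \<Longrightarrow> distr M E (g n) = \<mu>"
    and "prob_space.indep_vars M (\<lambda>_. count_space UNIV) \<xi> {2..}"
    and "\<And>n. 2 \<le> n \<Longrightarrow> distr M (count_space UNIV) (\<xi> n) = measure_pmf (bernoulli_pmf \<alpha>)"
    and "prob_space.indep_vars M (\<lambda>_. count_space UNIV) u {2..}"
    and "\<And>n \<omega>. 2 \<le> n \<Longrightarrow> \<omega> \<in> space M \<Longrightarrow> u n \<omega> \<in> {1..<n}"
    and "\<And>n. 2 \<le> n \<Longrightarrow> distr M (count_space UNIV) (u n) = measure_pmf (pmf_of_set {1..<n})"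
    and B: "subalgebra M B"
    and T: "\<And>n. 2 \<le> n \<Longrightarrow> (\<lambda>(\<omega>, x). T n \<omega> x) \<in> B \<Otimes>\<^sub>M E \<rightarrow>\<^sub>M E"
    and indep: "prob_space.indep_sets M (\<lambda>i::nat.
        [sets (generated M E {1..} g),
         sets (generated M (count_space UNIV) {2..} \<xi>),
         sets (generated M (count_space UNIV) {2..} u), sets B] ! i) {0, 1, 2, 3}"
    and "\<And>\<omega>. \<omega> \<in> space M \<Longrightarrow> X 1 \<omega> = g 1 \<omega>"
    and "\<And>n \<omega>. 2 \<le> n \<Longrightarrow> \<omega> \<in> space M \<Longrightarrow>
      X n \<omega> = (if \<xi> n \<omega> then T n \<omega> (X (u n \<omega>) \<omega>) else g n \<omega>)"
  shows "srrw M G E \<mu> \<alpha> B (\<lambda>\<omega>. \<omega>) (\<lambda>n (\<omega>, h, x). T n \<omega> x) g \<xi> u X"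
proof -
  have vB: "sets (vimage_algebra (space M) (\<lambda>\<omega>. \<omega>) B) = sets B"
  proof -
    have "space M = space B" using B by (simp add: subalgebra_def)
    then show ?thesis
      by (subst sets_vimage_algebra2) (auto dest: sets.sets_into_space)
  qed
  have "(\<lambda>(\<omega>, h, x). T n \<omega> x)
      \<in> B \<Otimes>\<^sub>M (\<Pi>\<^sub>M j\<in>{2..<n}. count_space (UNIV :: (bool \<times> nat) set)) \<Otimes>\<^sub>M E \<rightarrow>\<^sub>M E"
    if n: "2 \<le> n" for n
  proof -
    have "(\<lambda>p. (\<lambda>(\<omega>, x). T n \<omega> x) (fst p, snd (snd p)))
      \<in> B \<Otimes>\<^sub>M (\<Pi>\<^sub>M j\<in>{2..<n}. count_space (UNIV :: (bool \<times> nat) set)) \<Otimes>\<^sub>M E \<rightarrow>\<^sub>M E"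
      by (rule measurable_compose[OF _ T[OF n]]) measurable
    then show ?thesis by (simp add: case_prod_beta')
  qed
  moreover have "(\<lambda>\<omega>. \<omega>) \<in> M \<rightarrow>\<^sub>M B"
    using B by (auto simp: subalgebra_def measurable_def)
  ultimately show ?thesis
    using assms unfolding srrw_def srrw_axioms_def vB by auto
qed

end

theory Submission
  imports Defs
begin

text \<open>
  Which vertices of the block are isolated is decided by the pairs \<open>(\<xi>\<^sub>j, u\<^sub>j)\<close> alone, and the
  label of an isolated vertex enters no other step: a step at any other vertex is computed by
  following edges of the forest, and none of them touches an isolated vertex. So on the event
  that \<open>i\<close> is isolated, everything that the block reveals is a function of the sources of
  randomness other than \<open>g\<^sub>i\<close> (lemma \<open>block_at_info\<close>), and \<open>g\<^sub>i\<close> is independent of those. Part (i)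
  follows by peeling off isolated labels one at a time. For the labels themselves this is a
  product formula (\<open>block_labels_prob\<close>); for the path it is an induction along the block
  (\<open>nn_integral_block_path\<close>), in which an isolated step is integrated out by Fubini and any
  other step is a translation by a revealed group element.

  For (ii) and (iii) a centred indicator function of the endpoint is pulled back through the
  kernels of the block. Translations do not increase the norm of \<open>\<ell>\<^sup>2\<close> and averaging with \<open>\<mu>\<close>
  multiplies it by at most \<open>q\<close>, so a block with \<open>J\<close> isolated vertices gains a factor \<open>q\<^sup>J\<close>
  (\<open>markov_law_contraction\<close>). On a finite group of size \<open>N\<close> the indicator of a set minus its mean
  has norm at most \<open>sqrt N / 2\<close>, and evaluation at a point has norm \<open>sqrt (1 - 1 / N)\<close> on
  functions of mean zero; the product of the two is the constant \<open>sqrt (N - 1) / 2\<close>.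

  It remains to see that \<open>J\<close> is rarely small. Given the first \<open>t = m + k\<close> vertices, the number of
  isolated vertices in the first part of the block grows by one with probability \<open>1 - \<alpha>\<close> and
  loses one with probability \<open>\<alpha> J / t\<close>. For the generating function \<open>E (1 - z)\<^sup>J\<close>, Bernoulli's
  inequality turns this step into a factor \<open>1 - (1 - \<alpha>) z\<close> and the replacement of \<open>z\<close> by
  \<open>z (1 - 1 / t)\<close>. The iteration gives \<open>E (1 - z)\<^sup>J \<le> exp (- (1 - \<alpha>) z n / 2)\<close> conditionally on the
  past (\<open>fresh_laplace_bound\<close>), and Markov's inequality with \<open>z = 3 / 4\<close> bounds the probability
  that \<open>J < (1 - \<alpha>) n / 8\<close> by \<open>exp (- (1 - \<alpha>) n / 8)\<close>.

  A random time \<open>\<tau>\<close> is treated by cutting the sample space along its values. On \<open>\<tau> = m\<close> the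
  \<open>\<sigma>\<close>-algebra at time \<open>\<tau>\<close> coincides, up to a null set, with the one at the fixed time \<open>m\<close>, so it is
  enough to test conditional expectations on events of fixed time.
\<close>

section \<open>Traces of \<sigma>-algebras and conditional expectations\<close>

text \<open>
  The sets with trace on \<open>Q\<close> in \<open>F\<close> form a \<open>\<sigma>\<close>-algebra, so it suffices to look at generators. All
  comparisons of \<open>\<sigma>\<close>-algebras on an event below go through this lemma.
\<close>

lemma sets_sigma_trace:
  assumes D: "D \<in> sets (sigma \<Omega> \<A>)" and \<A>: "\<A> \<subseteq> Pow \<Omega>" and F: "space F = \<Omega>" and Q: "Q \<in> sets F"
    and trace: "\<And>A. A \<in> \<A> \<Longrightarrow> A \<inter> Q \<in> sets F"
  shows "D \<inter> Q \<in> sets F"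
proof -
  have "D \<in> sigma_sets \<Omega> \<A>" using D \<A> by simp
  then show ?thesis
  proof induction
    case (Compl a)
    have "(\<Omega> - a) \<inter> Q = Q - a \<inter> Q"
      using sets.sets_into_space[OF Q] F by auto
    with Compl Q show ?case by auto
  next
    case (Union a)
    have "(\<Union>i. a i) \<inter> Q = (\<Union>i. a i \<inter> Q)" by auto
    also have "\<dots> \<in> sets F" using Union by (intro sets.countable_UN) auto
    finally show ?case .
  qed (use trace in auto)
qed

lemma measurable_generated:
  assumes "i \<in> I" "Y i \<in> space M \<rightarrow> space L"
  shows "Y i \<in> generated M L I Y \<rightarrow>\<^sub>M L"
proof (rule measurableI)
  have sub: "(\<Union>i\<in>I. {Y i -` B \<inter> space M | B. B \<in> sets L}) \<subseteq> Pow (space M)" by auto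
  have sp: "space (generated M L I Y) = space M"
    unfolding generated_def using sub by (rule space_measure_of)
  show "Y i x \<in> space L" if "x \<in> space (generated M L I Y)" for x
    using that assms sp by auto
  show "Y i -` A \<inter> space (generated M L I Y) \<in> sets (generated M L I Y)" if "A \<in> sets L" for A
    unfolding sp unfolding generated_def sets_measure_of[OF sub]
    using that assms by (intro sigma_sets.Basic) auto
qed

lemma space_generated [simp]: "space (generated M L I Y) = space M"
  unfolding generated_def by (rule space_measure_of) auto

lemma sets_generated_least:
  assumes "space F = space M" "\<And>i. i \<in> I \<Longrightarrow> Y i \<in> F \<rightarrow>\<^sub>M L"
  shows "sets (generated M L I Y) \<subseteq> sets F"
proof -
  have "(\<Union>i\<in>I. {Y i -` B \<inter> space M | B. B \<in> sets L}) \<subseteq> sets F"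
  proof safe
    fix i B assume "i \<in> I" "B \<in> sets L"
    then show "Y i -` B \<inter> space M \<in> sets F"
      using measurable_sets[OF assms(2)] by (simp add: assms(1))
  qed
  then have "sigma_sets (space F) (\<Union>i\<in>I. {Y i -` B \<inter> space M | B. B \<in> sets L}) \<subseteq> sets F"
    by (rule sets.sigma_sets_subset)
  moreover have "(\<Union>i\<in>I. {Y i -` B \<inter> space M | B. B \<in> sets L}) \<subseteq> Pow (space M)" by auto
  ultimately show ?thesis by (simp add: generated_def assms(1))
qed

text \<open>
  If \<open>B\<close> is not finer than \<open>D\<close> on the event \<open>I\<close>, then a \<open>B\<close>-measurable parameter that is only used on
  \<open>I\<close> may be regarded as \<open>D\<close>-measurable.
\<close>

lemma measurable_indicator_mult_transfer:
  fixes H :: "'a \<times> 'b \<Rightarrow> ennreal"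
  assumes sp: "space B = space D" and I: "I \<in> sets D"
    and trace: "\<And>A. A \<in> sets B \<Longrightarrow> A \<inter> I \<in> sets D"
    and H: "H \<in> borel_measurable (B \<Otimes>\<^sub>M L)"
  shows "(\<lambda>p. H p * indicator I (fst p)) \<in> borel_measurable (D \<Otimes>\<^sub>M L)"
proof -
  let ?\<Omega> = "I \<times> space L"
  have \<Omega>: "?\<Omega> \<in> sets (D \<Otimes>\<^sub>M L)" using I by auto
  have tr: "S \<inter> ?\<Omega> \<in> sets (D \<Otimes>\<^sub>M L)" if "S \<in> sets (B \<Otimes>\<^sub>M L)" for S
  proof (rule sets_sigma_trace)
    show "S \<in> sets (sigma (space B \<times> space L) {a \<times> b | a b. a \<in> sets B \<and> b \<in> sets L})"
      using that by (simp add: sets_pair_measure pair_measure_closed)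
    show "{a \<times> b | a b. a \<in> sets B \<and> b \<in> sets L} \<subseteq> Pow (space B \<times> space L)"
      by (rule pair_measure_closed)
    show "space (D \<Otimes>\<^sub>M L) = space B \<times> space L" by (simp add: space_pair_measure sp)
    show "A \<inter> ?\<Omega> \<in> sets (D \<Otimes>\<^sub>M L)" if "A \<in> {a \<times> b | a b. a \<in> sets B \<and> b \<in> sets L}" for A
    proof -
      from that obtain a b where ab: "A = a \<times> b" "a \<in> sets B" "b \<in> sets L" by auto
      have "A \<inter> ?\<Omega> = (a \<inter> I) \<times> b" using ab sets.sets_into_space[of b L] by auto
      with ab trace show ?thesis by auto
    qed
  qed (rule \<Omega>)
  have "H \<in> borel_measurable (restrict_space (D \<Otimes>\<^sub>M L) ?\<Omega>)"
  proof (rule measurableI)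
    fix A :: "ennreal set" assume "A \<in> sets borel"
    then have "(H -` A \<inter> space (B \<Otimes>\<^sub>M L)) \<inter> ?\<Omega> \<in> sets (D \<Otimes>\<^sub>M L)"
      using H by (intro tr) auto
    also have "(H -` A \<inter> space (B \<Otimes>\<^sub>M L)) \<inter> ?\<Omega> = H -` A \<inter> space (restrict_space (D \<Otimes>\<^sub>M L) ?\<Omega>)"
      by (auto simp: space_restrict_space space_pair_measure sp)
    finally show "H -` A \<inter> space (restrict_space (D \<Otimes>\<^sub>M L) ?\<Omega>) \<in> sets (restrict_space (D \<Otimes>\<^sub>M L) ?\<Omega>)"
      using \<Omega> by (subst sets_restrict_space_iff) (auto simp: space_restrict_space)
  qed simp
  then have "(\<lambda>p. H p * indicator ?\<Omega> p) \<in> borel_measurable (D \<Otimes>\<^sub>M L)"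
    using \<Omega> by (subst (asm) borel_measurable_restrict_space_iff_ennreal) auto
  then show ?thesis
    by (rule measurable_cong[THEN iffD1, rotated]) (auto simp: space_pair_measure indicator_def)
qed

context prob_space
begin

lemma set_integral_indicator:
  fixes D W :: "'a set"
  assumes "D \<in> events" "W \<in> events"
  shows "(\<integral>\<omega>\<in>D. indicator W \<omega> \<partial>M) = prob (D \<inter> W)"
proof -
  have "(\<integral>\<omega>\<in>D. indicator W \<omega> \<partial>M) = (\<integral>\<omega>. indicator (D \<inter> W) \<omega> \<partial>M)"
    unfolding set_lebesgue_integral_def
    by (rule Bochner_Integration.integral_cong) (auto simp: indicator_def)
  also have "\<dots> = prob (D \<inter> W)" using assms by simp
  finally show ?thesis .
qed

lemma integral_scaled_indicator:
  fixes c :: real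
  assumes D: "D \<in> events"
  shows "integrable M (\<lambda>\<omega>. c * indicator D \<omega>)" and "(\<integral>\<omega>. c * indicator D \<omega> \<partial>M) = c * prob D"
proof -
  have "integrable M (indicator D :: 'a \<Rightarrow> real)"
    using D by (intro integrable_real_indicator) (simp_all add: emeasure_eq_measure)
  then show "integrable M (\<lambda>\<omega>. c * indicator D \<omega>)" by (rule integrable_mult_right)
  show "(\<integral>\<omega>. c * indicator D \<omega> \<partial>M) = c * prob D" using D by simp
qed

lemma sigma_finite_subalgebra_of_events:
  assumes "subalgebra M B"
  shows "sigma_finite_subalgebra M B"
  using assms by (intro finite_measure_subalgebra_is_sigma_finite finite_measure_subalgebra.intro
      finite_measure_subalgebra_axioms.intro) (unfold_locales)

text \<open>
  Localised version of the characterisation of conditional expectations: knowing the integrals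
  over the events inside \<open>Q\<close> determines the conditional expectation on \<open>Q\<close>.
\<close>

lemma cond_exp_eq_on:
  fixes f h :: "'a \<Rightarrow> real"
  assumes B: "subalgebra M B" and Q: "Q \<in> sets B"
    and f: "integrable M f" and h: "integrable M h" "h \<in> borel_measurable B"
    and eq: "\<And>D. D \<in> sets B \<Longrightarrow> D \<subseteq> Q \<Longrightarrow> (\<integral>\<omega>\<in>D. f \<omega> \<partial>M) = (\<integral>\<omega>\<in>D. h \<omega> \<partial>M)"
  shows "AE \<omega> in M. \<omega> \<in> Q \<longrightarrow> real_cond_exp M B f \<omega> = h \<omega>"
proof -
  interpret sigma_finite_subalgebra M B
    by (rule sigma_finite_subalgebra_of_events[OF B])
  have QM: "Q \<in> sets M" using B Q by (auto simp: subalgebra_def)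
  note [measurable] = Q QM h(2) borel_measurable_integrable[OF f] borel_measurable_integrable[OF h(1)]
  have int: "integrable M (\<lambda>\<omega>. indicator Q \<omega> * f \<omega>)" "integrable M (\<lambda>\<omega>. indicator Q \<omega> * h \<omega>)"
    using integrable_mult_indicator[OF QM f] integrable_mult_indicator[OF QM h(1)] by auto
  have "AE \<omega> in M. real_cond_exp M B (\<lambda>\<omega>. indicator Q \<omega> * f \<omega>) \<omega> = indicator Q \<omega> * h \<omega>"
  proof (rule real_cond_exp_charact)
    fix D assume D: "D \<in> sets B"
    have restr: "(\<integral>\<omega>\<in>D. indicator Q \<omega> * k \<omega> \<partial>M) = (\<integral>\<omega>\<in>D \<inter> Q. k \<omega> \<partial>M)" for k :: "'a \<Rightarrow> real"
      unfolding set_lebesgue_integral_def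
      by (rule Bochner_Integration.integral_cong) (auto simp: indicator_def)
    show "(\<integral>\<omega>\<in>D. indicator Q \<omega> * f \<omega> \<partial>M) = (\<integral>\<omega>\<in>D. indicator Q \<omega> * h \<omega> \<partial>M)"
      unfolding restr using D Q by (intro eq) auto
  qed (use int in \<open>measurable\<close>)
  moreover have "AE \<omega> in M. real_cond_exp M B (\<lambda>\<omega>. indicator Q \<omega> * f \<omega>) \<omega>
      = indicator Q \<omega> * real_cond_exp M B f \<omega>"
    using int by (intro real_cond_exp_mult) auto
  ultimately show ?thesis by eventually_elim auto
qed

text \<open>
  Otherwise the event \<open>D \<subseteq> Q\<close> on which the conditional expectation exceeds \<open>h\<close> would have positive
  probability and violate the inequality between the integrals over \<open>D\<close>.
\<close>

lemma cond_exp_le_on: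
  fixes f h :: "'a \<Rightarrow> real"
  assumes B: "subalgebra M B" and Q: "Q \<in> sets B"
    and f: "integrable M f" and h: "integrable M h" "h \<in> borel_measurable B"
    and le: "\<And>D. D \<in> sets B \<Longrightarrow> D \<subseteq> Q \<Longrightarrow> (\<integral>\<omega>\<in>D. f \<omega> \<partial>M) \<le> (\<integral>\<omega>\<in>D. h \<omega> \<partial>M)"
  shows "AE \<omega> in M. \<omega> \<in> Q \<longrightarrow> real_cond_exp M B f \<omega> \<le> h \<omega>"
proof -
  interpret sigma_finite_subalgebra M B
    by (rule sigma_finite_subalgebra_of_events[OF B])
  let ?e = "real_cond_exp M B f"
  define D where "D = {\<omega> \<in> space B. \<omega> \<in> Q \<and> h \<omega> < ?e \<omega>}"
  note [measurable] = Q h(2) borel_measurable_cond_exp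
  have D: "D \<in> sets B" unfolding D_def by measurable
  then have DM: "D \<in> sets M" using B by (auto simp: subalgebra_def)
  have sp: "space B = space M" using B by (simp add: subalgebra_def)
  have e: "integrable M ?e" by (rule real_cond_exp_int(1)[OF f])
  define k where "k = (\<lambda>\<omega>. indicator D \<omega> * (?e \<omega> - h \<omega>))"
  have ik: "integrable M (\<lambda>\<omega>. indicator D \<omega> * ?e \<omega>)" "integrable M (\<lambda>\<omega>. indicator D \<omega> * h \<omega>)"
    using integrable_mult_indicator[OF DM e] integrable_mult_indicator[OF DM h(1)] by auto
  have k_int: "integrable M k" unfolding k_def right_diff_distrib using ik by auto
  have k_pos: "0 \<le> k \<omega>" for \<omega> by (auto simp: k_def D_def indicator_def)
  have "(\<integral>\<omega>. k \<omega> \<partial>M) = (\<integral>\<omega>\<in>D. ?e \<omega> \<partial>M) - (\<integral>\<omega>\<in>D. h \<omega> \<partial>M)"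
    unfolding k_def right_diff_distrib set_lebesgue_integral_def using ik by simp
  also have "(\<integral>\<omega>\<in>D. ?e \<omega> \<partial>M) = (\<integral>\<omega>\<in>D. f \<omega> \<partial>M)"
    by (rule real_cond_exp_intA[OF f D, symmetric])
  also have "(\<integral>\<omega>\<in>D. f \<omega> \<partial>M) - (\<integral>\<omega>\<in>D. h \<omega> \<partial>M) \<le> 0"
    using le[OF D] by (auto simp: D_def)
  finally have "(\<integral>\<omega>. k \<omega> \<partial>M) = 0"
    using Bochner_Integration.integral_nonneg[of M k] k_pos by (simp add: antisym)
  then have "AE \<omega> in M. k \<omega> = 0"
    using integral_nonneg_eq_0_iff_AE[OF k_int] k_pos by simp
  with AE_space show ?thesis
    by eventually_elim (auto simp: k_def D_def indicator_def sp split: if_splits)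
qed

end

section \<open>Random times\<close>

text \<open>
  On the piece \<open>Q m\<close> of \<open>{\<tau> = m}\<close> the \<open>\<sigma>\<close>-algebra \<open>B\<close> knows no more than \<open>F m\<close>. The pieces cover almost
  everything, but not necessarily the event of an infinite stopping time, on which the finite
  value of \<open>\<tau>\<close> is arbitrary and \<open>B\<close> may know the whole future.
\<close>

definition sampled ::
    "'w measure \<Rightarrow> (nat \<Rightarrow> 'w measure) \<Rightarrow> 'w measure \<Rightarrow> ('w \<Rightarrow> nat) \<Rightarrow> (nat \<Rightarrow> 'w set) \<Rightarrow> bool" where
  "sampled M F B \<tau> Q \<longleftrightarrow> subalgebra M B \<and>
     (\<forall>m. Q m \<in> sets B \<and> (\<forall>\<omega>\<in>Q m. \<tau> \<omega> = m) \<and> (\<forall>D\<in>sets B. D \<inter> Q m \<in> sets (F m))) \<and>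
     (AE \<omega> in M. \<omega> \<in> Q (\<tau> \<omega>))"

text \<open>
  The reverse comparison. It holds on all of \<open>{\<tau> = m}\<close>, including the null event just described,
  and therefore gives measurability everywhere and not only almost everywhere.
\<close>

definition contains_at :: "'w measure \<Rightarrow> (nat \<Rightarrow> 'w measure) \<Rightarrow> 'w measure \<Rightarrow> ('w \<Rightarrow> nat) \<Rightarrow> bool" where
  "contains_at M F B \<tau> \<longleftrightarrow> (\<forall>m. \<forall>A\<in>sets (F m). A \<inter> {\<omega> \<in> space M. \<tau> \<omega> = m} \<in> sets B)"

lemma filtration_extended_filtration:
  assumes F: "\<And>m. subalgebra M (F m)" and mono: "\<And>m n. m \<le> n \<Longrightarrow> sets (F m) \<subseteq> sets (F n)"
  shows "filtration (space M) (extended_filtration M F)"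
proof
  have sub: "(\<Union>m. sets (F m)) \<subseteq> Pow (space M)"
    using F sets.space_closed by (force simp: subalgebra_def)
  show "space (extended_filtration M F i) = space M" for i
    using F sub by (cases i) (auto simp: extended_filtration_def subalgebra_def intro!: space_measure_of)
  show "sets (extended_filtration M F i) \<subseteq> sets (extended_filtration M F j)" if "i \<le> j" for i j
  proof (cases i; cases j)
    fix a assume "i = enat a" "j = \<infinity>"
    then show ?thesis using sub by (auto simp: extended_filtration_def)
  qed (use that mono in \<open>auto simp: extended_filtration_def\<close>)
qed

text \<open>
  For a stopping time \<open>\<sigma>\<close> the pieces are \<open>{\<sigma> = m}\<close>. On them the definition of the \<open>\<sigma>\<close>-algebra at
  time \<open>\<sigma>\<close> gives both comparisons.
\<close>

lemma fixed_or_stopping_sampled: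
  assumes F: "\<And>m. subalgebra M (F m)" and mono: "\<And>m n. m \<le> n \<Longrightarrow> sets (F m) \<subseteq> sets (F n)"
    and B\<tau>: "fixed_or_stopping M F B \<tau>"
  shows "(\<exists>Q. sampled M F B \<tau> Q) \<and> contains_at M F B \<tau>"
  using B\<tau> unfolding fixed_or_stopping_def
proof (elim disjE exE conjE)
  fix m assume m: "B = F m" "\<tau> = (\<lambda>_. m)"
  have sp: "space (F i) = space M" for i using F by (auto simp: subalgebra_def)
  have "sampled M F B \<tau> (\<lambda>i. if i = m then space M else {})"
    using F sets.top[of "F m"] unfolding m sampled_def by (auto simp: sp)
  moreover have "contains_at M F B \<tau>"
    unfolding contains_at_def
  proof (intro allI ballI)
    show "A \<inter> {\<omega> \<in> space M. \<tau> \<omega> = i} \<in> sets B" if "A \<in> sets (F i)" for i A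
      using that sets.top[of "F m"] by (cases "m = i") (auto simp: m sp)
  qed
  ultimately show ?thesis by auto
next
  fix \<sigma> :: "'a \<Rightarrow> enat"
  let ?F = "extended_filtration M F"
  interpret filtration "space M" ?F by (rule filtration_extended_filtration[OF F mono])
  assume \<sigma>: "stopping_time ?F \<sigma>" and fin: "AE \<omega> in M. \<sigma> \<omega> < \<infinity>"
    and B: "B = pre_sigma \<sigma>" and \<tau>: "\<tau> = (\<lambda>\<omega>. the_enat (\<sigma> \<omega>))"
  have sub: "(\<Union>m. sets (F m)) \<subseteq> Pow (space M)"
    using F sets.space_closed by (force simp: subalgebra_def)
  have F_fin: "?F (enat m) = F m" for m by (simp add: extended_filtration_def)
  have F_inf: "A \<in> sets M" if "A \<in> sets (?F \<infinity>)" for A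
  proof -
    have "sigma_sets (space M) (\<Union>m. sets (F m)) \<subseteq> sets M"
      using F by (intro sets.sigma_sets_subset) (auto simp: subalgebra_def)
    with that sub show ?thesis by (auto simp: extended_filtration_def)
  qed
  have setsB: "A \<in> sets B \<longleftrightarrow> (\<forall>t. {\<omega>\<in>A. \<sigma> \<omega> \<le> t} \<in> sets (?F t))" for A
    unfolding B sets_pre_sigma[OF \<sigma>] by simp
  have level: "{\<omega> \<in> space M. \<sigma> \<omega> = t} \<in> sets (?F t)" for t
  proof (cases t)
    case (enat k)
    have "Measurable.pred (?F t) (\<lambda>\<omega>. \<sigma> \<omega> \<le> t \<and> (\<forall>s\<in>{..<k}. \<not> \<sigma> \<omega> \<le> enat s))"
      by (intro pred_intros_logic pred_intros_countable_bounded stopping_time_le_const[OF \<sigma>])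
         (auto simp: enat)
    also have "(\<lambda>\<omega>. \<sigma> \<omega> \<le> t \<and> (\<forall>s\<in>{..<k}. \<not> \<sigma> \<omega> \<le> enat s)) = (\<lambda>\<omega>. \<sigma> \<omega> = t)"
    proof (intro ext)
      show "(\<sigma> \<omega> \<le> t \<and> (\<forall>s\<in>{..<k}. \<not> \<sigma> \<omega> \<le> enat s)) = (\<sigma> \<omega> = t)" for \<omega>
        unfolding enat by (cases "\<sigma> \<omega>") (simp_all add: Ball_def not_le, meson linorder_not_less order_le_less)
    qed
    finally show ?thesis by (simp add: pred_def space_F)
  next
    case infinity
    have "Measurable.pred (?F t) (\<lambda>\<omega>. \<forall>s::nat. \<not> \<sigma> \<omega> \<le> enat s)"
      by (intro pred_intros_logic pred_intros_countable stopping_time_le_const[OF \<sigma>])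
         (auto simp: infinity)
    also have "(\<lambda>\<omega>. \<forall>s::nat. \<not> \<sigma> \<omega> \<le> enat s) = (\<lambda>\<omega>. \<sigma> \<omega> = t)"
    proof (intro ext)
      show "(\<forall>s::nat. \<not> \<sigma> \<omega> \<le> enat s) = (\<sigma> \<omega> = t)" for \<omega>
        unfolding infinity by (cases "\<sigma> \<omega>") auto
    qed
    finally show ?thesis by (simp add: pred_def space_F)
  qed
  have piece: "A \<inter> {\<omega> \<in> space M. \<sigma> \<omega> = t} \<in> sets B" if "A \<in> sets (?F t)" for A t
  proof -
    have "A \<inter> {\<omega> \<in> space M. \<sigma> \<omega> = t} \<in> sets (?F s)" if "t \<le> s" for s
      using sets.Int[OF \<open>A \<in> sets (?F t)\<close> level] sets_F_mono[OF that] by auto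
    moreover have "{\<omega> \<in> A \<inter> {\<omega> \<in> space M. \<sigma> \<omega> = t}. \<sigma> \<omega> \<le> s} =
        (if t \<le> s then A \<inter> {\<omega> \<in> space M. \<sigma> \<omega> = t} else {})" for s by auto
    ultimately show ?thesis unfolding setsB by simp
  qed
  have BM: "subalgebra M B"
    unfolding subalgebra_def
  proof (intro conjI subsetI)
    show "space B = space M" unfolding B by (rule space_pre_sigma)
    show "A \<in> sets M" if "A \<in> sets B" for A
      using that setsB[of A] F_inf[of A] by (auto dest: spec[of _ "\<infinity>"])
  qed
  let ?Q = "\<lambda>m. {\<omega> \<in> space M. \<sigma> \<omega> = enat m}"
  have "sampled M F B \<tau> ?Q"
    unfolding sampled_def
  proof (intro conjI allI ballI BM)
    fix m
    show "?Q m \<in> sets B"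
      using piece[OF sets.top, of "enat m"] by (simp add: space_F Int_def)
    show "\<tau> \<omega> = m" if "\<omega> \<in> ?Q m" for \<omega> using that by (simp add: \<tau>)
    show "D \<inter> ?Q m \<in> sets (F m)" if D: "D \<in> sets B" for D
    proof -
      have "{\<omega>\<in>D. \<sigma> \<omega> \<le> enat m} \<inter> ?Q m \<in> sets (?F (enat m))"
        using D level[of "enat m"] unfolding setsB by blast
      also have "{\<omega>\<in>D. \<sigma> \<omega> \<le> enat m} \<inter> ?Q m = D \<inter> ?Q m" by auto
      finally show ?thesis by (simp add: F_fin)
    qed
  next
    show "AE \<omega> in M. \<omega> \<in> ?Q (\<tau> \<omega>)"
      using fin AE_space by eventually_elim (auto simp: \<tau>)
  qed
  moreover have "contains_at M F B \<tau>"
    unfolding contains_at_def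
  proof (intro allI ballI)
    fix m A assume A: "A \<in> sets (F m)"
    have 1: "A \<inter> {\<omega> \<in> space M. \<sigma> \<omega> = enat m} \<in> sets B"
      using A by (intro piece) (simp add: F_fin)
    have "A \<in> sets (?F \<infinity>)" using A sets_F_mono[of "enat m" \<infinity>] by (auto simp: F_fin)
    then have 2: "A \<inter> {\<omega> \<in> space M. \<sigma> \<omega> = \<infinity>} \<in> sets B" by (rule piece)
    \<comment> \<open>The value of \<open>the_enat\<close> at infinity may be \<open>m\<close>; then the null event \<open>\<sigma> = \<infinity>\<close> belongs to \<open>\<tau> = m\<close>.\<close>
    have "A \<inter> {\<omega> \<in> space M. \<tau> \<omega> = m} = A \<inter> {\<omega> \<in> space M. \<sigma> \<omega> = enat m} \<union>
        (if the_enat \<infinity> = m then A \<inter> {\<omega> \<in> space M. \<sigma> \<omega> = \<infinity>} else {})"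
    proof (rule Set.set_eqI)
      show "\<omega> \<in> A \<inter> {\<omega> \<in> space M. \<tau> \<omega> = m} \<longleftrightarrow> \<omega> \<in> A \<inter> {\<omega> \<in> space M. \<sigma> \<omega> = enat m} \<union>
        (if the_enat \<infinity> = m then A \<inter> {\<omega> \<in> space M. \<sigma> \<omega> = \<infinity>} else {})" for \<omega>
        by (cases "\<sigma> \<omega>") (auto simp: \<tau>)
    qed
    with 1 2 show "A \<inter> {\<omega> \<in> space M. \<tau> \<omega> = m} \<in> sets B" by auto
  qed
  ultimately show ?thesis by auto
qed

text \<open>
  A process may be evaluated at \<open>\<tau>\<close>: the preimage of a set is the union over \<open>m\<close> of the preimages at
  time \<open>m\<close>, cut down to \<open>{\<tau> = m}\<close>.
\<close>

lemma measurable_at_random_time: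
  assumes B: "space B = space M" and F: "\<And>m. space (F m) = space M"
    and cont: "contains_at M F B \<tau>"
    and f: "\<And>m. f m \<in> F m \<rightarrow>\<^sub>M L"
  shows "(\<lambda>\<omega>. f (\<tau> \<omega>) \<omega>) \<in> B \<rightarrow>\<^sub>M L"
proof (rule measurableI)
  show "f (\<tau> \<omega>) \<omega> \<in> space L" if "\<omega> \<in> space B" for \<omega>
    using measurable_space[OF f, of \<omega> "\<tau> \<omega>"] that B F by auto
  fix A assume A: "A \<in> sets L"
  have "(\<lambda>\<omega>. f (\<tau> \<omega>) \<omega>) -` A \<inter> space B =
      (\<Union>m. (f m -` A \<inter> space (F m)) \<inter> {\<omega> \<in> space M. \<tau> \<omega> = m})"
    using B F by auto
  also have "\<dots> \<in> sets B"
    using measurable_sets[OF f A] cont unfolding contains_at_def by (intro sets.countable_UN) auto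
  finally show "(\<lambda>\<omega>. f (\<tau> \<omega>) \<omega>) -` A \<inter> space B \<in> sets B" .
qed

lemma sampled_time_measurable:
  assumes S: "sampled M F B \<tau> Q" and cont: "contains_at M F B \<tau>" and F: "\<And>m. space (F m) = space M"
  shows "{\<omega> \<in> space M. \<tau> \<omega> = m} \<in> sets B"
  using cont[unfolded contains_at_def, rule_format, of "space M" m] sets.top[of "F m"] F
  by (auto simp: Int_def)

text \<open>
  The trivial filtration \<open>\<lambda>_. M\<close> makes the previous lemmas applicable to random variables that
  are merely measurable.
\<close>

lemma contains_at_events:
  assumes S: "sampled M F B \<tau> Q" and cont: "contains_at M F B \<tau>" and F: "\<And>m. space (F m) = space M"
  shows "contains_at M (\<lambda>_. M) M \<tau>"
  unfolding contains_at_def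
proof (intro allI ballI sets.Int)
  show "{\<omega> \<in> space M. \<tau> \<omega> = m} \<in> sets M" for m
    using sampled_time_measurable[OF S cont F, of m] S by (auto simp: sampled_def subalgebra_def)
qed

context prob_space
begin

text \<open>
  To identify a conditional probability given the \<open>\<sigma>\<close>-algebra at a random time, it suffices to
  integrate over events of fixed time.
\<close>

lemma sampled_prob_given_eq:
  assumes S: "sampled M F B \<tau> Q" and R: "R \<in> sets B" and W: "W \<in> events"
    and h: "integrable M h" "h \<in> borel_measurable B"
    and eq: "\<And>m D. D \<in> sets (F m) \<Longrightarrow> D \<in> events \<Longrightarrow> D \<subseteq> Q m \<Longrightarrow> D \<subseteq> R \<Longrightarrow> prob (D \<inter> W) = (\<integral>\<omega>\<in>D. h \<omega> \<partial>M)"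
  shows "AE \<omega> in M. \<omega> \<in> R \<longrightarrow> prob_given M B W \<omega> = h \<omega>"
proof -
  have sub: "subalgebra M B" using S by (simp add: sampled_def)
  then have ev: "D \<in> events" if "D \<in> sets B" for D using that by (auto simp: subalgebra_def)
  have "AE \<omega> in M. \<omega> \<in> Q m \<inter> R \<longrightarrow> real_cond_exp M B (indicator W) \<omega> = h \<omega>" for m
  proof (rule cond_exp_eq_on[OF sub _ _ h])
    show "Q m \<inter> R \<in> sets B" using S R by (auto simp: sampled_def)
    show "integrable M (indicator W :: 'a \<Rightarrow> real)" 
      using W by (auto simp: emeasure_eq_measure intro!: integrable_real_indicator)
    fix D assume D: "D \<in> sets B" "D \<subseteq> Q m \<inter> R"
    then have "D \<inter> Q m \<in> sets (F m)" using S by (auto simp: sampled_def)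
    with D have "D \<in> sets (F m)" by (simp add: Int_absorb2)
    then show "(\<integral>\<omega>\<in>D. indicator W \<omega> \<partial>M) = (\<integral>\<omega>\<in>D. h \<omega> \<partial>M)"
      using D ev W eq by (simp add: set_integral_indicator)
  qed
  then have "AE \<omega> in M. \<forall>m. \<omega> \<in> Q m \<inter> R \<longrightarrow> real_cond_exp M B (indicator W) \<omega> = h \<omega>"
    unfolding AE_all_countable by (rule allI)
  moreover have "AE \<omega> in M. \<omega> \<in> Q (\<tau> \<omega>)" using S by (simp add: sampled_def)
  ultimately show ?thesis
    unfolding prob_given_def by eventually_elim auto
qed

lemma sampled_cond_exp_le:
  fixes f h :: "'a \<Rightarrow> real"
  assumes S: "sampled M F B \<tau> Q" and f: "integrable M f"
    and h: "integrable M h" "h \<in> borel_measurable B"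
    and le: "\<And>m D. D \<in> sets (F m) \<Longrightarrow> D \<in> events \<Longrightarrow> D \<subseteq> Q m \<Longrightarrow> (\<integral>\<omega>\<in>D. f \<omega> \<partial>M) \<le> (\<integral>\<omega>\<in>D. h \<omega> \<partial>M)"
  shows "AE \<omega> in M. real_cond_exp M B f \<omega> \<le> h \<omega>"
proof -
  have sub: "subalgebra M B" using S by (simp add: sampled_def)
  then have ev: "D \<in> events" if "D \<in> sets B" for D using that by (auto simp: subalgebra_def)
  have "AE \<omega> in M. \<omega> \<in> Q m \<longrightarrow> real_cond_exp M B f \<omega> \<le> h \<omega>" for m
  proof (rule cond_exp_le_on[OF sub _ f h])
    show "Q m \<in> sets B" using S by (auto simp: sampled_def)
    fix D assume D: "D \<in> sets B" "D \<subseteq> Q m"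
    then have "D \<inter> Q m \<in> sets (F m)" using S by (auto simp: sampled_def)
    with D have "D \<in> sets (F m)" by (simp add: Int_absorb2)
    then show "(\<integral>\<omega>\<in>D. f \<omega> \<partial>M) \<le> (\<integral>\<omega>\<in>D. h \<omega> \<partial>M)" using D ev le by simp
  qed
  then have "AE \<omega> in M. \<forall>m. \<omega> \<in> Q m \<longrightarrow> real_cond_exp M B f \<omega> \<le> h \<omega>"
    unfolding AE_all_countable by (rule allI)
  moreover have "AE \<omega> in M. \<omega> \<in> Q (\<tau> \<omega>)" using S by (simp add: sampled_def)
  ultimately show ?thesis by eventually_elim auto
qed

end

section \<open>Path laws of inhomogeneous chains\<close>

abbreviation path_space :: "'a measure \<Rightarrow> nat \<Rightarrow> (nat \<Rightarrow> 'a) measure" where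
  "path_space E n \<equiv> (\<Pi>\<^sub>M k\<in>{0..n}. E)"

lemma measurable_path_extend:
  "(\<lambda>(p, y). p(Suc n := y)) \<in> path_space E n \<Otimes>\<^sub>M E \<rightarrow>\<^sub>M path_space E (Suc n)"
  using measurable_add_dim[of "Suc n" "{0..n}" "\<lambda>_. E"] by (simp add: atLeast0_atMost_Suc)

lemma measurable_markov_law:
  assumes K: "\<And>k. 1 \<le> k \<Longrightarrow> k \<le> n \<Longrightarrow> (\<lambda>(\<omega>, x). K \<omega> k x) \<in> D \<Otimes>\<^sub>M E \<rightarrow>\<^sub>M prob_algebra E"
    and x: "x \<in> D \<rightarrow>\<^sub>M E"
  shows "(\<lambda>\<omega>. markov_law E (K \<omega>) (x \<omega>) n) \<in> D \<rightarrow>\<^sub>M prob_algebra (path_space E n)"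
  using K
proof (induction n)
  case 0
  have "(\<lambda>\<omega>. \<lambda>k\<in>{0..0}. x \<omega>) \<in> D \<rightarrow>\<^sub>M path_space E 0"
    using x by (intro measurable_restrict)
  from measurable_compose[OF this measurable_return_prob_space] show ?case
    unfolding markov_law.simps .
next
  case (Suc n)
  have IH: "(\<lambda>\<omega>. markov_law E (K \<omega>) (x \<omega>) n) \<in> D \<rightarrow>\<^sub>M prob_algebra (path_space E n)"
    using Suc by simp
  have proj: "(\<lambda>p. p n) \<in> path_space E n \<rightarrow>\<^sub>M E"
    by (rule measurable_component_singleton) simp
  have K1: "(\<lambda>(\<omega>, p). K \<omega> (Suc n) (p n)) \<in> D \<Otimes>\<^sub>M path_space E n \<rightarrow>\<^sub>M prob_algebra E"
  proof -
    have "(\<lambda>z. (fst z, (snd z) n)) \<in> D \<Otimes>\<^sub>M path_space E n \<rightarrow>\<^sub>M D \<Otimes>\<^sub>M E"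
      using measurable_compose[OF measurable_snd proj] by (intro measurable_Pair) auto
    from measurable_compose[OF this Suc.prems[of "Suc n"]] show ?thesis
      by (simp add: case_prod_beta')
  qed
  have ext: "(\<lambda>(z, y). (snd z)(Suc n := y))
      \<in> (D \<Otimes>\<^sub>M path_space E n) \<Otimes>\<^sub>M E \<rightarrow>\<^sub>M path_space E (Suc n)"
  proof -
    have "(\<lambda>z. (snd (fst z), snd z)) \<in> (D \<Otimes>\<^sub>M path_space E n) \<Otimes>\<^sub>M E \<rightarrow>\<^sub>M path_space E n \<Otimes>\<^sub>M E"
      by measurable
    from measurable_compose[OF this measurable_path_extend] show ?thesis
      by (simp add: case_prod_beta')
  qed
  have "(\<lambda>z. distr (K (fst z) (Suc n) ((snd z) n)) (path_space E (Suc n)) (\<lambda>y. (snd z)(Suc n := y)))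
      \<in> D \<Otimes>\<^sub>M path_space E n \<rightarrow>\<^sub>M prob_algebra (path_space E (Suc n))"
    using K1 ext by (intro measurable_distr_prob_space2[where M = E]) (auto simp: case_prod_beta')
  then show ?case
    using IH by (simp add: case_prod_beta' measurable_bind_prob_space2)
qed

lemma markov_law_prob_algebra:
  assumes "\<And>k. 1 \<le> k \<Longrightarrow> k \<le> n \<Longrightarrow> K k \<in> E \<rightarrow>\<^sub>M prob_algebra E" and x: "x \<in> space E"
  shows "markov_law E K x n \<in> space (prob_algebra (path_space E n))"
proof -
  have "(\<lambda>x. markov_law E K x n) \<in> E \<rightarrow>\<^sub>M prob_algebra (path_space E n)"
    using assms(1) by (intro measurable_markov_law) (auto simp: case_prod_beta' intro: measurable_compose[OF measurable_snd])
  from measurable_space[OF this x] show ?thesis .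
qed

text \<open>
  The chain is built by appending steps at the end, so the last step can be integrated out first.
\<close>

lemma nn_integral_markov_law_Suc:
  assumes K: "\<And>k. 1 \<le> k \<Longrightarrow> k \<le> Suc n \<Longrightarrow> K k \<in> E \<rightarrow>\<^sub>M prob_algebra E" and x: "x \<in> space E"
    and h: "h \<in> borel_measurable (path_space E (Suc n))"
  shows "(\<integral>\<^sup>+q. h q \<partial>markov_law E K x (Suc n)) =
    (\<integral>\<^sup>+p. \<integral>\<^sup>+y. h (p(Suc n := y)) \<partial>K (Suc n) (p n) \<partial>markov_law E K x n)"
proof -
  have L: "markov_law E K x n \<in> space (prob_algebra (path_space E n))"
    using K x by (intro markov_law_prob_algebra) auto
  then have setsL: "sets (markov_law E K x n) = sets (path_space E n)"
    by (simp add: space_prob_algebra)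
  have proj: "(\<lambda>p. p n) \<in> path_space E n \<rightarrow>\<^sub>M E"
    by (rule measurable_component_singleton) simp
  have "(\<lambda>p. distr (K (Suc n) (p n)) (path_space E (Suc n)) (\<lambda>y. p(Suc n := y)))
      \<in> path_space E n \<rightarrow>\<^sub>M prob_algebra (path_space E (Suc n))"
    using measurable_compose[OF proj K[of "Suc n"]] measurable_path_extend
    by (intro measurable_distr_prob_space2[where M = E]) auto
  then have B: "(\<lambda>p. distr (K (Suc n) (p n)) (path_space E (Suc n)) (\<lambda>y. p(Suc n := y)))
      \<in> markov_law E K x n \<rightarrow>\<^sub>M subprob_algebra (path_space E (Suc n))"
    using measurable_cong_sets[OF setsL refl] by (auto intro: measurable_prob_algebraD)
  have "(\<integral>\<^sup>+q. h q \<partial>markov_law E K x (Suc n)) =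
    (\<integral>\<^sup>+p. \<integral>\<^sup>+q. h q \<partial>distr (K (Suc n) (p n)) (path_space E (Suc n)) (\<lambda>y. p(Suc n := y)) \<partial>markov_law E K x n)"
    using nn_integral_bind[OF h B] by simp
  also have "\<dots> = (\<integral>\<^sup>+p. \<integral>\<^sup>+y. h (p(Suc n := y)) \<partial>K (Suc n) (p n) \<partial>markov_law E K x n)"
  proof (rule nn_integral_cong)
    fix p assume "p \<in> space (markov_law E K x n)"
    then have p: "p \<in> space (path_space E n)" using sets_eq_imp_space_eq[OF setsL] by simp
    then have "p n \<in> space E" using measurable_space[OF proj] by simp
    then have "K (Suc n) (p n) \<in> space (prob_algebra E)" using measurable_space[OF K[of "Suc n"]] by simp
    then have sK: "sets (K (Suc n) (p n)) = sets E" by (simp add: space_prob_algebra)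
    have "(\<lambda>y. p(Suc n := y)) \<in> E \<rightarrow>\<^sub>M path_space E (Suc n)"
      using measurable_compose[OF measurable_Pair1'[OF p] measurable_path_extend] by simp
    then have "(\<lambda>y. p(Suc n := y)) \<in> K (Suc n) (p n) \<rightarrow>\<^sub>M path_space E (Suc n)"
      using measurable_cong_sets[OF sK refl] by auto
    then show "(\<integral>\<^sup>+q. h q \<partial>distr (K (Suc n) (p n)) (path_space E (Suc n)) (\<lambda>y. p(Suc n := y))) =
        (\<integral>\<^sup>+y. h (p(Suc n := y)) \<partial>K (Suc n) (p n))"
      using h by (subst nn_integral_distr) auto
  qed
  finally show ?thesis .
qed

lemma integral_markov_law_Suc:
  fixes f :: "'a \<Rightarrow> real"
  assumes K: "\<And>k. 1 \<le> k \<Longrightarrow> k \<le> Suc n \<Longrightarrow> K k \<in> E \<rightarrow>\<^sub>M prob_algebra E" and x: "x \<in> space E"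
    and f: "f \<in> borel_measurable E" "\<And>y. y \<in> space E \<Longrightarrow> 0 \<le> f y" "\<And>y. y \<in> space E \<Longrightarrow> f y \<le> 1"
  shows "(\<integral>p. f (p (Suc n)) \<partial>markov_law E K x (Suc n)) = (\<integral>p. (\<integral>y. f y \<partial>K (Suc n) (p n)) \<partial>markov_law E K x n)"
proof -
  have L: "prob_space (markov_law E K x k)" and Ls: "sets (markov_law E K x k) = sets (path_space E k)" if "k \<le> Suc n" for k
    using markov_law_prob_algebra[of k K E x] K x that by (auto simp: space_prob_algebra)
  have proj: "(\<lambda>p. p k) \<in> markov_law E K x k \<rightarrow>\<^sub>M E" if "k \<le> Suc n" for k
    unfolding measurable_cong_sets[OF Ls[OF that] refl] by (rule measurable_component_singleton) simp
  have fint: "(\<integral>\<^sup>+y. ennreal (f y) \<partial>\<nu>) = ennreal (\<integral>y. f y \<partial>\<nu>)" "0 \<le> (\<integral>y. f y \<partial>\<nu>)" "(\<integral>y. f y \<partial>\<nu>) \<le> 1"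
    if "\<nu> \<in> space (prob_algebra E)" for \<nu>
  proof -
    interpret \<nu>: prob_space \<nu> using that by (simp add: space_prob_algebra)
    have s: "sets \<nu> = sets E" using that by (simp add: space_prob_algebra)
    have sp: "space \<nu> = space E" using s by (rule sets_eq_imp_space_eq)
    have fm: "f \<in> borel_measurable \<nu>" using f(1) measurable_cong_sets[OF s refl] by blast
    have i: "integrable \<nu> f" using fm f(2,3) sp by (intro \<nu>.integrable_const_bound[where B = 1]) auto
    show "(\<integral>\<^sup>+y. ennreal (f y) \<partial>\<nu>) = ennreal (\<integral>y. f y \<partial>\<nu>)"
      using i f(2) sp by (intro nn_integral_eq_integral) auto
    show "0 \<le> (\<integral>y. f y \<partial>\<nu>)" using f(2) sp by (intro Bochner_Integration.integral_nonneg) auto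
    have "(\<integral>y. f y \<partial>\<nu>) \<le> (\<integral>y. 1 \<partial>\<nu>)" using i f(3) sp by (intro integral_mono) auto
    then show "(\<integral>y. f y \<partial>\<nu>) \<le> 1" by (simp add: \<nu>.prob_space)
  qed
  have Kf: "(\<lambda>z. \<integral>y. f y \<partial>K (Suc n) z) \<in> borel_measurable E"
    by (rule measurable_compose[OF measurable_prob_algebraD[OF K] integral_measurable_subprob_algebra[OF f(1)]]) auto
  have Kz: "K (Suc n) (p n) \<in> space (prob_algebra E)" if "p \<in> space (markov_law E K x n)" for p
    using measurable_space[OF K measurable_space[OF proj that]] by simp
  interpret L1: prob_space "markov_law E K x (Suc n)" by (rule L) simp
  interpret L0: prob_space "markov_law E K x n" by (rule L) simp
  have i1: "integrable (markov_law E K x (Suc n)) (\<lambda>p. f (p (Suc n)))"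
    using measurable_compose[OF proj f(1), of "Suc n"] f(2,3) measurable_space[OF proj, of "Suc n"]
    by (intro L1.integrable_const_bound[where B = 1]) auto
  have i0: "integrable (markov_law E K x n) (\<lambda>p. \<integral>y. f y \<partial>K (Suc n) (p n))"
    using measurable_compose[OF proj Kf, of n] fint(2,3)[OF Kz]
    by (intro L0.integrable_const_bound[where B = 1]) auto
  have "ennreal (\<integral>p. f (p (Suc n)) \<partial>markov_law E K x (Suc n)) = (\<integral>\<^sup>+p. ennreal (f (p (Suc n))) \<partial>markov_law E K x (Suc n))"
    using i1 f(2) measurable_space[OF proj, of "Suc n"] by (intro nn_integral_eq_integral[symmetric]) auto
  also have "\<dots> = (\<integral>\<^sup>+p. \<integral>\<^sup>+y. ennreal (f ((p(Suc n := y)) (Suc n))) \<partial>K (Suc n) (p n) \<partial>markov_law E K x n)"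
    using f(1) by (intro nn_integral_markov_law_Suc[OF K x]) auto
  also have "\<dots> = (\<integral>\<^sup>+p. ennreal (\<integral>y. f y \<partial>K (Suc n) (p n)) \<partial>markov_law E K x n)"
    by (rule nn_integral_cong) (simp add: fint(1)[OF Kz])
  also have "\<dots> = ennreal (\<integral>p. (\<integral>y. f y \<partial>K (Suc n) (p n)) \<partial>markov_law E K x n)"
    using i0 fint(2)[OF Kz] by (intro nn_integral_eq_integral) auto
  finally show ?thesis
    using f(2) measurable_space[OF proj, of "Suc n"] fint(2)[OF Kz]
    by (subst (asm) ennreal_inj) (auto intro!: Bochner_Integration.integral_nonneg)
qed

section \<open>Independent sources of randomness\<close>

text \<open>
  Names for the variables from which the walk is built: the transformations \<open>\<Theta>\<close>, the labels
  \<open>g\<^sub>i\<close>, the coins \<open>\<xi>\<^sub>j\<close> and the targets \<open>u\<^sub>j\<close>.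
\<close>

datatype source = Transf | Label nat | Coin nat | Target nat

context srrw
begin

lemma space_\<mu> [simp]: "space \<mu> = space E"
  using step_law(2) by (rule sets_eq_imp_space_eq)

lemma g_measurable: "1 \<le> i \<Longrightarrow> g i \<in> M \<rightarrow>\<^sub>M E"
  using g_indep by (auto simp: indep_vars_def2)

lemma \<xi>_measurable: "2 \<le> j \<Longrightarrow> \<xi> j \<in> M \<rightarrow>\<^sub>M count_space UNIV"
  using \<xi>_indep by (auto simp: indep_vars_def2)

lemma u_measurable: "2 \<le> j \<Longrightarrow> u j \<in> M \<rightarrow>\<^sub>M count_space UNIV"
  using u_indep by (auto simp: indep_vars_def2)

primrec source_sets :: "source \<Rightarrow> 'w set set" where
  "source_sets Transf = {\<Theta> -` B \<inter> space M | B. B \<in> sets N}"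
| "source_sets (Label i) = {g i -` B \<inter> space M | B. B \<in> sets E}"
| "source_sets (Coin j) = {\<xi> j -` B \<inter> space M | B. B \<in> sets (count_space UNIV)}"
| "source_sets (Target j) = {u j -` B \<inter> space M | B. B \<in> sets (count_space UNIV)}"

definition sources :: "source set" where
  "sources = {Transf} \<union> Label ` {1..} \<union> Coin ` {2..} \<union> Target ` {2..}"

lemma source_sets_events: "s \<in> sources \<Longrightarrow> source_sets s \<subseteq> events"
  using g_measurable \<xi>_measurable u_measurable \<Theta>_measurable
  by (auto simp: sources_def intro: measurable_sets)

lemma Int_stable_source_sets: "Int_stable (source_sets s)"
proof -
  have *: "Int_stable {Y -` B \<inter> space M | B. B \<in> sets L}" for Y :: "'w \<Rightarrow> 'b" and L
  proof (rule Int_stableI, safe)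
    fix A B assume "A \<in> sets L" "B \<in> sets L"
    then show "\<exists>C. Y -` A \<inter> space M \<inter> (Y -` B \<inter> space M) = Y -` C \<inter> space M \<and> C \<in> sets L"
      by (intro exI[of _ "A \<inter> B"]) auto
  qed
  show ?thesis by (cases s) (simp_all only: source_sets.simps *)
qed

lemma indep_family_in_generated:
  assumes indep: "indep_vars (\<lambda>_. L) Y I" and J: "finite J" "J \<subseteq> I"
    and A: "\<And>i. i \<in> J \<Longrightarrow> A i \<in> {Y i -` B \<inter> space M | B. B \<in> sets L}"
  shows "space M \<inter> (\<Inter>i\<in>J. A i) \<in> sets (generated M L I Y)"
    and "prob (space M \<inter> (\<Inter>i\<in>J. A i)) = (\<Prod>i\<in>J. prob (A i))"
proof -
  have sub: "(\<Union>i\<in>I. {Y i -` B \<inter> space M | B. B \<in> sets L}) \<subseteq> Pow (space M)" by auto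
  have "A i \<in> sets (generated M L I Y)" if "i \<in> J" for i
    unfolding generated_def sets_measure_of[OF sub] 
    by (rule sigma_sets.Basic, rule UN_I, rule subsetD[OF J(2) that], rule A[OF that])
  then show "space M \<inter> (\<Inter>i\<in>J. A i) \<in> sets (generated M L I Y)"
    using J(1) sets.top[of "generated M L I Y"]
    by (cases "J = {}") (simp, intro sets.Int sets.finite_INT, simp_all)
  show "prob (space M \<inter> (\<Inter>i\<in>J. A i)) = (\<Prod>i\<in>J. prob (A i))"
  proof (cases "J = {}")
    case False
    have "space M \<inter> (\<Inter>i\<in>J. A i) = (\<Inter>i\<in>J. A i)"
      using False A by fastforce
    moreover have "prob (\<Inter>i\<in>J. A i) = (\<Prod>i\<in>J. prob (A i))"
      using indep A J False unfolding indep_vars_def2 by (intro indep_setsD) auto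
    ultimately show ?thesis by simp
  qed (simp add: prob_space)
qed

text \<open>
  Independence of the four groups combines with independence inside each group: an intersection
  of events from finitely many sources is the intersection of one event per group, and the
  probability of each of these four events factorises further.
\<close>

lemma indep_source_sets: "indep_sets source_sets sources"
proof (rule indep_setsI)
  show "source_sets s \<subseteq> events" if "s \<in> sources" for s using source_sets_events[OF that] .
  fix A J assume J: "J \<noteq> {}" "J \<subseteq> sources" "finite J" and A: "\<forall>j\<in>J. A j \<in> source_sets j"
  define Jg where "Jg = Label -` J"
  define Jx where "Jx = Coin -` J"
  define Ju where "Ju = Target -` J"
  define Jt where "Jt = J \<inter> {Transf}"
  have J_split: "J = Label ` Jg \<union> Coin ` Jx \<union> Target ` Ju \<union> Jt"
  proof (rule Set.set_eqI)
    show "s \<in> J \<longleftrightarrow> s \<in> Label ` Jg \<union> Coin ` Jx \<union> Target ` Ju \<union> Jt" for s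
      by (cases s) (auto simp: Jg_def Jx_def Ju_def Jt_def)
  qed
  have J_split': "Label ` Jg \<union> Coin ` Jx \<union> Target ` Ju \<union> Jt = J" using J_split by simp
  have disj: "Label ` Jg \<inter> Coin ` Jx = {}" "(Label ` Jg \<union> Coin ` Jx) \<inter> Target ` Ju = {}"
    "(Label ` Jg \<union> Coin ` Jx \<union> Target ` Ju) \<inter> Jt = {}"
    by (auto simp: Jt_def)
  have fin: "finite Jg" "finite Jx" "finite Ju" "finite Jt"
    unfolding Jg_def Jx_def Ju_def Jt_def using J(3) by (auto intro!: finite_vimageI inj_onI)
  have sub: "Jg \<subseteq> {1..}" "Jx \<subseteq> {2..}" "Ju \<subseteq> {2..}"
    using J(2) unfolding Jg_def Jx_def Ju_def sources_def by auto
  define Bg where "Bg = space M \<inter> (\<Inter>i\<in>Jg. A (Label i))"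
  define Bx where "Bx = space M \<inter> (\<Inter>j\<in>Jx. A (Coin j))"
  define Bu where "Bu = space M \<inter> (\<Inter>j\<in>Ju. A (Target j))"
  define Bt where "Bt = space M \<inter> (\<Inter>s\<in>Jt. A s)"
  have Ag: "A (Label i) \<in> {g i -` B \<inter> space M | B. B \<in> sets E}" if "i \<in> Jg" for i
    using A[THEN bspec, of "Label i"] that by (simp add: Jg_def)
  have Ax: "A (Coin j) \<in> {\<xi> j -` B \<inter> space M | B. B \<in> sets (count_space UNIV)}" if "j \<in> Jx" for j
    using A[THEN bspec, of "Coin j"] that by (simp add: Jx_def)
  have Au: "A (Target j) \<in> {u j -` B \<inter> space M | B. B \<in> sets (count_space UNIV)}" if "j \<in> Ju" for j
    using A[THEN bspec, of "Target j"] that by (simp add: Ju_def)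
  note Bg = indep_family_in_generated[OF g_indep fin(1) sub(1) Ag, folded Bg_def]
  note Bx = indep_family_in_generated[OF \<xi>_indep fin(2) sub(2) Ax, folded Bx_def]
  note Bu = indep_family_in_generated[OF u_indep fin(3) sub(3) Au, folded Bu_def]
  have \<Theta>_sp: "\<Theta> \<in> space M \<rightarrow> space N" using \<Theta>_measurable by (auto dest: measurable_space)
  have Bt: "Bt \<in> sets (vimage_algebra (space M) \<Theta> N)" "prob Bt = (\<Prod>s\<in>Jt. prob (A s))"
  proof -
    have "Jt = {} \<or> Jt = {Transf}" by (auto simp: Jt_def)
    then have "(Jt = {} \<and> Bt = space M) \<or> (Jt = {Transf} \<and> Bt = A Transf \<and> A Transf \<in> source_sets Transf)"
    proof
      assume t: "Jt = {Transf}"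
      then have "Transf \<in> J" by (auto simp: Jt_def)
      with A have "A Transf \<in> source_sets Transf" by (rule bspec)
      with t show ?thesis by (auto simp: Bt_def)
    qed (auto simp: Bt_def)
    moreover have "space M \<in> sets (vimage_algebra (space M) \<Theta> N)"
      using sets.top[of "vimage_algebra (space M) \<Theta> N"] by simp
    ultimately show "Bt \<in> sets (vimage_algebra (space M) \<Theta> N)" "prob Bt = (\<Prod>s\<in>Jt. prob (A s))"
      using \<Theta>_sp by (auto simp: sets_vimage_algebra2 prob_space)
  qed
  let ?B = "\<lambda>i::nat. [Bg, Bx, Bu, Bt] ! i"
  have "prob (\<Inter>i\<in>{0, 1, 2, 3::nat}. ?B i) = (\<Prod>i\<in>{0, 1, 2, 3::nat}. prob (?B i))"
    using Bg(1) Bx(1) Bu(1) Bt(1) by (intro indep_setsD[OF sequences_indep]) auto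
  then have "prob (Bg \<inter> Bx \<inter> Bu \<inter> Bt) = prob Bg * prob Bx * prob Bu * prob Bt"
    by (simp add: numeral_2_eq_2 numeral_3_eq_3 Int_assoc mult.assoc)
  also have "Bg \<inter> Bx \<inter> Bu \<inter> Bt = (\<Inter>j\<in>J. A j)"
  proof -
    have "(\<Inter>j\<in>J. A j) = space M \<inter> (\<Inter>j\<in>J. A j)"
    proof -
      obtain s where s: "s \<in> J" using J(1) by auto
      then have "A s \<subseteq> space M" using A source_sets_events[of s] J(2) sets.sets_into_space by blast
      with s show ?thesis by auto
    qed
    also have "\<dots> = Bg \<inter> Bx \<inter> Bu \<inter> Bt"
      unfolding Bg_def Bx_def Bu_def Bt_def by (subst J_split) auto
    finally show ?thesis by simp
  qed
  also have "prob Bg * prob Bx * prob Bu * prob Bt = (\<Prod>j\<in>J. prob (A j))"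
  proof -
    have "(\<Prod>j\<in>J. prob (A j)) = (\<Prod>s\<in>Label ` Jg. prob (A s)) * (\<Prod>s\<in>Coin ` Jx. prob (A s))
        * (\<Prod>s\<in>Target ` Ju. prob (A s)) * (\<Prod>s\<in>Jt. prob (A s))"
      unfolding J_split'[symmetric] using fin disj by (simp add: prod.union_disjoint)
    also have "\<dots> = prob Bg * prob Bx * prob Bu * prob Bt"
      by (simp add: Bg Bx Bu Bt prod.reindex inj_on_def)
    finally show ?thesis by simp
  qed
  finally show "prob (\<Inter>j\<in>J. A j) = (\<Prod>j\<in>J. prob (A j))" .
qed

definition info :: "source set \<Rightarrow> 'w measure" where
  "info L = sigma (space M) (\<Union>s\<in>L. source_sets s)"

lemma source_sets_sub: "(\<Union>s\<in>L. source_sets s) \<subseteq> Pow (space M)"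
proof -
  have "source_sets s \<subseteq> Pow (space M)" for s by (cases s) auto
  then show ?thesis by blast
qed

lemma space_info [simp]: "space (info L) = space M"
  unfolding info_def by (rule space_measure_of[OF source_sets_sub])

lemma sets_info: "sets (info L) = sigma_sets (space M) (\<Union>s\<in>L. source_sets s)"
  unfolding info_def by (rule sets_measure_of[OF source_sets_sub])

lemma info_mono: "L \<subseteq> L' \<Longrightarrow> sets (info L) \<subseteq> sets (info L')"
  unfolding sets_info by (rule sigma_sets_mono') auto

lemma subalgebra_info:
  assumes "L \<subseteq> sources"
  shows "subalgebra M (info L)"
proof -
  have "(\<Union>s\<in>L. source_sets s) \<subseteq> events"
    by (rule UN_least) (use assms source_sets_events in auto)
  then have "sets (info L) \<subseteq> events" unfolding sets_info by (rule sets.sigma_sets_subset)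
  then show ?thesis by (simp add: subalgebra_def)
qed

text \<open>
  The only form in which independence is used below. It is applied to one label and all other
  sources, and to the pair of a coin and a target and all other sources.
\<close>

lemma info_indep:
  assumes L: "L \<inter> L' = {}" "L \<subseteq> sources" "L' \<subseteq> sources"
    and A: "A \<in> sets (info L)" and A': "A' \<in> sets (info L')"
  shows "prob (A \<inter> A') = prob A * prob A'"
proof -
  have "indep_sets (\<lambda>b. sigma_sets (space M) (\<Union>s\<in>case_bool L L' b. source_sets s)) UNIV"
  proof (rule indep_sets_collect_sigma)
    show "indep_sets source_sets (\<Union>b\<in>UNIV. case_bool L L' b)"
      using L(2,3) by (intro indep_sets_mono_index[OF _ indep_source_sets]) (auto split: bool.splits)
    show "disjoint_family_on (case_bool L L') UNIV"
      using L(1) by (auto simp: disjoint_family_on_def split: bool.splits)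
  qed (rule Int_stable_source_sets)
  from indep_setsD[OF this, of UNIV "case_bool A A'"] A A' show ?thesis
    by (auto simp: sets_info UNIV_bool Int_commute mult.commute split: bool.splits)
qed

lemma info_measurable:
  "Transf \<in> L \<Longrightarrow> \<Theta> \<in> info L \<rightarrow>\<^sub>M N"
  "Label i \<in> L \<Longrightarrow> 1 \<le> i \<Longrightarrow> g i \<in> info L \<rightarrow>\<^sub>M E"
  "Coin j \<in> L \<Longrightarrow> \<xi> j \<in> info L \<rightarrow>\<^sub>M count_space UNIV"
  "Target j \<in> L \<Longrightarrow> u j \<in> info L \<rightarrow>\<^sub>M count_space UNIV"
proof -
  have basic: "A \<in> sets (info L)" if "A \<in> source_sets s" "s \<in> L" for A s
    unfolding sets_info by (rule sigma_sets.Basic, rule UN_I, rule that(2), rule that(1))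
  have *: "Y \<in> info L \<rightarrow>\<^sub>M F" if "s \<in> L" "source_sets s = {Y -` B \<inter> space M | B. B \<in> sets F}"
      "Y \<in> space M \<rightarrow> space F" for Y :: "'w \<Rightarrow> 'b" and F s
  proof (rule measurableI)
    show "Y -` A \<inter> space (info L) \<in> sets (info L)" if "A \<in> sets F" for A
      unfolding space_info by (rule basic[OF _ \<open>s \<in> L\<close>]) (use that in \<open>auto simp: \<open>source_sets s = _\<close>\<close>)
  qed (use that(3) in auto)
  show "Transf \<in> L \<Longrightarrow> \<Theta> \<in> info L \<rightarrow>\<^sub>M N"
    using measurable_space[OF \<Theta>_measurable] by (intro *[of Transf]) auto
  show "Label i \<in> L \<Longrightarrow> 1 \<le> i \<Longrightarrow> g i \<in> info L \<rightarrow>\<^sub>M E"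
    using measurable_space[OF g_measurable] by (intro *[of "Label i"]) auto
  show "Coin j \<in> L \<Longrightarrow> \<xi> j \<in> info L \<rightarrow>\<^sub>M count_space UNIV"
    by (intro *[of "Coin j"]) auto
  show "Target j \<in> L \<Longrightarrow> u j \<in> info L \<rightarrow>\<^sub>M count_space UNIV"
    by (intro *[of "Target j"]) auto
qed

definition past :: "nat \<Rightarrow> source set" where
  "past m = {Transf} \<union> Label ` {1..m} \<union> Coin ` {2..m} \<union> Target ` {2..m}"

lemma past_sources: "past m \<subseteq> sources" by (auto simp: past_def sources_def)

lemma past_event: "A \<in> sets (info (past m)) \<Longrightarrow> A \<in> events"
  using subalgebra_info[OF past_sources[of m]] by (auto simp: subalgebra_def)

section \<open>Steps and filtrations\<close>

text \<open>
  If the labels of the visible vertices are known and no edge leads from a visible vertex to an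
  invisible one, then the recursion for the steps at visible vertices never looks at an invisible
  label. Replacing invisible values by the unit makes all variables total.
\<close>

lemma revealed_steps_measurable:
  assumes D: "space D = space M" "\<Theta> \<in> D \<rightarrow>\<^sub>M N"
    and coins: "\<And>j. 2 \<le> j \<Longrightarrow> j \<le> n \<Longrightarrow> \<xi> j \<in> D \<rightarrow>\<^sub>M count_space UNIV"
    and targets: "\<And>j. 2 \<le> j \<Longrightarrow> j \<le> n \<Longrightarrow> u j \<in> D \<rightarrow>\<^sub>M count_space UNIV"
    and V: "\<And>j. 1 \<le> j \<Longrightarrow> j \<le> n \<Longrightarrow> Measurable.pred D (\<lambda>\<omega>. j \<in> V \<omega>)"
    and labels: "\<And>j. 1 \<le> j \<Longrightarrow> j \<le> n \<Longrightarrow> (\<lambda>\<omega>. if j \<in> V \<omega> then g j \<omega> else \<one>\<^bsub>G\<^esub>) \<in> D \<rightarrow>\<^sub>M E"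
    and closed: "\<And>j \<omega>. 2 \<le> j \<Longrightarrow> j \<le> n \<Longrightarrow> \<omega> \<in> space M \<Longrightarrow> j \<in> V \<omega> \<Longrightarrow> \<xi> j \<omega> \<Longrightarrow> u j \<omega> \<in> V \<omega>"
    and j: "1 \<le> j" "j \<le> n"
  shows "(\<lambda>\<omega>. if j \<in> V \<omega> then X j \<omega> else \<one>\<^bsub>G\<^esub>) \<in> D \<rightarrow>\<^sub>M E"
  using j
proof (induction j rule: less_induct)
  case (less j)
  let ?Y = "\<lambda>j \<omega>. if j \<in> V \<omega> then X j \<omega> else \<one>\<^bsub>G\<^esub>"
  show ?case
  proof (cases "j = 1")
    case True
    show ?thesis using labels[OF less.prems] unfolding True
      by (rule measurable_cong[THEN iffD1, rotated])
         (use D(1) X_first in \<open>simp add: One_nat_def[symmetric] del: One_nat_def\<close>)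
  next
    case False
    with less.prems have j: "2 \<le> j" "j \<le> n" by auto
    have uj: "u j \<in> D \<rightarrow>\<^sub>M count_space {1..<j}"
      using targets[OF j] u_range[OF j(1)] D(1)
      by (auto intro!: measurable_count_space_eq2_countable[THEN iffD2] simp: measurable_count_space_eq2_countable)
    have Y: "(\<lambda>\<omega>. ?Y (u j \<omega>) \<omega>) \<in> D \<rightarrow>\<^sub>M E"
      by (rule measurable_compose_countable'[OF _ uj]) (use less.IH j in auto)
    have hist: "(\<lambda>\<omega>. \<lambda>l\<in>{2..<j}. (\<xi> l \<omega>, u l \<omega>)) \<in> D \<rightarrow>\<^sub>M (\<Pi>\<^sub>M l\<in>{2..<j}. count_space UNIV)"
    proof (rule measurable_restrict)
      fix l assume "l \<in> {2..<j}"
      with j have l: "2 \<le> l" "l \<le> n" by auto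
      have "(\<lambda>\<omega>. (\<xi> l \<omega>, u l \<omega>)) \<in> D \<rightarrow>\<^sub>M count_space UNIV \<Otimes>\<^sub>M count_space UNIV"
        using coins[OF l] targets[OF l] by (rule measurable_Pair)
      then show "(\<lambda>\<omega>. (\<xi> l \<omega>, u l \<omega>)) \<in> D \<rightarrow>\<^sub>M count_space UNIV"
        by (simp add: pair_measure_countable)
    qed
    have T: "(\<lambda>\<omega>. \<T> j (\<Theta> \<omega>, (\<lambda>l\<in>{2..<j}. (\<xi> l \<omega>, u l \<omega>)), ?Y (u j \<omega>) \<omega>)) \<in> D \<rightarrow>\<^sub>M E"
      using \<T>_measurable[OF j(1)] D(2) hist Y by (rule_tac measurable_compose[OF _ \<T>_measurable[OF j(1)]]) (intro measurable_Pair)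
    have "(\<lambda>\<omega>. if j \<in> V \<omega> \<and> \<xi> j \<omega> then \<T> j (\<Theta> \<omega>, (\<lambda>l\<in>{2..<j}. (\<xi> l \<omega>, u l \<omega>)), ?Y (u j \<omega>) \<omega>)
        else if j \<in> V \<omega> then g j \<omega> else \<one>\<^bsub>G\<^esub>) \<in> D \<rightarrow>\<^sub>M E"
      using coins[OF j] V[OF less.prems]
      by (intro measurable_If[OF T labels[OF less.prems]]) (auto simp: pred_def[symmetric])
    then show ?thesis
      by (rule measurable_cong[THEN iffD1, rotated])
         (use j closed D(1) X_step in \<open>auto\<close>)
  qed
qed

lemma steps_measurable:
  assumes "space D = space M" "\<Theta> \<in> D \<rightarrow>\<^sub>M N"
    and "\<And>j. 2 \<le> j \<Longrightarrow> j \<le> n \<Longrightarrow> \<xi> j \<in> D \<rightarrow>\<^sub>M count_space UNIV"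
    and "\<And>j. 2 \<le> j \<Longrightarrow> j \<le> n \<Longrightarrow> u j \<in> D \<rightarrow>\<^sub>M count_space UNIV"
    and "\<And>j. 1 \<le> j \<Longrightarrow> j \<le> n \<Longrightarrow> g j \<in> D \<rightarrow>\<^sub>M E"
    and "1 \<le> j" "j \<le> n"
  shows "X j \<in> D \<rightarrow>\<^sub>M E"
  using revealed_steps_measurable[of D n "\<lambda>_. UNIV" j] assms by simp

lemma X_info: "1 \<le> j \<Longrightarrow> past j \<subseteq> L \<Longrightarrow> X j \<in> info L \<rightarrow>\<^sub>M E"
  by (rule steps_measurable[where n = j]) (auto intro!: info_measurable simp: past_def)

lemma X_measurable: "1 \<le> j \<Longrightarrow> X j \<in> M \<rightarrow>\<^sub>M E"
  using X_info[of j sources] past_sources[of j] subalgebra_info[of sources]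
  by (auto intro: measurable_from_subalg)

abbreviation \<A> :: "nat \<Rightarrow> 'w measure" where "\<A> \<equiv> full_filtration M E N \<Theta> g \<xi> u"

abbreviation \<H> :: "nat \<Rightarrow> 'w measure" where "\<H> \<equiv> step_filtration M E X"

lemma full_filtration_sub:
  "sets (vimage_algebra (space M) \<Theta> N) \<union> sets (generated M E {1..m} g)
      \<union> sets (generated M (count_space UNIV) {2..m} (\<lambda>j \<omega>. (\<xi> j \<omega>, u j \<omega>))) \<subseteq> Pow (space M)"
  using sets.space_closed[of "vimage_algebra (space M) \<Theta> N"]
    sets.space_closed[of "generated M E {1..m} g"]
    sets.space_closed[of "generated M (count_space UNIV) {2..m} (\<lambda>j \<omega>. (\<xi> j \<omega>, u j \<omega>))"]
  by simp

lemma space_\<A> [simp]: "space (\<A> m) = space M"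
  unfolding full_filtration_def by (rule space_measure_of[OF full_filtration_sub])

lemma sets_\<A>: "sets (\<A> m) = sigma_sets (space M) (sets (vimage_algebra (space M) \<Theta> N)
      \<union> sets (generated M E {1..m} g)
      \<union> sets (generated M (count_space UNIV) {2..m} (\<lambda>j \<omega>. (\<xi> j \<omega>, u j \<omega>))))"
  unfolding full_filtration_def by (rule sets_measure_of[OF full_filtration_sub])

lemma \<A>_measurable:
  "\<Theta> \<in> \<A> m \<rightarrow>\<^sub>M N"
  "1 \<le> i \<Longrightarrow> i \<le> m \<Longrightarrow> g i \<in> \<A> m \<rightarrow>\<^sub>M E"
  "2 \<le> j \<Longrightarrow> j \<le> m \<Longrightarrow> \<xi> j \<in> \<A> m \<rightarrow>\<^sub>M count_space UNIV"
  "2 \<le> j \<Longrightarrow> j \<le> m \<Longrightarrow> u j \<in> \<A> m \<rightarrow>\<^sub>M count_space UNIV"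
proof -
  have sub: "f \<in> \<A> m \<rightarrow>\<^sub>M L" if "f \<in> F \<rightarrow>\<^sub>M L" "space F = space M" "sets F \<subseteq> sets (\<A> m)"
    for f :: "'w \<Rightarrow> 'b" and F L
    using that by (auto simp: measurable_def)
  show "\<Theta> \<in> \<A> m \<rightarrow>\<^sub>M N"
    by (rule sub[of _ "vimage_algebra (space M) \<Theta> N"])
       (use \<Theta>_measurable in \<open>auto simp: sets_\<A> intro!: measurable_vimage_algebra1 dest: measurable_space\<close>)
  show "g i \<in> \<A> m \<rightarrow>\<^sub>M E" if "1 \<le> i" "i \<le> m"
    by (rule sub[of _ "generated M E {1..m} g"])
       (use that g_measurable in \<open>auto simp: sets_\<A> intro!: measurable_generated dest: measurable_space\<close>)
  have pair: "(\<lambda>\<omega>. (\<xi> j \<omega>, u j \<omega>)) \<in> \<A> m \<rightarrow>\<^sub>M count_space UNIV" if "2 \<le> j" "j \<le> m" for j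
    by (rule sub[of _ "generated M (count_space UNIV) {2..m} (\<lambda>j \<omega>. (\<xi> j \<omega>, u j \<omega>))"])
       (use that in \<open>auto simp: sets_\<A> intro!: measurable_generated\<close>)
  show "\<xi> j \<in> \<A> m \<rightarrow>\<^sub>M count_space UNIV" if "2 \<le> j" "j \<le> m"
    using measurable_compose[OF pair[OF that], of fst "count_space UNIV"] by simp
  show "u j \<in> \<A> m \<rightarrow>\<^sub>M count_space UNIV" if "2 \<le> j" "j \<le> m"
    using measurable_compose[OF pair[OF that], of snd "count_space UNIV"] by simp
qed

text \<open>
  The universal property of \<open>\<A> m\<close>; both its monotonicity and its comparison with \<open>info\<close> are
  instances.
\<close>

lemma sets_\<A>_least:
  assumes sp: "space F = space M" and \<Theta>: "\<Theta> \<in> F \<rightarrow>\<^sub>M N"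
    and g: "\<And>i. 1 \<le> i \<Longrightarrow> i \<le> m \<Longrightarrow> g i \<in> F \<rightarrow>\<^sub>M E"
    and \<xi>: "\<And>j. 2 \<le> j \<Longrightarrow> j \<le> m \<Longrightarrow> \<xi> j \<in> F \<rightarrow>\<^sub>M count_space UNIV"
    and u: "\<And>j. 2 \<le> j \<Longrightarrow> j \<le> m \<Longrightarrow> u j \<in> F \<rightarrow>\<^sub>M count_space UNIV"
  shows "sets (\<A> m) \<subseteq> sets F"
proof -
  have "sets (vimage_algebra (space M) \<Theta> N) \<subseteq> sets F"
    using \<Theta> sp \<Theta>_measurable
    by (subst sets_vimage_algebra2) (auto dest: measurable_space measurable_sets)
  moreover have "sets (generated M E {1..m} g) \<subseteq> sets F"
    using g sp by (intro sets_generated_least) auto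
  moreover have "sets (generated M (count_space UNIV) {2..m} (\<lambda>j \<omega>. (\<xi> j \<omega>, u j \<omega>))) \<subseteq> sets F"
  proof (rule sets_generated_least[OF sp])
    fix j assume "j \<in> {2..m}"
    then have "(\<lambda>\<omega>. (\<xi> j \<omega>, u j \<omega>)) \<in> F \<rightarrow>\<^sub>M count_space UNIV \<Otimes>\<^sub>M count_space UNIV"
      using \<xi> u by (intro measurable_Pair) auto
    then show "(\<lambda>\<omega>. (\<xi> j \<omega>, u j \<omega>)) \<in> F \<rightarrow>\<^sub>M count_space UNIV"
      by (simp add: pair_measure_countable)
  qed
  ultimately show ?thesis
    unfolding sets_\<A> sp[symmetric] by (intro sets.sigma_sets_subset) simp
qed

lemma \<A>_info: "past m \<subseteq> L \<Longrightarrow> sets (\<A> m) \<subseteq> sets (info L)"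
  by (rule sets_\<A>_least) (auto intro!: info_measurable simp: past_def)

lemma subalgebra_\<A>: "subalgebra M (\<A> m)"
  using \<A>_info[OF past_sources] subalgebra_info[of sources] by (auto simp: subalgebra_def)

lemma \<A>_mono: "m \<le> n \<Longrightarrow> sets (\<A> m) \<subseteq> sets (\<A> n)"
  by (rule sets_\<A>_least) (auto intro: \<A>_measurable)

lemma X_\<A>: "1 \<le> j \<Longrightarrow> j \<le> m \<Longrightarrow> X j \<in> \<A> m \<rightarrow>\<^sub>M E"
  by (rule steps_measurable[where n = j]) (auto intro: \<A>_measurable)

lemma space_\<H> [simp]: "space (\<H> m) = space M"
  by (simp add: step_filtration_def)

lemma \<H>_\<A>: "sets (\<H> m) \<subseteq> sets (\<A> m)"
  unfolding step_filtration_def by (rule sets_generated_least) (auto intro: X_\<A>)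

lemma subalgebra_\<H>: "subalgebra M (\<H> m)"
  using \<H>_\<A>[of m] subalgebra_\<A>[of m] by (auto simp: subalgebra_def)

lemma \<H>_mono: "m \<le> n \<Longrightarrow> sets (\<H> m) \<subseteq> sets (\<H> n)"
  unfolding step_filtration_def
  by (rule sets_generated_least)
     (use measurable_space[OF X_measurable] in \<open>auto intro!: measurable_generated\<close>)

section \<open>Isolated vertices\<close>

text \<open>
  A vertex is isolated iff it has no edge: its own edge to \<open>u\<^sub>i\<close> is absent, which is automatic for
  \<open>i = 1\<close>, and no later vertex chose it. Since \<open>u\<^sub>j < j\<close>, edges are never loops and so always enlarge
  the component.
\<close>

lemma isolated_iff:
  assumes \<omega>: "\<omega> \<in> space M"
  shows "i \<in> isolated \<xi> u n \<omega> \<longleftrightarrow>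
    1 \<le> i \<and> i \<le> n \<and> \<not> (2 \<le> i \<and> \<xi> i \<omega>) \<and> (\<forall>j\<in>{2..n}. \<not> (\<xi> j \<omega> \<and> u j \<omega> = i))" (is "?l \<longleftrightarrow> ?r")
proof
  let ?R = "forest_edges \<xi> u n \<omega> \<union> (forest_edges \<xi> u n \<omega>)\<inverse>"
  assume ?l
  then have i: "1 \<le> i" "i \<le> n" and comp: "w = i" if "(i, w) \<in> ?R" "w \<in> {1..n}" for w
    using that by (auto simp: isolated_def component_def)
  have i: "1 \<le> i" "i \<le> n" using \<open>?l\<close> by (auto simp: isolated_def)
  have "\<not> (2 \<le> i \<and> \<xi> i \<omega>)"
  proof
    assume *: "2 \<le> i \<and> \<xi> i \<omega>"
    then have "u i \<omega> \<in> {1..<i}" using u_range \<omega> by blast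
    moreover have "(i, u i \<omega>) \<in> ?R" using * i by (auto simp: forest_edges_def)
    ultimately show False using comp[of "u i \<omega>"] i by auto
  qed
  moreover have "\<not> (\<xi> j \<omega> \<and> u j \<omega> = i)" if j: "j \<in> {2..n}" for j
  proof
    assume *: "\<xi> j \<omega> \<and> u j \<omega> = i"
    then have "i < j" using u_range[of j \<omega>] \<omega> j by auto
    moreover have "(i, j) \<in> ?R" using * j by (auto simp: forest_edges_def)
    ultimately show False using comp[of j] j by auto
  qed
  ultimately show ?r using i by auto
next
  let ?R = "forest_edges \<xi> u n \<omega> \<union> (forest_edges \<xi> u n \<omega>)\<inverse>"
  assume r: ?r
  have no_edge: "(i, w) \<notin> ?R" for w using r by (auto simp: forest_edges_def)
  have "w = i" if "(i, w) \<in> ?R\<^sup>*" for w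
    using that no_edge by (auto elim: converse_rtranclE)
  then show ?l using r by (auto simp: isolated_def component_def)
qed

lemma isolated_measurable:
  assumes sp: "space D = space M"
    and \<xi>: "\<And>j. 2 \<le> j \<Longrightarrow> j \<le> n \<Longrightarrow> \<xi> j \<in> D \<rightarrow>\<^sub>M count_space UNIV"
    and u: "\<And>j. 2 \<le> j \<Longrightarrow> j \<le> n \<Longrightarrow> u j \<in> D \<rightarrow>\<^sub>M count_space UNIV"
  shows "Measurable.pred D (\<lambda>\<omega>. i \<in> isolated \<xi> u n \<omega>)"
proof -
  have uj: "Measurable.pred D (\<lambda>\<omega>. u j \<omega> = i)" if "2 \<le> j" "j \<le> n" for j
    using u[OF that] by (rule measurable_compose) simp
  have "Measurable.pred D (\<lambda>\<omega>. 1 \<le> i \<and> i \<le> n \<and> \<not> (2 \<le> i \<and> \<xi> i \<omega>) \<and> (\<forall>j\<in>{2..n}. \<not> (\<xi> j \<omega> \<and> u j \<omega> = i)))"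
  proof (cases "2 \<le> i \<and> i \<le> n")
    case True
    then show ?thesis using \<xi> uj by (intro pred_intros_logic pred_intros_finite) auto
  next
    case False
    show ?thesis
    proof (cases "i = 1")
      case True
      then show ?thesis using \<xi> uj by simp
    next
      case f: False
      have "(\<lambda>\<omega>. 1 \<le> i \<and> i \<le> n \<and> \<not> (2 \<le> i \<and> \<xi> i \<omega>) \<and> (\<forall>j\<in>{2..n}. \<not> (\<xi> j \<omega> \<and> u j \<omega> = i))) = (\<lambda>_. False)"
        using False f by (intro ext) auto
      then show ?thesis by simp
    qed
  qed
  then show ?thesis
    by (rule measurable_cong[THEN iffD1, rotated]) (simp add: sp isolated_iff)
qed

lemma isolated_step: "\<omega> \<in> space M \<Longrightarrow> i \<in> isolated \<xi> u n \<omega> \<Longrightarrow> X i \<omega> = g i \<omega>"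
  using X_first[of \<omega>] X_step[of i \<omega>] by (cases "i = 1") (auto simp: isolated_iff)

lemma isolated_events: "Measurable.pred M (\<lambda>\<omega>. i \<in> isolated \<xi> u n \<omega>)"
  by (rule isolated_measurable) (auto intro: \<xi>_measurable u_measurable)

section \<open>The information revealed by a block\<close>

abbreviation block :: "'w measure \<Rightarrow> ('w \<Rightarrow> nat) \<Rightarrow> nat \<Rightarrow> 'w measure" where
  "block \<equiv> block_sigma M E g \<xi> u"

abbreviation block_at :: "nat \<Rightarrow> nat \<Rightarrow> 'w measure" where
  "block_at m n \<equiv> block (\<A> m) (\<lambda>_. m) n"

abbreviation pair_event :: "('w \<Rightarrow> nat) \<Rightarrow> nat \<Rightarrow> nat \<Rightarrow> (bool \<times> nat) set \<Rightarrow> 'w set" where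
  "pair_event \<tau> n j C \<equiv> {\<omega> \<in> space M. j \<le> \<tau> \<omega> + n \<and> (\<xi> j \<omega>, u j \<omega>) \<in> C}"

abbreviation label_event :: "('w \<Rightarrow> nat) \<Rightarrow> nat \<Rightarrow> nat \<Rightarrow> 'a set \<Rightarrow> 'w set" where
  "label_event \<tau> n j A \<equiv>
     {\<omega> \<in> space M. j \<in> {\<tau> \<omega> + 1..\<tau> \<omega> + n} - isolated \<xi> u (\<tau> \<omega> + n) \<omega> \<and> g j \<omega> \<in> A}"

abbreviation block_generators :: "'w measure \<Rightarrow> ('w \<Rightarrow> nat) \<Rightarrow> nat \<Rightarrow> 'w set set" where
  "block_generators B \<tau> n \<equiv> sets B
      \<union> {pair_event \<tau> n j C | j C. 2 \<le> j}
      \<union> {label_event \<tau> n j A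
           | j A. A \<in> sets E}"

lemma block_generators_sub: "space B = space M \<Longrightarrow> block_generators B \<tau> n \<subseteq> Pow (space M)"
  using sets.space_closed[of B] by auto

lemma space_block: "space B = space M \<Longrightarrow> space (block B \<tau> n) = space M"
  unfolding block_sigma_def by (rule space_measure_of[OF block_generators_sub])

lemma sets_block: "space B = space M \<Longrightarrow>
    sets (block B \<tau> n) = sigma_sets (space M) (block_generators B \<tau> n)"
  unfolding block_sigma_def by (rule sets_measure_of[OF block_generators_sub])

lemma space_block_at [simp]: "space (block_at m n) = space M"
  by (rule space_block) simp

lemma block_generatorI:
  "space B = space M \<Longrightarrow> A \<in> block_generators B \<tau> n \<Longrightarrow> A \<in> sets (block B \<tau> n)"
  by (simp add: sets_block sigma_sets.Basic)

lemma block_basic: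
  assumes B: "space B = space M"
  shows "A \<in> sets B \<Longrightarrow> A \<in> sets (block B \<tau> n)"
    and "2 \<le> j \<Longrightarrow> pair_event \<tau> n j C \<in> sets (block B \<tau> n)"
    and "F \<in> sets E \<Longrightarrow> label_event \<tau> n j F
      \<in> sets (block B \<tau> n)"
proof -
  show "A \<in> sets (block B \<tau> n)" if "A \<in> sets B"
    by (rule block_generatorI[OF B], rule UnI1, rule UnI1, rule that)
  show "pair_event \<tau> n j C \<in> sets (block B \<tau> n)"
    if "2 \<le> j"
    by (rule block_generatorI[OF B], rule UnI1, rule UnI2, rule CollectI, rule exI[of _ j],
        rule exI[of _ C], rule conjI[OF refl that])
  show "label_event \<tau> n j F
      \<in> sets (block B \<tau> n)" if "F \<in> sets E"
    by (rule block_generatorI[OF B], rule UnI2, rule CollectI, rule exI[of _ j],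
        rule exI[of _ F], rule conjI[OF refl that])
qed

text \<open>
  Instance of \<open>sets_sigma_trace\<close> for the three kinds of generators of the block information.
\<close>

lemma block_trace:
  assumes B: "space B = space M" and D: "D \<in> sets (block B \<tau> n)"
    and F: "space F = space M" "Q \<in> sets F"
    and 1: "\<And>A. A \<in> sets B \<Longrightarrow> A \<inter> Q \<in> sets F"
    and 2: "\<And>j C. 2 \<le> j \<Longrightarrow> pair_event \<tau> n j C \<inter> Q \<in> sets F"
    and 3: "\<And>j A. A \<in> sets E \<Longrightarrow> label_event \<tau> n j A \<inter> Q
      \<in> sets F"
  shows "D \<inter> Q \<in> sets F"
proof (rule sets_sigma_trace[OF _ block_generators_sub[OF B] F])
  show "D \<in> sets (sigma (space M) (block_generators B \<tau> n))" using D by (simp only: block_sigma_def)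
  show "A \<inter> Q \<in> sets F" if "A \<in> block_generators B \<tau> n" for A
    using that
  proof (elim UnE)
    assume "A \<in> {pair_event \<tau> n j C | j C. 2 \<le> j}"
    then obtain j C where "A = pair_event \<tau> n j C" "2 \<le> j" by blast
    with 2 show ?thesis by blast
  next
    assume "A \<in> {label_event \<tau> n j A
           | j A. A \<in> sets E}"
    then obtain j A' where "A = {\<omega> \<in> space M. j \<in> {\<tau> \<omega> + 1..\<tau> \<omega> + n} - isolated \<xi> u (\<tau> \<omega> + n) \<omega> \<and> g j \<omega> \<in> A'}"
      "A' \<in> sets E" by blast
    with 3 show ?thesis by blast
  qed (rule 1)
qed

text \<open>
  On an event where two times agree, the random index ranges in the generators agree as well, so
  only the \<open>\<sigma>\<close>-algebras of the past have to be compared.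
\<close>

lemma block_compare:
  assumes B: "space B = space M" "space B' = space M"
    and Q: "Q \<in> sets (block B' \<tau>' n)" "\<And>\<omega>. \<omega> \<in> Q \<Longrightarrow> \<tau> \<omega> = \<tau>' \<omega>"
    and A: "\<And>A. A \<in> sets B \<Longrightarrow> A \<inter> Q \<in> sets (block B' \<tau>' n)"
    and D: "D \<in> sets (block B \<tau> n)"
  shows "D \<inter> Q \<in> sets (block B' \<tau>' n)"
proof (rule block_trace[OF B(1) D])
  have "pair_event \<tau> n j C \<inter> Q = pair_event \<tau>' n j C \<inter> Q" for j C using Q(2) by auto
  then show "pair_event \<tau> n j C \<inter> Q \<in> sets (block B' \<tau>' n)" if "2 \<le> j" for j C
    using sets.Int[OF block_basic(2)[OF B(2) that] Q(1)] by simp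
  have "label_event \<tau> n j F \<inter> Q = label_event \<tau>' n j F \<inter> Q" for j F using Q(2) by auto
  then show "label_event \<tau> n j F \<inter> Q \<in> sets (block B' \<tau>' n)" if "F \<in> sets E" for j F
    using sets.Int[OF block_basic(3)[OF B(2) that] Q(1)] by simp
qed (use Q(1) A space_block[OF B(2)] in simp_all)

lemma pair_measurable:
  assumes "\<xi> j \<in> D \<rightarrow>\<^sub>M count_space UNIV" "u j \<in> D \<rightarrow>\<^sub>M count_space UNIV"
  shows "(\<lambda>\<omega>. (\<xi> j \<omega>, u j \<omega>)) \<in> D \<rightarrow>\<^sub>M count_space UNIV"
  using measurable_Pair[OF assms] by (simp add: pair_measure_countable)

lemma block_at_measurable:
  "f \<in> \<A> m \<rightarrow>\<^sub>M L \<Longrightarrow> f \<in> block_at m n \<rightarrow>\<^sub>M L"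
  "2 \<le> j \<Longrightarrow> j \<le> m + n \<Longrightarrow> \<xi> j \<in> block_at m n \<rightarrow>\<^sub>M count_space UNIV"
  "2 \<le> j \<Longrightarrow> j \<le> m + n \<Longrightarrow> u j \<in> block_at m n \<rightarrow>\<^sub>M count_space UNIV"
  "Measurable.pred (block_at m n) (\<lambda>\<omega>. i \<in> isolated \<xi> u (m + n) \<omega>)"
proof -
  show "f \<in> block_at m n \<rightarrow>\<^sub>M L" if "f \<in> \<A> m \<rightarrow>\<^sub>M L"
    by (rule measurable_from_subalg[OF _ that])
       (simp add: subalgebra_def subset_iff block_basic(1))
  have pair: "(\<lambda>\<omega>. (\<xi> j \<omega>, u j \<omega>)) \<in> block_at m n \<rightarrow>\<^sub>M count_space UNIV" if j: "2 \<le> j" "j \<le> m + n" for j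
  proof (rule measurableI)
    fix C :: "(bool \<times> nat) set"
    have "(\<lambda>\<omega>. (\<xi> j \<omega>, u j \<omega>)) -` C \<inter> space (block_at m n) =
        pair_event (\<lambda>_. m) n j C" using j by auto
    also have "\<dots> \<in> sets (block_at m n)" 
      by (rule block_basic(2)[of "\<A> m" j "\<lambda>_. m" n C]) (use j in simp_all)
    finally show "(\<lambda>\<omega>. (\<xi> j \<omega>, u j \<omega>)) -` C \<inter> space (block_at m n) \<in> sets (block_at m n)" .
  qed simp
  show \<xi>: "\<xi> j \<in> block_at m n \<rightarrow>\<^sub>M count_space UNIV" if "2 \<le> j" "j \<le> m + n" for j
    using measurable_compose[OF pair[OF that], of fst "count_space UNIV"] by simp
  show u: "u j \<in> block_at m n \<rightarrow>\<^sub>M count_space UNIV" if "2 \<le> j" "j \<le> m + n" for j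
    using measurable_compose[OF pair[OF that], of snd "count_space UNIV"] by simp
  show "Measurable.pred (block_at m n) (\<lambda>\<omega>. i \<in> isolated \<xi> u (m + n) \<omega>)"
    using \<xi> u by (intro isolated_measurable) auto
qed

lemma one_space: "\<one>\<^bsub>G\<^esub> \<in> space E" using space_E by simp

text \<open>
  The visible vertices are those of the past and the non-isolated ones of the block. An edge
  joins two non-isolated vertices, so it never leaves the visible set.
\<close>

lemma revealed_step_measurable:
  assumes "1 \<le> j" "j \<le> m + n"
  shows "(\<lambda>\<omega>. if j \<le> m \<or> j \<notin> isolated \<xi> u (m + n) \<omega> then X j \<omega> else \<one>\<^bsub>G\<^esub>) \<in> block_at m n \<rightarrow>\<^sub>M E"
proof -
  let ?V = "\<lambda>\<omega>. {j. j \<le> m \<or> j \<notin> isolated \<xi> u (m + n) \<omega>}"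
  have "(\<lambda>\<omega>. if j \<in> ?V \<omega> then X j \<omega> else \<one>\<^bsub>G\<^esub>) \<in> block_at m n \<rightarrow>\<^sub>M E"
  proof (rule revealed_steps_measurable[where n = "m + n" and V = ?V and D = "block_at m n"])
    show "\<Theta> \<in> block_at m n \<rightarrow>\<^sub>M N" by (intro block_at_measurable(1) \<A>_measurable)
    show "Measurable.pred (block_at m n) (\<lambda>\<omega>. j \<in> ?V \<omega>)" for j
    proof -
      have "Measurable.pred (block_at m n) (\<lambda>\<omega>. \<not> j \<in> isolated \<xi> u (m + n) \<omega>)"
        by (rule pred_intros_logic(2), rule block_at_measurable(4))
      then show ?thesis by (cases "j \<le> m") simp_all
    qed
    show "(\<lambda>\<omega>. if j \<in> ?V \<omega> then g j \<omega> else \<one>\<^bsub>G\<^esub>) \<in> block_at m n \<rightarrow>\<^sub>M E" if j: "1 \<le> j" "j \<le> m + n" for j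
    proof (cases "j \<le> m")
      case True
      have "g j \<in> block_at m n \<rightarrow>\<^sub>M E"
        by (intro block_at_measurable(1) \<A>_measurable j True)
      with True show ?thesis by simp
    next
      case False
      show ?thesis
      proof (rule measurableI)
        show "(if j \<in> ?V \<omega> then g j \<omega> else \<one>\<^bsub>G\<^esub>) \<in> space E" if "\<omega> \<in> space (block_at m n)" for \<omega>
          using that measurable_space[OF g_measurable[OF j(1)], of \<omega>] one_space by auto
        fix F assume F: "F \<in> sets E"
        have "(\<lambda>\<omega>. if j \<in> ?V \<omega> then g j \<omega> else \<one>\<^bsub>G\<^esub>) -` F \<inter> space (block_at m n) =
          label_event (\<lambda>_. m) n j F \<union>
          (if \<one>\<^bsub>G\<^esub> \<in> F then {\<omega> \<in> space (block_at m n). j \<in> isolated \<xi> u (m + n) \<omega>} else {})"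
          using j False by (auto split: if_splits)
        also have "\<dots> \<in> sets (block_at m n)"
        proof (rule sets.Un)
          show "label_event (\<lambda>_. m) n j F \<in> sets (block_at m n)"
            by (rule block_basic(3)[OF _ F]) simp
          show "(if \<one>\<^bsub>G\<^esub> \<in> F then {\<omega> \<in> space (block_at m n). j \<in> isolated \<xi> u (m + n) \<omega>} else {}) \<in> sets (block_at m n)"
            using block_at_measurable(4)[where m = m and n = n and i = j] by (simp add: pred_def)
        qed
        finally show "(\<lambda>\<omega>. if j \<in> ?V \<omega> then g j \<omega> else \<one>\<^bsub>G\<^esub>) -` F \<inter> space (block_at m n) \<in> sets (block_at m n)" .
      qed
    qed
    show "u j \<omega> \<in> ?V \<omega>" if "2 \<le> j" "j \<le> m + n" "\<omega> \<in> space M" "j \<in> ?V \<omega>" "\<xi> j \<omega>" for j \<omega>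
      using that by (auto simp: isolated_iff)
  qed (use assms in \<open>simp_all add: block_at_measurable(2,3)\<close>)
  then show ?thesis by simp
qed

text \<open>
  The reason why isolated labels stay fresh: on the event that \<open>i\<close> is isolated, the label \<open>g\<^sub>i\<close> is
  not among the revealed labels, and no other generator of the block information depends on it.
\<close>

lemma block_at_info:
  assumes D: "D \<in> sets (block_at m n)" and i: "m < i" "i \<le> m + n"
  shows "D \<inter> {\<omega> \<in> space M. i \<in> isolated \<xi> u (m + n) \<omega>} \<in> sets (info (sources - {Label i}))"
    (is "D \<inter> ?Q \<in> sets ?I")
proof (rule block_trace[OF _ D])
  have \<xi>: "\<xi> j \<in> ?I \<rightarrow>\<^sub>M count_space UNIV" and u: "u j \<in> ?I \<rightarrow>\<^sub>M count_space UNIV" if "2 \<le> j" for j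
    using that by (auto intro!: info_measurable simp: sources_def)
  have iso: "Measurable.pred ?I (\<lambda>\<omega>. k \<in> isolated \<xi> u (m + n) \<omega>)" for k
    using \<xi> u by (intro isolated_measurable) auto
  show Q: "?Q \<in> sets ?I" using iso[of i] by (simp add: pred_def)
  show "A \<inter> ?Q \<in> sets ?I" if "A \<in> sets (\<A> m)" for A
  proof (rule sets.Int[OF _ Q])
    have "past m \<subseteq> sources - {Label i}" using i by (auto simp: past_def sources_def)
    from subsetD[OF \<A>_info[OF this] that] show "A \<in> sets ?I" .
  qed
  show "pair_event (\<lambda>_. m) n j C \<inter> ?Q \<in> sets ?I" if "2 \<le> j" for j C
  proof (rule sets.Int[OF _ Q])
    have "Measurable.pred ?I (\<lambda>\<omega>. (\<xi> j \<omega>, u j \<omega>) \<in> C)"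
      by (rule pred_sets2[OF _ pair_measurable[OF \<xi>[OF that] u[OF that]]]) simp
    then show "pair_event (\<lambda>_. m) n j C \<in> sets ?I"
      by (cases "j \<le> m + n") (simp_all add: pred_def)
  qed
  show "label_event (\<lambda>_. m) n j A \<inter> ?Q \<in> sets ?I"
    if A: "A \<in> sets E" for j A
  proof (cases "j \<noteq> i \<and> j \<in> {m + 1..m + n}")
    case True
    then have gj: "g j \<in> ?I \<rightarrow>\<^sub>M E" by (intro info_measurable) (auto simp: sources_def)
    have "Measurable.pred ?I (\<lambda>\<omega>. j \<notin> isolated \<xi> u (m + n) \<omega> \<and> g j \<omega> \<in> A)"
      by (intro pred_intros_logic iso pred_sets2[OF A gj])
    then have "{\<omega> \<in> space M. j \<notin> isolated \<xi> u (m + n) \<omega> \<and> g j \<omega> \<in> A} \<in> sets ?I"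
      by (simp add: pred_def)
    moreover have "label_event (\<lambda>_. m) n j A =
        {\<omega> \<in> space M. j \<notin> isolated \<xi> u (m + n) \<omega> \<and> g j \<omega> \<in> A}"
      using True by simp
    ultimately show ?thesis using Q by (simp only: sets.Int)
  next
    case False
    then have "label_event (\<lambda>_. m) n j A \<inter> ?Q = {}" by auto
    then show ?thesis by simp
  qed
qed simp_all

lemma contains_at_block:
  assumes B: "space B = space M" and cont: "contains_at M \<A> B \<tau>"
  shows "contains_at M (\<lambda>m. block_at m n) (block B \<tau> n) \<tau>"
  unfolding contains_at_def
proof (intro allI ballI)
  fix m D assume D: "D \<in> sets (block_at m n)"
  let ?Q = "{\<omega> \<in> space M. \<tau> \<omega> = m}" and ?G = "block B \<tau> n"
  have A: "A \<inter> ?Q \<in> sets ?G" if "A \<in> sets (\<A> m)" for A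
    using cont that by (intro block_basic(1)[OF B]) (simp add: contains_at_def)
  then have Q: "?Q \<in> sets ?G" using A[of "space M"] sets.top[of "\<A> m"] by (auto simp: Int_def)
  show "D \<inter> ?Q \<in> sets ?G"
    by (rule block_compare[OF space_\<A> B Q _ A D]) simp
qed

lemma subalgebra_block:
  assumes B: "subalgebra M B" and \<tau>: "\<And>m. {\<omega> \<in> space M. \<tau> \<omega> = m} \<in> sets B"
  shows "subalgebra M (block B \<tau> n)"
proof -
  have sp: "space B = space M" using B by (simp add: subalgebra_def)
  have cont: "contains_at M (\<lambda>_. M) M \<tau>"
    unfolding contains_at_def using \<tau> B by (auto simp: subalgebra_def)
  have at_time: "{\<omega> \<in> space M. P (\<tau> \<omega>) \<omega>} \<in> events" if "\<And>m. Measurable.pred M (P m)" for P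
    using measurable_at_random_time[OF refl refl cont that] by (simp add: pred_def)
  have "D \<inter> space M \<in> events" if D: "D \<in> sets (block B \<tau> n)" for D
  proof (rule block_trace[OF sp D])
    show "A \<inter> space M \<in> events" if "A \<in> sets B" for A using that B by (auto simp: subalgebra_def)
    show "pair_event \<tau> n j C \<inter> space M \<in> events" if "2 \<le> j" for j C
    proof -
      have p: "Measurable.pred M (\<lambda>\<omega>. (\<xi> j \<omega>, u j \<omega>) \<in> C)"
        by (rule pred_sets2[OF _ pair_measurable[OF \<xi>_measurable[OF that] u_measurable[OF that]]]) simp
      have "pair_event \<tau> n j C \<in> events"
      proof (rule at_time[of "\<lambda>m \<omega>. j \<le> m + n \<and> (\<xi> j \<omega>, u j \<omega>) \<in> C"])
        show "Measurable.pred M (\<lambda>\<omega>. j \<le> m + n \<and> (\<xi> j \<omega>, u j \<omega>) \<in> C)" for m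
          using p by (cases "j \<le> m + n") simp_all
      qed
      then show ?thesis by (rule sets.Int[OF _ sets.top])
    qed
    show "label_event \<tau> n j A \<inter> space M \<in> events"
      if A: "A \<in> sets E" for j A
    proof (cases "1 \<le> j")
      case True
      then have p: "Measurable.pred M (\<lambda>\<omega>. g j \<omega> \<in> A)"
        by (rule pred_sets2[OF A g_measurable])
      have "{\<omega> \<in> space M. j \<in> {\<tau> \<omega> + 1..\<tau> \<omega> + n} \<and> j \<notin> isolated \<xi> u (\<tau> \<omega> + n) \<omega> \<and> g j \<omega> \<in> A} \<in> events"
      proof (rule at_time[of "\<lambda>m \<omega>. j \<in> {m + 1..m + n} \<and> j \<notin> isolated \<xi> u (m + n) \<omega> \<and> g j \<omega> \<in> A"])
        have "Measurable.pred M (\<lambda>\<omega>. j \<notin> isolated \<xi> u (m + n) \<omega> \<and> g j \<omega> \<in> A)" for m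
          by (intro pred_intros_logic isolated_events p)
        then show "Measurable.pred M (\<lambda>\<omega>. j \<in> {m + 1..m + n} \<and> j \<notin> isolated \<xi> u (m + n) \<omega> \<and> g j \<omega> \<in> A)" for m
          by (cases "j \<in> {m + 1..m + n}") simp_all
      qed
      then show ?thesis unfolding Diff_iff conj_assoc by (rule sets.Int[OF _ sets.top])
    next
      case False
      then have "label_event \<tau> n j A \<inter> space M = {}"
        by auto
      then show ?thesis by (simp only: sets.empty_sets)
    qed
  qed auto
  moreover have "D \<inter> space M = D" if "D \<in> sets (block B \<tau> n)" for D
    using sets.sets_into_space[OF that] by (auto simp: space_block[OF sp])
  ultimately show ?thesis by (auto simp: subalgebra_def space_block[OF sp])
qed

lemma sampled_block:
  assumes S: "sampled M \<A> B \<tau> Q" and cont: "contains_at M \<A> B \<tau>"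
  shows "sampled M (\<lambda>m. block_at m n) (block B \<tau> n) \<tau> Q"
proof -
  have B: "subalgebra M B" using S by (simp add: sampled_def)
  then have sp: "space B = space M" by (simp add: subalgebra_def)
  have QB: "Q m \<in> sets B" and Q\<tau>: "\<And>\<omega>. \<omega> \<in> Q m \<Longrightarrow> \<tau> \<omega> = m"
    and DQ: "\<And>D. D \<in> sets B \<Longrightarrow> D \<inter> Q m \<in> sets (\<A> m)" for m
    using S by (auto simp: sampled_def)
  have sub: "subalgebra M (block B \<tau> n)"
    by (rule subalgebra_block[OF B sampled_time_measurable[OF S cont space_\<A>]])
  have "D \<inter> Q m \<in> sets (block_at m n)" if D: "D \<in> sets (block B \<tau> n)" for D m
  proof (rule block_compare[OF sp space_\<A> _ Q\<tau> _ D])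
    have "Q m \<in> sets (\<A> m)" using DQ[OF QB, of m m] by simp
    then show "Q m \<in> sets (block_at m n)" by (rule block_basic(1)[OF space_\<A>])
    show "A \<inter> Q m \<in> sets (block_at m n)" if "A \<in> sets B" for A
      by (rule block_basic(1)[OF space_\<A> DQ[OF that]])
  qed
  then show ?thesis
    using S sub block_basic(1)[OF sp QB] by (auto simp: sampled_def)
qed

lemma subalgebra_block_at: "subalgebra M (block_at m n)"
proof (rule subalgebra_block[OF subalgebra_\<A>])
  show "{\<omega> \<in> space M. m = k} \<in> sets (\<A> m)" for k
    using sets.top[of "\<A> m"] by (cases "m = k") simp_all
qed

lemma sets_block_at_events: "D \<in> sets (block_at m n) \<Longrightarrow> D \<in> events"
  using subalgebra_block_at by (auto simp: subalgebra_def)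

end

section \<open>The walk on a block\<close>

text \<open>
  For a discrete group of large cardinality joint measurability of the multiplication is a
  genuine assumption; it makes the positions of the walk random variables.
\<close>

locale measurable_srrw = srrw M G E \<mu> \<alpha> N \<Theta> \<T> g \<xi> u X
  for M :: "'w measure" and G :: "'a monoid" and E \<mu> :: "'a measure" and \<alpha> :: real
    and N :: "'t measure" and \<Theta> :: "'w \<Rightarrow> 't"
    and \<T> :: "nat \<Rightarrow> 't \<times> (nat \<Rightarrow> bool \<times> nat) \<times> 'a \<Rightarrow> 'a"
    and g :: "nat \<Rightarrow> 'w \<Rightarrow> 'a" and \<xi> :: "nat \<Rightarrow> 'w \<Rightarrow> bool" and u :: "nat \<Rightarrow> 'w \<Rightarrow> nat"
    and X :: "nat \<Rightarrow> 'w \<Rightarrow> 'a" +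
  assumes mult_measurable: "(\<lambda>(x, y). x \<otimes>\<^bsub>G\<^esub> y) \<in> E \<Otimes>\<^sub>M E \<rightarrow>\<^sub>M E"
begin

lemma mult_comp:
  assumes "f \<in> D \<rightarrow>\<^sub>M E" "h \<in> D \<rightarrow>\<^sub>M E"
  shows "(\<lambda>\<omega>. f \<omega> \<otimes>\<^bsub>G\<^esub> h \<omega>) \<in> D \<rightarrow>\<^sub>M E"
  using measurable_compose[OF measurable_Pair[OF assms] mult_measurable] by simp

lemma walk_measurable:
  assumes "\<And>j. 1 \<le> j \<Longrightarrow> j \<le> n \<Longrightarrow> X j \<in> D \<rightarrow>\<^sub>M E"
  shows "walk G X n \<in> D \<rightarrow>\<^sub>M E"
  using assms
proof (induction n)
  case 0
  have "walk G X 0 = (\<lambda>_. \<one>\<^bsub>G\<^esub>)" by auto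
  then show ?case using one_space by simp
next
  case (Suc n)
  have "walk G X (Suc n) = (\<lambda>\<omega>. walk G X n \<omega> \<otimes>\<^bsub>G\<^esub> X (Suc n) \<omega>)" by auto
  with Suc show ?case by (auto intro!: mult_comp)
qed

lemma walk_\<A>: "walk G X m \<in> \<A> m \<rightarrow>\<^sub>M E"
  by (intro walk_measurable X_\<A>) auto

lemma walk_events: "walk G X m \<in> M \<rightarrow>\<^sub>M E"
  by (intro walk_measurable X_measurable)

definition block_path :: "nat \<Rightarrow> nat \<Rightarrow> 'w \<Rightarrow> nat \<Rightarrow> 'a" where
  "block_path m k \<omega> = (\<lambda>i\<in>{0..k}. walk G X (m + i) \<omega>)"

lemma block_path_measurable:
  assumes "\<And>j. 1 \<le> j \<Longrightarrow> j \<le> m + k \<Longrightarrow> X j \<in> D \<rightarrow>\<^sub>M E"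
  shows "block_path m k \<in> D \<rightarrow>\<^sub>M path_space E k"
  unfolding block_path_def by (intro measurable_restrict walk_measurable assms) auto

lemma block_path_Suc:
  "block_path m (Suc k) \<omega> = (block_path m k \<omega>)(Suc k := block_path m k \<omega> k \<otimes>\<^bsub>G\<^esub> X (m + Suc k) \<omega>)"
  by (auto simp: block_path_def fun_eq_iff le_Suc_eq)

definition block_kernel :: "nat \<Rightarrow> nat \<Rightarrow> 'w \<Rightarrow> nat \<Rightarrow> 'a \<Rightarrow> 'a measure" where
  "block_kernel m n \<omega> k =
    (if m + k \<in> isolated \<xi> u (m + n) \<omega> then mult_kernel G E \<mu> else translation_kernel G E (X (m + k) \<omega>))"

lemma mult_kernel_measurable: "mult_kernel G E \<mu> \<in> E \<rightarrow>\<^sub>M prob_algebra E"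
proof -
  have "\<mu> \<in> space (prob_algebra E)" using step_law by (simp add: space_prob_algebra)
  then have "(\<lambda>x. distr \<mu> E (\<lambda>y. x \<otimes>\<^bsub>G\<^esub> y)) \<in> E \<rightarrow>\<^sub>M prob_algebra E"
    using mult_measurable by (intro measurable_distr_prob_space2[where M = E]) auto
  then show ?thesis by (simp add: mult_kernel_def[abs_def])
qed

lemma translation_kernel_measurable:
  assumes "y \<in> space E"
  shows "translation_kernel G E y \<in> E \<rightarrow>\<^sub>M prob_algebra E"
proof -
  have "(\<lambda>x. x \<otimes>\<^bsub>G\<^esub> y) \<in> E \<rightarrow>\<^sub>M E" using assms by (intro mult_comp) auto
  from measurable_compose[OF this measurable_return_prob_space]
  show ?thesis by (simp add: translation_kernel_def[abs_def])
qed

lemma X_space: "\<omega> \<in> space M \<Longrightarrow> 1 \<le> j \<Longrightarrow> X j \<omega> \<in> space E"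
  using measurable_space[OF X_measurable] by blast

lemma block_kernel_measurable_at:
  "\<omega> \<in> space M \<Longrightarrow> 1 \<le> k \<Longrightarrow> block_kernel m n \<omega> k \<in> E \<rightarrow>\<^sub>M prob_algebra E"
  unfolding block_kernel_def
  using mult_kernel_measurable translation_kernel_measurable[OF X_space, of \<omega> "m + k"] by auto

lemma block_kernel_measurable:
  assumes k: "1 \<le> k" "k \<le> n"
  shows "(\<lambda>(\<omega>, x). block_kernel m n \<omega> k x) \<in> block_at m n \<Otimes>\<^sub>M E \<rightarrow>\<^sub>M prob_algebra E"
proof -
  let ?i = "m + k" and ?B = "block_at m n \<Otimes>\<^sub>M E"
  let ?Y = "\<lambda>\<omega>. if ?i \<le> m \<or> ?i \<notin> isolated \<xi> u (m + n) \<omega> then X ?i \<omega> else \<one>\<^bsub>G\<^esub>"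
  have Y: "?Y \<in> block_at m n \<rightarrow>\<^sub>M E" using k by (intro revealed_step_measurable) auto
  have 1: "(\<lambda>z. mult_kernel G E \<mu> (snd z)) \<in> ?B \<rightarrow>\<^sub>M prob_algebra E"
    by (rule measurable_compose[OF measurable_snd mult_kernel_measurable])
  have 2: "(\<lambda>z. return E (snd z \<otimes>\<^bsub>G\<^esub> ?Y (fst z))) \<in> ?B \<rightarrow>\<^sub>M prob_algebra E"
    by (intro measurable_compose[OF _ measurable_return_prob_space] mult_comp measurable_snd
        measurable_compose[OF measurable_fst Y])
  have 3: "Measurable.pred ?B (\<lambda>z. ?i \<in> isolated \<xi> u (m + n) (fst z))"
    by (rule measurable_compose[OF measurable_fst block_at_measurable(4)])
  have "(\<lambda>z. if ?i \<in> isolated \<xi> u (m + n) (fst z) then mult_kernel G E \<mu> (snd z)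
      else return E (snd z \<otimes>\<^bsub>G\<^esub> ?Y (fst z))) \<in> ?B \<rightarrow>\<^sub>M prob_algebra E"
    using 1 2 3[unfolded pred_def] by (rule measurable_If)
  also have "(\<lambda>z. if ?i \<in> isolated \<xi> u (m + n) (fst z) then mult_kernel G E \<mu> (snd z)
      else return E (snd z \<otimes>\<^bsub>G\<^esub> ?Y (fst z))) = (\<lambda>(\<omega>, x). block_kernel m n \<omega> k x)"
    by (auto simp: block_kernel_def translation_kernel_def fun_eq_iff)
  finally show ?thesis .
qed

lemma nn_integral_block_kernel:
  assumes \<omega>: "\<omega> \<in> space M" and k: "1 \<le> k" and x: "x \<in> space E" and h: "h \<in> borel_measurable E"
  shows "(\<integral>\<^sup>+y. h y \<partial>block_kernel m n \<omega> k x) = (if m + k \<in> isolated \<xi> u (m + n) \<omega>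
    then \<integral>\<^sup>+y. h (x \<otimes>\<^bsub>G\<^esub> y) \<partial>\<mu> else h (x \<otimes>\<^bsub>G\<^esub> X (m + k) \<omega>))"
proof -
  have "(\<lambda>y. x \<otimes>\<^bsub>G\<^esub> y) \<in> E \<rightarrow>\<^sub>M E" using x by (intro mult_comp) auto
  then have "(\<lambda>y. x \<otimes>\<^bsub>G\<^esub> y) \<in> \<mu> \<rightarrow>\<^sub>M E" using measurable_cong_sets[OF step_law(2) refl] by blast
  moreover have "x \<otimes>\<^bsub>G\<^esub> X (m + k) \<omega> \<in> space E"
    using x X_space[OF \<omega>, of "m + k"] k by (simp add: space_E)
  ultimately show ?thesis
    using h by (simp add: block_kernel_def mult_kernel_def translation_kernel_def nn_integral_distr nn_integral_return)
qed

text \<open>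
  The law of the path of length \<open>k\<close> predicted from the information revealed by a block of length
  \<open>n \<ge> k\<close>; the parameter \<open>n\<close> decides which vertices count as isolated.
\<close>

definition block_law :: "nat \<Rightarrow> nat \<Rightarrow> nat \<Rightarrow> 'w \<Rightarrow> (nat \<Rightarrow> 'a) measure" where
  "block_law m n k \<omega> = markov_law E (block_kernel m n \<omega>) (walk G X m \<omega>) k"

lemma block_law_measurable:
  "k \<le> n \<Longrightarrow> block_law m n k \<in> block_at m n \<rightarrow>\<^sub>M prob_algebra (path_space E k)"
  unfolding block_law_def[abs_def]
  by (intro measurable_markov_law block_kernel_measurable block_at_measurable(1) walk_\<A>) auto

text \<open>
  Fubini: by independence the joint law of \<open>g\<^sub>i\<close> and of all other sources is a product measure.
\<close>

lemma nn_integral_label: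
  fixes F :: "'w \<times> 'a \<Rightarrow> ennreal"
  assumes i: "1 \<le> i" and F: "F \<in> borel_measurable (info (sources - {Label i}) \<Otimes>\<^sub>M E)"
  shows "(\<integral>\<^sup>+\<omega>. F (\<omega>, g i \<omega>) \<partial>M) = (\<integral>\<^sup>+\<omega>. \<integral>\<^sup>+y. F (\<omega>, y) \<partial>\<mu> \<partial>M)"
proof -
  let ?D = "info (sources - {Label i})"
  have sub: "subalgebra M ?D" by (intro subalgebra_info) auto
  interpret \<mu>: prob_space \<mu> by (rule step_law)
  interpret R: prob_space "restr_to_subalg M ?D"
    by (rule prob_space_restr_to_subalg[OF sub prob_space_axioms])
  have id: "(\<lambda>\<omega>. \<omega>) \<in> M \<rightarrow>\<^sub>M ?D" using sub by (auto simp: measurable_def subalgebra_def)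
  have pair: "(\<lambda>\<omega>. (\<omega>, g i \<omega>)) \<in> M \<rightarrow>\<^sub>M ?D \<Otimes>\<^sub>M E"
    using id g_measurable[OF i] by (rule measurable_Pair)
  have setsR: "sets (restr_to_subalg M ?D \<Otimes>\<^sub>M \<mu>) = sets (?D \<Otimes>\<^sub>M E)"
    using sets_restr_to_subalg[OF sub] step_law(2) by (rule sets_pair_measure_cong)
  have eq: "restr_to_subalg M ?D \<Otimes>\<^sub>M \<mu> = distr M (?D \<Otimes>\<^sub>M E) (\<lambda>\<omega>. (\<omega>, g i \<omega>))"
  proof (rule pair_measure_eqI)
    fix A B assume A: "A \<in> sets (restr_to_subalg M ?D)" and "B \<in> sets \<mu>"
    then have A': "A \<in> sets ?D" and B: "B \<in> sets E"
      using sets_restr_to_subalg[OF sub] step_law(2) by auto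
    have gB: "g i -` B \<inter> space M \<in> sets (info {Label i})"
      using measurable_sets[OF info_measurable(2)[of i "{Label i}"] B] i by simp
    have "emeasure (distr M (?D \<Otimes>\<^sub>M E) (\<lambda>\<omega>. (\<omega>, g i \<omega>))) (A \<times> B) =
        emeasure M ((\<lambda>\<omega>. (\<omega>, g i \<omega>)) -` (A \<times> B) \<inter> space M)"
      using pair A' B by (intro emeasure_distr) auto
    also have "(\<lambda>\<omega>. (\<omega>, g i \<omega>)) -` (A \<times> B) \<inter> space M = A \<inter> (g i -` B \<inter> space M)"
      using sets.sets_into_space[OF A'] by auto
    also have "emeasure M \<dots> = ennreal (prob A * prob (g i -` B \<inter> space M))"
      unfolding emeasure_eq_measure using A' gB i
      by (subst info_indep[of "sources - {Label i}" "{Label i}"]) (auto simp: sources_def)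
    also have "prob (g i -` B \<inter> space M) = measure \<mu> B"
      using measure_distr[OF g_measurable[OF i] B] g_law[OF i] by simp
    also have "ennreal (prob A * measure \<mu> B) = emeasure (restr_to_subalg M ?D) A * emeasure \<mu> B"
      using A' sub by (simp add: emeasure_restr_to_subalg[OF sub] emeasure_eq_measure \<mu>.emeasure_eq_measure ennreal_mult)
    finally show "emeasure (restr_to_subalg M ?D) A * emeasure \<mu> B =
      emeasure (distr M (?D \<Otimes>\<^sub>M E) (\<lambda>\<omega>. (\<omega>, g i \<omega>))) (A \<times> B)" by simp
  qed (use setsR in \<open>simp_all add: \<mu>.sigma_finite_measure_axioms R.sigma_finite_measure_axioms\<close>)
  have F': "F \<in> borel_measurable (restr_to_subalg M ?D \<Otimes>\<^sub>M \<mu>)"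
    using F measurable_cong_sets[OF setsR refl] by blast
  have inner: "(\<lambda>\<omega>. \<integral>\<^sup>+y. F (\<omega>, y) \<partial>\<mu>) \<in> borel_measurable ?D"
    using \<mu>.borel_measurable_nn_integral_fst[OF F'] measurable_cong_sets[OF sets_restr_to_subalg[OF sub] refl] by blast
  have "(\<integral>\<^sup>+\<omega>. F (\<omega>, g i \<omega>) \<partial>M) = (\<integral>\<^sup>+z. F z \<partial>distr M (?D \<Otimes>\<^sub>M E) (\<lambda>\<omega>. (\<omega>, g i \<omega>)))"
    using pair F by (subst nn_integral_distr) auto
  also have "\<dots> = (\<integral>\<^sup>+\<omega>. \<integral>\<^sup>+y. F (\<omega>, y) \<partial>\<mu> \<partial>restr_to_subalg M ?D)"
    unfolding eq[symmetric] by (rule \<mu>.nn_integral_fst[OF F', symmetric])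
  also have "\<dots> = (\<integral>\<^sup>+\<omega>. \<integral>\<^sup>+y. F (\<omega>, y) \<partial>\<mu> \<partial>M)"
    by (rule nn_integral_subalgebra2[OF sub inner])
  finally show ?thesis .
qed

lemma measurable_path_step:
  assumes "Y \<in> D \<rightarrow>\<^sub>M path_space E k" "y \<in> D \<rightarrow>\<^sub>M E"
  shows "(\<lambda>z. (Y z)(Suc k := Y z k \<otimes>\<^bsub>G\<^esub> y z)) \<in> D \<rightarrow>\<^sub>M path_space E (Suc k)"
proof -
  have "(\<lambda>p. p k) \<in> path_space E k \<rightarrow>\<^sub>M E" by (rule measurable_component_singleton) simp
  from mult_comp[OF measurable_compose[OF assms(1) this] assms(2)]
  have "(\<lambda>z. (Y z, Y z k \<otimes>\<^bsub>G\<^esub> y z)) \<in> D \<rightarrow>\<^sub>M path_space E k \<Otimes>\<^sub>M E"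
    using assms(1) by (intro measurable_Pair)
  from measurable_compose[OF this measurable_path_extend] show ?thesis by simp
qed

text \<open>
  Induction on the length \<open>k\<close> of the path, for test functions that may depend on the revealed
  information. In the induction step let \<open>i = m + k + 1\<close>. If \<open>i\<close> is not isolated, the new position is
  a function of the old path and of a revealed step, which the test function can absorb. If \<open>i\<close> is
  isolated, the step is the label \<open>g\<^sub>i\<close>, on which the path up to time \<open>m + k\<close> and, on this event, the
  revealed information do not depend; the label is then integrated out by Fubini. The proof works
  with the joint integral because the path up to time \<open>m + k\<close> is not itself revealed.
\<close>

lemma nn_integral_block_path:
  fixes f :: "'w \<times> (nat \<Rightarrow> 'a) \<Rightarrow> ennreal"
  assumes "k \<le> n" "f \<in> borel_measurable (block_at m n \<Otimes>\<^sub>M path_space E k)"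
  shows "(\<integral>\<^sup>+\<omega>. f (\<omega>, block_path m k \<omega>) \<partial>M) = (\<integral>\<^sup>+\<omega>. \<integral>\<^sup>+p. f (\<omega>, p) \<partial>block_law m n k \<omega> \<partial>M)"
  using assms
proof (induction k arbitrary: f)
  case 0
  show ?case
  proof (rule nn_integral_cong)
    fix \<omega> assume \<omega>: "\<omega> \<in> space M"
    have p0: "(\<lambda>i\<in>{0..0}. walk G X m \<omega>) \<in> space (path_space E 0)"
      using measurable_space[OF walk_events \<omega>] by (auto simp: space_PiM)
    have "(\<lambda>p. f (\<omega>, p)) \<in> borel_measurable (path_space E 0)"
      using 0(2) \<omega> by (intro measurable_compose[OF measurable_Pair1' 0(2)]) simp
    then have "(\<integral>\<^sup>+p. f (\<omega>, p) \<partial>return (path_space E 0) (\<lambda>i\<in>{0..0}. walk G X m \<omega>)) = f (\<omega>, \<lambda>i\<in>{0..0}. walk G X m \<omega>)"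
      using p0 by (intro nn_integral_return)
    moreover have "block_path m 0 \<omega> = (\<lambda>i\<in>{0..0}. walk G X m \<omega>)"
      by (auto simp: block_path_def fun_eq_iff)
    ultimately show "f (\<omega>, block_path m 0 \<omega>) = (\<integral>\<^sup>+p. f (\<omega>, p) \<partial>block_law m n 0 \<omega>)"
      unfolding block_law_def markov_law.simps by simp
  qed
next
  case (Suc k)
  let ?i = "m + Suc k" and ?B = "block_at m n" and ?P = "path_space E"
  let ?D = "info (sources - {Label ?i})"
  let ?Y = "\<lambda>\<omega>. if ?i \<le> m \<or> ?i \<notin> isolated \<xi> u (m + n) \<omega> then X ?i \<omega> else \<one>\<^bsub>G\<^esub>"
  define I where "I = {\<omega> \<in> space M. ?i \<in> isolated \<xi> u (m + n) \<omega>}"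
  note f = Suc.prems(2)
  have Y: "?Y \<in> ?B \<rightarrow>\<^sub>M E" using Suc.prems by (intro revealed_step_measurable) auto
  have IB: "I \<in> sets ?B" using block_at_measurable(4)[where m = m and n = n and i = ?i] by (simp add: I_def pred_def)
  have I_trace: "A \<inter> I \<in> sets ?D" if "A \<in> sets ?B" for A
    unfolding I_def using that Suc.prems(1) by (intro block_at_info) auto
  have ID: "I \<in> sets ?D" using I_trace[OF IB] by simp
  interpret \<mu>: prob_space \<mu> by (rule step_law)
  \<comment> \<open>\<open>F\<close> is the contribution of an isolated \<open>i\<close> as a function of the other sources and of \<open>g\<^sub>i\<close>; \<open>fI\<close> and
    \<open>fN\<close> are the test functions on paths of length \<open>k\<close> to which the two cases lead.\<close>
  define F where "F = (\<lambda>z. f (fst z, (block_path m k (fst z))(Suc k := block_path m k (fst z) k \<otimes>\<^bsub>G\<^esub> snd z)) * indicator I (fst z))"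
  define fI where "fI = (\<lambda>z. (\<integral>\<^sup>+y. f (fst z, (snd z)(Suc k := snd z k \<otimes>\<^bsub>G\<^esub> y)) \<partial>\<mu>) * indicator I (fst z))"
  define fN where "fN = (\<lambda>z. f (fst z, (snd z)(Suc k := snd z k \<otimes>\<^bsub>G\<^esub> ?Y (fst z))) * indicator (space M - I) (fst z))"
  have F: "F \<in> borel_measurable (?D \<Otimes>\<^sub>M E)"
  proof -
    \<comment> \<open>The path up to time \<open>m + k\<close> uses only labels of vertices before \<open>i\<close>.\<close>
    have path: "block_path m k \<in> ?D \<rightarrow>\<^sub>M ?P k"
    proof (rule block_path_measurable)
      fix j assume j: "1 \<le> j" "j \<le> m + k"
      have "past j \<subseteq> sources - {Label ?i}" using j by (auto simp: past_def sources_def)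
      with j show "X j \<in> ?D \<rightarrow>\<^sub>M E" by (intro X_info)
    qed
    have step: "(\<lambda>z. (fst z, (block_path m k (fst z))(Suc k := block_path m k (fst z) k \<otimes>\<^bsub>G\<^esub> snd z)))
        \<in> ?D \<Otimes>\<^sub>M E \<rightarrow>\<^sub>M ?D \<Otimes>\<^sub>M ?P (Suc k)"
      by (intro measurable_Pair measurable_fst measurable_path_step measurable_snd
          measurable_compose[OF measurable_fst path])
    have "(\<lambda>z. f z * indicator I (fst z)) \<in> borel_measurable (?D \<Otimes>\<^sub>M ?P (Suc k))"
      by (rule measurable_indicator_mult_transfer[OF _ ID I_trace f]) simp_all
    from measurable_compose[OF step this] show ?thesis by (simp add: F_def)
  qed
  have fI: "fI \<in> borel_measurable (?B \<Otimes>\<^sub>M ?P k)"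
  proof -
    have step: "(\<lambda>z. (fst (fst z), (snd (fst z))(Suc k := snd (fst z) k \<otimes>\<^bsub>G\<^esub> snd z)))
        \<in> (?B \<Otimes>\<^sub>M ?P k) \<Otimes>\<^sub>M \<mu> \<rightarrow>\<^sub>M ?B \<Otimes>\<^sub>M ?P (Suc k)"
    proof (intro measurable_Pair measurable_path_step)
      show "(\<lambda>z. fst (fst z)) \<in> (?B \<Otimes>\<^sub>M ?P k) \<Otimes>\<^sub>M \<mu> \<rightarrow>\<^sub>M ?B"
        by (rule measurable_compose[OF measurable_fst measurable_fst])
      show "(\<lambda>z. snd (fst z)) \<in> (?B \<Otimes>\<^sub>M ?P k) \<Otimes>\<^sub>M \<mu> \<rightarrow>\<^sub>M ?P k"
        by (rule measurable_compose[OF measurable_fst measurable_snd])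
      show "snd \<in> (?B \<Otimes>\<^sub>M ?P k) \<Otimes>\<^sub>M \<mu> \<rightarrow>\<^sub>M E"
        using measurable_snd[of "?B \<Otimes>\<^sub>M ?P k" \<mu>] measurable_cong_sets[OF refl step_law(2)] by blast
    qed
    have "(\<lambda>z. \<integral>\<^sup>+y. f (fst z, (snd z)(Suc k := snd z k \<otimes>\<^bsub>G\<^esub> y)) \<partial>\<mu>) \<in> borel_measurable (?B \<Otimes>\<^sub>M ?P k)"
      using measurable_compose[OF step f]
      by (intro \<mu>.borel_measurable_nn_integral) (simp add: case_prod_beta')
    then show ?thesis unfolding fI_def
      by (rule borel_measurable_times_ennreal[OF _ measurable_compose[OF measurable_fst borel_measurable_indicator[OF IB]]])
  qed
  have fN: "fN \<in> borel_measurable (?B \<Otimes>\<^sub>M ?P k)"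
  proof -
    have step: "(\<lambda>z. (fst z, (snd z)(Suc k := snd z k \<otimes>\<^bsub>G\<^esub> ?Y (fst z)))) \<in> ?B \<Otimes>\<^sub>M ?P k \<rightarrow>\<^sub>M ?B \<Otimes>\<^sub>M ?P (Suc k)"
      by (intro measurable_Pair measurable_fst measurable_path_step measurable_snd
          measurable_compose[OF measurable_fst Y])
    have N: "space M - I \<in> sets ?B" using sets.compl_sets[OF IB] by simp
    from measurable_compose[OF step f] show ?thesis unfolding fN_def
      by (rule borel_measurable_times_ennreal[OF _ measurable_compose[OF measurable_fst borel_measurable_indicator[OF N]]])
  qed
  have meas_path: "(\<lambda>\<omega>. h (\<omega>, block_path m k \<omega>)) \<in> borel_measurable M"
    if "h \<in> borel_measurable (?B \<Otimes>\<^sub>M ?P k)" for h :: "'w \<times> (nat \<Rightarrow> 'a) \<Rightarrow> ennreal"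
  proof -
    have "(\<lambda>\<omega>. \<omega>) \<in> M \<rightarrow>\<^sub>M ?B" by (rule measurable_from_subalg[OF subalgebra_block_at measurable_ident[unfolded id_def]])
    moreover have "block_path m k \<in> M \<rightarrow>\<^sub>M ?P k" by (intro block_path_measurable X_measurable)
    ultimately show ?thesis using that by (intro measurable_compose[OF measurable_Pair that])
  qed
  have "(\<integral>\<^sup>+\<omega>. f (\<omega>, block_path m (Suc k) \<omega>) \<partial>M) =
      (\<integral>\<^sup>+\<omega>. F (\<omega>, g ?i \<omega>) + fN (\<omega>, block_path m k \<omega>) \<partial>M)"
  proof (rule nn_integral_cong)
    fix \<omega> assume \<omega>: "\<omega> \<in> space M"
    show "f (\<omega>, block_path m (Suc k) \<omega>) = F (\<omega>, g ?i \<omega>) + fN (\<omega>, block_path m k \<omega>)"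
    proof (cases "\<omega> \<in> I")
      case True
      then have "X ?i \<omega> = g ?i \<omega>" using isolated_step[OF \<omega>] by (auto simp: I_def)
      with True show ?thesis by (simp add: F_def fN_def block_path_Suc del: add_Suc_right)
    next
      case False
      with \<omega> show ?thesis by (simp add: F_def fN_def block_path_Suc I_def del: add_Suc_right)
    qed
  qed
  also have "\<dots> = (\<integral>\<^sup>+\<omega>. F (\<omega>, g ?i \<omega>) \<partial>M) + (\<integral>\<^sup>+\<omega>. fN (\<omega>, block_path m k \<omega>) \<partial>M)"
  proof (rule nn_integral_add)
    have id: "(\<lambda>\<omega>. \<omega>) \<in> M \<rightarrow>\<^sub>M ?D"
      using subalgebra_info[of "sources - {Label ?i}"] by (auto simp: measurable_def subalgebra_def)
    show "(\<lambda>\<omega>. F (\<omega>, g ?i \<omega>)) \<in> borel_measurable M"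
      by (rule measurable_compose[OF measurable_Pair[OF id g_measurable] F]) simp
  qed (rule meas_path[OF fN])
  also have "(\<integral>\<^sup>+\<omega>. F (\<omega>, g ?i \<omega>) \<partial>M) = (\<integral>\<^sup>+\<omega>. \<integral>\<^sup>+y. F (\<omega>, y) \<partial>\<mu> \<partial>M)"
    by (rule nn_integral_label[OF _ F]) simp
  also have "\<dots> = (\<integral>\<^sup>+\<omega>. fI (\<omega>, block_path m k \<omega>) \<partial>M)"
    by (rule nn_integral_cong) (auto simp: F_def fI_def indicator_def)
  also have "\<dots> + (\<integral>\<^sup>+\<omega>. fN (\<omega>, block_path m k \<omega>) \<partial>M) =
      (\<integral>\<^sup>+\<omega>. fI (\<omega>, block_path m k \<omega>) + fN (\<omega>, block_path m k \<omega>) \<partial>M)"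
    by (rule nn_integral_add[symmetric]; rule meas_path; rule fI fN)
  also have "\<dots> = (\<integral>\<^sup>+\<omega>. \<integral>\<^sup>+p. fI (\<omega>, p) + fN (\<omega>, p) \<partial>block_law m n k \<omega> \<partial>M)"
    using Suc.IH[of "\<lambda>z. fI z + fN z"] Suc.prems(1) fI fN by simp
  also have "\<dots> = (\<integral>\<^sup>+\<omega>. \<integral>\<^sup>+p. f (\<omega>, p) \<partial>block_law m n (Suc k) \<omega> \<partial>M)"
  proof (rule nn_integral_cong)
    fix \<omega> assume \<omega>: "\<omega> \<in> space M"
    let ?K = "block_kernel m n \<omega>"
    have one_le_Suc: "1 \<le> Suc k" by simp
    have sp: "space (block_law m n k \<omega>) = space (?P k)"
      using measurable_space[OF block_law_measurable[of k n m], of \<omega>] \<omega> Suc.prems(1)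
      by (auto simp: space_prob_algebra dest: sets_eq_imp_space_eq)
    have f\<omega>: "(\<lambda>p. f (\<omega>, p)) \<in> borel_measurable (?P (Suc k))"
      using \<omega> by (intro measurable_compose[OF measurable_Pair1' f]) simp
    have "(\<integral>\<^sup>+p. f (\<omega>, p) \<partial>block_law m n (Suc k) \<omega>) =
        (\<integral>\<^sup>+p. \<integral>\<^sup>+y. f (\<omega>, p(Suc k := y)) \<partial>?K (Suc k) (p k) \<partial>block_law m n k \<omega>)"
      unfolding block_law_def
      using f\<omega> measurable_space[OF walk_events \<omega>] block_kernel_measurable_at[OF \<omega>]
      by (intro nn_integral_markov_law_Suc) auto
    also have "\<dots> = (\<integral>\<^sup>+p. fI (\<omega>, p) + fN (\<omega>, p) \<partial>block_law m n k \<omega>)"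
    proof (rule nn_integral_cong)
      fix p assume "p \<in> space (block_law m n k \<omega>)"
      then have p: "p \<in> space (?P k)" by (simp add: sp)
      then have pk: "p k \<in> space E" by (auto simp: space_PiM)
      have ext: "(\<lambda>y. p(Suc k := y)) \<in> E \<rightarrow>\<^sub>M ?P (Suc k)"
        using measurable_compose[OF measurable_Pair1'[OF p] measurable_path_extend] by simp
      have fp: "(\<lambda>y. f (\<omega>, p(Suc k := y))) \<in> borel_measurable E"
        by (rule measurable_compose[OF ext f\<omega>])
      show "(\<integral>\<^sup>+y. f (\<omega>, p(Suc k := y)) \<partial>?K (Suc k) (p k)) = fI (\<omega>, p) + fN (\<omega>, p)"
        unfolding nn_integral_block_kernel[OF \<omega> one_le_Suc pk fp]
        using \<omega> by (simp add: fI_def fN_def I_def del: add_Suc_right)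
    qed
    finally show "(\<integral>\<^sup>+p. fI (\<omega>, p) + fN (\<omega>, p) \<partial>block_law m n k \<omega>) = (\<integral>\<^sup>+p. f (\<omega>, p) \<partial>block_law m n (Suc k) \<omega>)" ..
  qed
  finally show ?case .
qed

lemma block_law_prob:
  assumes D: "D \<in> sets (block_at m n)" and A: "A \<in> sets (path_space E n)"
  shows "prob (D \<inter> {\<omega> \<in> space M. block_path m n \<omega> \<in> A}) = (\<integral>\<omega>\<in>D. measure (block_law m n n \<omega>) A \<partial>M)"
proof -
  have L: "block_law m n n \<in> block_at m n \<rightarrow>\<^sub>M prob_algebra (path_space E n)"
    by (rule block_law_measurable) simp
  have Lp: "prob_space (block_law m n n \<omega>)" and Ls: "sets (block_law m n n \<omega>) = sets (path_space E n)" if "\<omega> \<in> space M" for \<omega>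
    using measurable_space[OF L, of \<omega>] that by (auto simp: space_prob_algebra)
  have Y: "block_path m n \<in> M \<rightarrow>\<^sub>M path_space E n"
    by (intro block_path_measurable X_measurable)
  have YA: "{\<omega> \<in> space M. block_path m n \<omega> \<in> A} \<in> events"
    using measurable_sets[OF Y A] by (simp add: vimage_def Int_def conj_commute)
  note DM = sets_block_at_events[OF D]
  have m: "(\<lambda>\<omega>. measure (block_law m n n \<omega>) A) \<in> borel_measurable (block_at m n)"
    by (rule measurable_compose[OF L measurable_measure_prob_algebra[OF A]])
  then have mM: "(\<lambda>\<omega>. measure (block_law m n n \<omega>) A) \<in> borel_measurable M"
    by (rule measurable_from_subalg[OF subalgebra_block_at])
  let ?f = "\<lambda>z. indicator (D \<times> A) z :: ennreal"
  have "?f \<in> borel_measurable (block_at m n \<Otimes>\<^sub>M path_space E n)"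
    using D A by (intro borel_measurable_indicator) auto
  then have eq: "(\<integral>\<^sup>+\<omega>. ?f (\<omega>, block_path m n \<omega>) \<partial>M) = (\<integral>\<^sup>+\<omega>. \<integral>\<^sup>+p. ?f (\<omega>, p) \<partial>block_law m n n \<omega> \<partial>M)"
    by (rule nn_integral_block_path[OF order_refl])
  have "ennreal (prob (D \<inter> {\<omega> \<in> space M. block_path m n \<omega> \<in> A})) = (\<integral>\<^sup>+\<omega>. ?f (\<omega>, block_path m n \<omega>) \<partial>M)"
  proof -
    have "(\<integral>\<^sup>+\<omega>. ?f (\<omega>, block_path m n \<omega>) \<partial>M) =
        (\<integral>\<^sup>+\<omega>. indicator (D \<inter> {\<omega> \<in> space M. block_path m n \<omega> \<in> A}) \<omega> \<partial>M)"
      by (rule nn_integral_cong) (auto simp: indicator_def)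
    also have "\<dots> = emeasure M (D \<inter> {\<omega> \<in> space M. block_path m n \<omega> \<in> A})"
      using DM YA by simp
    finally show ?thesis by (simp add: emeasure_eq_measure)
  qed
  also have "\<dots> = (\<integral>\<^sup>+\<omega>. ennreal (indicator D \<omega> * measure (block_law m n n \<omega>) A) \<partial>M)"
    unfolding eq
  proof (rule nn_integral_cong)
    fix \<omega> assume \<omega>: "\<omega> \<in> space M"
    interpret L: prob_space "block_law m n n \<omega>" by (rule Lp[OF \<omega>])
    have "(\<integral>\<^sup>+p. ?f (\<omega>, p) \<partial>block_law m n n \<omega>) = (\<integral>\<^sup>+p. indicator D \<omega> * indicator A p \<partial>block_law m n n \<omega>)"
      by (rule nn_integral_cong) (auto simp: indicator_def)
    also have "\<dots> = indicator D \<omega> * emeasure (block_law m n n \<omega>) A"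
      using A Ls[OF \<omega>] by (simp add: nn_integral_cmult)
    also have "\<dots> = ennreal (indicator D \<omega> * measure (block_law m n n \<omega>) A)"
      by (auto simp: indicator_def L.emeasure_eq_measure)
    finally show "(\<integral>\<^sup>+p. ?f (\<omega>, p) \<partial>block_law m n n \<omega>) = ennreal (indicator D \<omega> * measure (block_law m n n \<omega>) A)" .
  qed
  also have "\<dots> = ennreal (\<integral>\<omega>. indicator D \<omega> * measure (block_law m n n \<omega>) A \<partial>M)"
  proof (rule nn_integral_eq_integral)
    show "integrable M (\<lambda>\<omega>. indicator D \<omega> * measure (block_law m n n \<omega>) A)"
    proof (rule integrable_const_bound[where B = 1])
      show "AE \<omega> in M. norm (indicator D \<omega> * measure (block_law m n n \<omega>) A) \<le> 1"
        using AE_space by eventually_elim (auto simp: indicator_def prob_space.prob_le_1[OF Lp])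
    qed (use mM DM in measurable)
  qed (auto simp: indicator_def)
  finally have "prob (D \<inter> {\<omega> \<in> space M. block_path m n \<omega> \<in> A}) =
      (\<integral>\<omega>. indicator D \<omega> * measure (block_law m n n \<omega>) A \<partial>M)"
    by (subst (asm) ennreal_inj) (auto intro!: Bochner_Integration.integral_nonneg)
  then show ?thesis by (simp add: set_lebesgue_integral_def)
qed

text \<open>
  Isolated labels are split off one at a time: the event \<open>D\<close> together with the other labels does
  not involve the label that is split off.
\<close>

lemma block_labels_prob:
  assumes "finite K" "K \<subseteq> {1..n}" "\<And>k. k \<in> K \<Longrightarrow> A k \<in> sets E" "D \<in> sets (block_at m n)"
    and "\<And>\<omega> k. \<omega> \<in> D \<Longrightarrow> k \<in> K \<Longrightarrow> m + k \<in> isolated \<xi> u (m + n) \<omega>"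
  shows "prob (D \<inter> {\<omega> \<in> space M. \<forall>k\<in>K. g (m + k) \<omega> \<in> A k}) = prob D * (\<Prod>k\<in>K. measure \<mu> (A k))"
  using assms
proof (induction K)
  case empty
  then have "D \<inter> space M = D" using sets.sets_into_space[OF empty(3)] by auto
  then show ?case by (simp add: Int_def)
next
  case (insert a K)
  let ?W = "\<lambda>K. {\<omega> \<in> space M. \<forall>k\<in>K. g (m + k) \<omega> \<in> A k}" and ?i = "m + a"
  let ?I = "info (sources - {Label ?i})"
  have a: "1 \<le> a" "a \<le> n" using insert.prems by auto
  have "D \<inter> {\<omega> \<in> space M. ?i \<in> isolated \<xi> u (m + n) \<omega>} \<in> sets ?I"
    using insert.prems(3) a by (intro block_at_info) auto
  also have "D \<inter> {\<omega> \<in> space M. ?i \<in> isolated \<xi> u (m + n) \<omega>} = D"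
    using insert.prems(4) sets.sets_into_space[OF insert.prems(3)] by auto
  finally have DI: "D \<in> sets ?I" .
  have "Measurable.pred ?I (\<lambda>\<omega>. \<forall>k\<in>K. g (m + k) \<omega> \<in> A k)"
  proof (rule pred_intros_finite(3)[OF insert.hyps(1)])
    fix k assume k: "k \<in> K"
    have "g (m + k) \<in> ?I \<rightarrow>\<^sub>M E"
      using k insert.prems(1) insert.hyps(2) by (intro info_measurable) (auto simp: sources_def)
    with k insert.prems(2) show "Measurable.pred ?I (\<lambda>\<omega>. g (m + k) \<omega> \<in> A k)" by (intro pred_sets2) auto
  qed
  then have WI: "?W K \<in> sets ?I" by (simp add: pred_def)
  have gi: "g ?i -` A a \<inter> space M \<in> sets (info {Label ?i})"
    using measurable_sets[OF info_measurable(2)[of ?i "{Label ?i}"], of "A a"] a insert.prems(2) by simp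
  have "D \<inter> ?W (insert a K) = (D \<inter> ?W K) \<inter> (g ?i -` A a \<inter> space M)" by auto
  also have "prob \<dots> = prob (D \<inter> ?W K) * prob (g ?i -` A a \<inter> space M)"
    using a by (intro info_indep[OF _ _ _ sets.Int[OF DI WI] gi]) (auto simp: sources_def)
  also have "prob (g ?i -` A a \<inter> space M) = measure \<mu> (A a)"
    using measure_distr[OF g_measurable[of ?i], of "A a"] g_law[of ?i] a insert.prems(2) by simp
  also have "prob (D \<inter> ?W K) = prob D * (\<Prod>k\<in>K. measure \<mu> (A k))"
    using insert.prems by (intro insert.IH) auto
  finally show ?case using insert.hyps by simp
qed

section \<open>Conditional laws given the block information\<close>

context
  fixes B \<tau> and n :: nat
  assumes B\<tau>: "fixed_or_stopping M \<A> B \<tau>"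
begin

abbreviation "\<G> \<equiv> block B \<tau> n"

lemma admissible:
  obtains Q where "sampled M \<A> B \<tau> Q" "sampled M (\<lambda>m. block_at m n) \<G> \<tau> Q"
    "contains_at M \<A> B \<tau>" "contains_at M (\<lambda>m. block_at m n) \<G> \<tau>"
    "space B = space M" "space \<G> = space M" "subalgebra M \<G>"
proof -
  from fixed_or_stopping_sampled[OF subalgebra_\<A> \<A>_mono B\<tau>]
  obtain Q where 1: "sampled M \<A> B \<tau> Q" and 2: "contains_at M \<A> B \<tau>" by auto
  have 3: "space B = space M" using 1 by (simp add: sampled_def subalgebra_def)
  have 4: "sampled M (\<lambda>m. block_at m n) \<G> \<tau> Q" by (rule sampled_block[OF 1 2])
  have 5: "contains_at M (\<lambda>m. block_at m n) \<G> \<tau>" by (rule contains_at_block[OF 3 2])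
  have 6: "subalgebra M \<G>" using 4 by (simp add: sampled_def)
  show thesis by (rule that[OF 1 4 2 5 3 space_block[OF 3] 6])
qed

lemma revealed_event:
  assumes "\<And>m. Measurable.pred (block_at m n) (P m)"
  shows "{\<omega> \<in> space M. P (\<tau> \<omega>) \<omega>} \<in> sets \<G>"
proof -
  have c: "contains_at M (\<lambda>m. block_at m n) \<G> \<tau>" and sp: "space \<G> = space M" by (rule admissible; assumption)+
  from measurable_at_random_time[OF sp space_block_at c assms] sp show ?thesis by (simp add: pred_def)
qed

lemma event_at_time:
  assumes "\<And>m. Measurable.pred M (P m)"
  shows "{\<omega> \<in> space M. P (\<tau> \<omega>) \<omega>} \<in> events"
proof -
  obtain Q where S: "sampled M \<A> B \<tau> Q" and c: "contains_at M \<A> B \<tau>" by (rule admissible)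
  from measurable_at_random_time[OF refl refl contains_at_events[OF S c space_\<A>] assms] show ?thesis by (simp add: pred_def)
qed

lemma isolated_labels_conditionally_iid:
  assumes K: "K \<subseteq> {1..n}" and A: "\<And>k. k \<in> K \<Longrightarrow> A k \<in> sets E"
  shows "AE \<omega> in M. (\<forall>k\<in>K. \<tau> \<omega> + k \<in> isolated \<xi> u (\<tau> \<omega> + n) \<omega>) \<longrightarrow>
     prob_given M \<G> {\<omega> \<in> space M. \<forall>k\<in>K. g (\<tau> \<omega> + k) \<omega> \<in> A k} \<omega> = (\<Prod>k\<in>K. measure \<mu> (A k))"
proof -
  obtain Q where S: "sampled M (\<lambda>m. block_at m n) \<G> \<tau> Q" by (rule admissible)
  have finK: "finite K" using K finite_subset by blast
  let ?R = "{\<omega> \<in> space M. \<forall>k\<in>K. \<tau> \<omega> + k \<in> isolated \<xi> u (\<tau> \<omega> + n) \<omega>}"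
  let ?W = "{\<omega> \<in> space M. \<forall>k\<in>K. g (\<tau> \<omega> + k) \<omega> \<in> A k}"
  have R: "?R \<in> sets \<G>"
    by (rule revealed_event, rule pred_intros_finite(3)[OF finK], rule block_at_measurable(4))
  have W: "?W \<in> events"
  proof (rule event_at_time, rule pred_intros_finite(3)[OF finK])
    show "Measurable.pred M (\<lambda>\<omega>. g (m + k) \<omega> \<in> A k)" if "k \<in> K" for k m
      using that K by (intro pred_sets2[OF A g_measurable]) auto
  qed
  have "AE \<omega> in M. \<omega> \<in> ?R \<longrightarrow> prob_given M \<G> ?W \<omega> = (\<Prod>k\<in>K. measure \<mu> (A k))"
  proof (rule sampled_prob_given_eq[OF S R W])
    fix m D assume D: "D \<in> sets (block_at m n)" "D \<in> events" "D \<subseteq> Q m" "D \<subseteq> ?R"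
    have \<tau>: "\<tau> \<omega> = m" if "\<omega> \<in> D" for \<omega> using S D(3) that by (auto simp: sampled_def)
    have "D \<inter> ?W = D \<inter> {\<omega> \<in> space M. \<forall>k\<in>K. g (m + k) \<omega> \<in> A k}" using \<tau> by auto
    also have "prob \<dots> = prob D * (\<Prod>k\<in>K. measure \<mu> (A k))"
      using finK K A D(1)
    proof (rule block_labels_prob)
      show "m + k \<in> isolated \<xi> u (m + n) \<omega>" if "\<omega> \<in> D" "k \<in> K" for \<omega> k
        using that D(4) \<tau>[OF that(1)] by auto
    qed
    also have "\<dots> = (\<integral>\<omega>\<in>D. (\<Prod>k\<in>K. measure \<mu> (A k)) \<partial>M)"
      using D(2) by (simp add: set_lebesgue_integral_def)
    finally show "prob (D \<inter> ?W) = (\<integral>\<omega>\<in>D. (\<Prod>k\<in>K. measure \<mu> (A k)) \<partial>M)" .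
  qed simp_all
  with AE_space show ?thesis by eventually_elim auto
qed

text \<open>
  The step is evaluated at a random time after replacing its values at isolated vertices by the
  unit; on the part of the sample space in question nothing is replaced.
\<close>

lemma revealed_steps:
  assumes k: "k \<in> {1..n}"
  shows "(\<lambda>\<omega>. X (\<tau> \<omega> + k) \<omega>)
    \<in> restrict_space \<G> {\<omega> \<in> space M. \<tau> \<omega> + k \<notin> isolated \<xi> u (\<tau> \<omega> + n) \<omega>} \<rightarrow>\<^sub>M E"
proof -
  have c: "contains_at M (\<lambda>m. block_at m n) \<G> \<tau>" and sp: "space \<G> = space M" by (rule admissible; assumption)+
  let ?Y = "\<lambda>m \<omega>. if m + k \<le> m \<or> m + k \<notin> isolated \<xi> u (m + n) \<omega> then X (m + k) \<omega> else \<one>\<^bsub>G\<^esub>"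
  have "?Y m \<in> block_at m n \<rightarrow>\<^sub>M E" for m
    by (rule revealed_step_measurable) (use k in auto)
  then have "(\<lambda>\<omega>. ?Y (\<tau> \<omega>) \<omega>) \<in> \<G> \<rightarrow>\<^sub>M E"
    by (rule measurable_at_random_time[OF sp space_block_at c])
  then have "(\<lambda>\<omega>. ?Y (\<tau> \<omega>) \<omega>)
      \<in> restrict_space \<G> {\<omega> \<in> space M. \<tau> \<omega> + k \<notin> isolated \<xi> u (\<tau> \<omega> + n) \<omega>} \<rightarrow>\<^sub>M E"
    by (rule measurable_restrict_space1)
  then show ?thesis
    by (rule measurable_cong[THEN iffD1, rotated]) (auto simp: space_restrict_space)
qed

lemma block_path_cond_law:
  "is_cond_law M \<G> (\<lambda>\<omega>. block_path (\<tau> \<omega>) n \<omega>) (path_space E n) (\<lambda>\<omega>. block_law (\<tau> \<omega>) n n \<omega>)"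
  unfolding is_cond_law_def
proof (intro conjI ballI)
  obtain Q where S: "sampled M (\<lambda>m. block_at m n) \<G> \<tau> Q" and SB: "sampled M \<A> B \<tau> Q"
    and cB: "contains_at M \<A> B \<tau>"
    and c: "contains_at M (\<lambda>m. block_at m n) \<G> \<tau>" and sp: "space \<G> = space M" and sub: "subalgebra M \<G>"
    by (rule admissible)
  have cM: "contains_at M (\<lambda>_. M) M \<tau>"
    by (rule contains_at_events[OF SB cB space_\<A>])
  show Y: "(\<lambda>\<omega>. block_path (\<tau> \<omega>) n \<omega>) \<in> M \<rightarrow>\<^sub>M path_space E n"
    by (rule measurable_at_random_time[OF refl refl cM]) (intro block_path_measurable X_measurable)
  show L: "(\<lambda>\<omega>. block_law (\<tau> \<omega>) n n \<omega>) \<in> \<G> \<rightarrow>\<^sub>M prob_algebra (path_space E n)"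
    by (rule measurable_at_random_time[OF sp space_block_at c]) (rule block_law_measurable, simp)
  fix A :: "(nat \<Rightarrow> 'a) set" assume A: "A \<in> sets (path_space E n)"
  let ?W = "(\<lambda>\<omega>. block_path (\<tau> \<omega>) n \<omega>) -` A \<inter> space M" and ?h = "\<lambda>\<omega>. measure (block_law (\<tau> \<omega>) n n \<omega>) A"
  have h: "?h \<in> borel_measurable \<G>"
    by (rule measurable_compose[OF L measurable_measure_prob_algebra[OF A]])
  have h_int: "integrable M ?h"
  proof (rule integrable_const_bound[where B = 1])
    have Lp: "prob_space (block_law (\<tau> \<omega>) n n \<omega>)" if "\<omega> \<in> space M" for \<omega>
      using measurable_space[OF L, of \<omega>] that sp by (auto simp: space_prob_algebra)
    show "AE \<omega> in M. norm (?h \<omega>) \<le> 1"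
      by (intro AE_I2) (simp add: prob_space.prob_le_1[OF Lp])
  qed (rule measurable_from_subalg[OF sub h])
  have "AE \<omega> in M. \<omega> \<in> space M \<longrightarrow> prob_given M \<G> ?W \<omega> = ?h \<omega>"
  proof (rule sampled_prob_given_eq[OF S _ _ h_int h])
    show "space M \<in> sets \<G>" using sets.top[of \<G>] sp by simp
    show "?W \<in> events" using Y A by (rule measurable_sets)
    fix m D assume D: "D \<in> sets (block_at m n)" "D \<in> events" "D \<subseteq> Q m"
    have \<tau>: "\<tau> \<omega> = m" if "\<omega> \<in> D" for \<omega> using S D(3) that by (auto simp: sampled_def)
    have "D \<inter> ?W = D \<inter> {\<omega> \<in> space M. block_path m n \<omega> \<in> A}" using \<tau> by auto
    also have "prob \<dots> = (\<integral>\<omega>\<in>D. measure (block_law m n n \<omega>) A \<partial>M)"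
      by (rule block_law_prob[OF D(1) A])
    also have "\<dots> = (\<integral>\<omega>\<in>D. ?h \<omega> \<partial>M)"
      unfolding set_lebesgue_integral_def
      by (rule Bochner_Integration.integral_cong) (auto simp: indicator_def \<tau>)
    finally show "prob (D \<inter> ?W) = (\<integral>\<omega>\<in>D. ?h \<omega> \<partial>M)" .
  qed
  with AE_space show "AE \<omega> in M. prob_given M \<G> ?W \<omega> = ?h \<omega>" by eventually_elim auto
qed

end

end

section \<open>The number of isolated vertices of a block\<close>

text \<open>
  Bernoulli's inequality in homogeneous form.
\<close>

lemma power_add_ge_first_order:
  fixes a b :: real
  assumes "0 \<le> a" "0 \<le> b"
  shows "a ^ l + real l * b * a ^ (l - 1) \<le> (a + b) ^ l"
proof (induction l)
  case (Suc l)
  have "a ^ Suc l + real (Suc l) * b * a ^ l = a * (a ^ l + real l * b * a ^ (l - 1)) + b * a ^ l"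
    by (cases l) (simp_all add: algebra_simps)
  also have "\<dots> \<le> a * (a + b) ^ l + b * (a + b) ^ l"
    using assms Suc.IH by (intro add_mono mult_left_mono power_mono) auto
  finally show ?case by (simp add: algebra_simps)
qed simp

text \<open>
  With \<open>p = 1 - \<alpha>\<close>, the left-hand side is the conditional expectation of \<open>(1 - z)\<^sup>J\<close> after one more
  vertex if there were \<open>l\<close> isolated vertices before: one is gained with probability \<open>p\<close>, and one is
  lost with probability \<open>(1 - p) l / t\<close>. The bound is again a power with exponent \<open>l\<close>, so the step
  can be iterated; its base belongs to the parameter \<open>z - z / t\<close>.
\<close>

lemma one_step_bound:
  fixes z p t :: real
  assumes z: "0 \<le> z" "z < 1" and p: "0 \<le> p" "p \<le> 1" and t: "0 < t"
  shows "p * (1 - z) ^ Suc l + (1 - p) * ((1 - real l / t) * (1 - z) ^ l + real l / t * (1 - z) ^ (l - 1))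
    \<le> (1 - p * z) * (1 - (z - z / t)) ^ l"
proof -
  let ?a = "1 - z"
  have a: "0 \<le> ?a" and b: "0 \<le> z / t" using z t by auto
  have split: "?a ^ l = (1 - z) * ?a ^ (l - 1)" if "l \<noteq> 0" using that by (cases l) auto
  have "(1 - real l / t) * ?a ^ l + real l / t * ?a ^ (l - 1) = ?a ^ l + real l * (z / t) * ?a ^ (l - 1)"
  proof (cases "l = 0")
    case False
    then show ?thesis unfolding split[OF False] by (simp add: algebra_simps)
  qed simp
  also have "\<dots> \<le> (?a + z / t) ^ l" by (rule power_add_ge_first_order[OF a b])
  finally have 1: "(1 - real l / t) * ?a ^ l + real l / t * ?a ^ (l - 1) \<le> (?a + z / t) ^ l" .
  have "?a ^ Suc l \<le> ?a * (?a + z / t) ^ l"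
    using a b by (auto intro!: mult_left_mono power_mono)
  then have "p * ?a ^ Suc l + (1 - p) * ((1 - real l / t) * ?a ^ l + real l / t * ?a ^ (l - 1))
      \<le> p * (?a * (?a + z / t) ^ l) + (1 - p) * (?a + z / t) ^ l"
    using 1 p by (intro add_mono mult_left_mono) auto
  also have "\<dots> = (1 - p * z) * (1 - (z - z / t)) ^ l" by (simp add: algebra_simps)
  finally show ?thesis .
qed

context srrw
begin

text \<open>
  The isolated vertices of the block at the moment when \<open>k\<close> of its vertices have been revealed.
\<close>

definition fresh :: "nat \<Rightarrow> nat \<Rightarrow> 'w \<Rightarrow> nat set" where
  "fresh m k \<omega> = isolated \<xi> u (m + k) \<omega> \<inter> {m + 1..m + k}"

lemma fresh_subset: "fresh m k \<omega> \<subseteq> {m + 1..m + k}" and finite_fresh: "finite (fresh m k \<omega>)"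
  by (auto simp: fresh_def)

lemma fresh_0 [simp]: "fresh m 0 \<omega> = {}" by (simp add: fresh_def)

lemma fresh_Suc:
  assumes \<omega>: "\<omega> \<in> space M"
  shows "fresh m (Suc k) \<omega> = (if 2 \<le> m + Suc k \<and> \<xi> (m + Suc k) \<omega> then fresh m k \<omega> - {u (m + Suc k) \<omega>}
    else insert (m + Suc k) (fresh m k \<omega>))"
proof (rule Set.set_eqI)
  fix i
  let ?j = "m + Suc k"
  have lt: "u j \<omega> < j" if "2 \<le> j" for j using u_range[OF that \<omega>] by simp
  have "i \<in> isolated \<xi> u ?j \<omega> \<longleftrightarrow> i \<in> isolated \<xi> u (m + k) \<omega> \<and> \<not> (2 \<le> ?j \<and> \<xi> ?j \<omega> \<and> u ?j \<omega> = i)"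
    if "i \<le> m + k"
    using that by (auto simp: isolated_iff[OF \<omega>] le_Suc_eq)
  moreover have "?j \<in> isolated \<xi> u ?j \<omega> \<longleftrightarrow> \<not> (2 \<le> ?j \<and> \<xi> ?j \<omega>)"
    using lt by (force simp: isolated_iff[OF \<omega>])
  moreover have "?j \<notin> isolated \<xi> u (m + k) \<omega>" by (simp add: isolated_iff[OF \<omega>])
  moreover have "u ?j \<omega> \<noteq> ?j" if "2 \<le> ?j" using lt[OF that] by simp
  ultimately show "i \<in> fresh m (Suc k) \<omega> \<longleftrightarrow> i \<in> (if 2 \<le> ?j \<and> \<xi> ?j \<omega> then fresh m k \<omega> - {u ?j \<omega>}
    else insert ?j (fresh m k \<omega>))"
    unfolding fresh_def by (cases "i = ?j"; cases "i \<le> m + k") (auto simp del: add_Suc_right)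
qed

lemma fresh_measurable:
  assumes "space D = space M"
    and "\<And>j. 2 \<le> j \<Longrightarrow> j \<le> m + k \<Longrightarrow> \<xi> j \<in> D \<rightarrow>\<^sub>M count_space UNIV"
    and "\<And>j. 2 \<le> j \<Longrightarrow> j \<le> m + k \<Longrightarrow> u j \<in> D \<rightarrow>\<^sub>M count_space UNIV"
  shows "{\<omega> \<in> space M. fresh m k \<omega> = L} \<in> sets D"
proof (cases "L \<subseteq> {m + 1..m + k}")
  case True
  have "Measurable.pred D (\<lambda>\<omega>. \<forall>i\<in>{m + 1..m + k}. i \<in> isolated \<xi> u (m + k) \<omega> \<longleftrightarrow> i \<in> L)"
  proof (rule pred_intros_finite(3))
    fix i
    have iso: "Measurable.pred D (\<lambda>\<omega>. i \<in> isolated \<xi> u (m + k) \<omega>)"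
      by (rule isolated_measurable[OF assms])
    then have "Measurable.pred D (\<lambda>\<omega>. \<not> i \<in> isolated \<xi> u (m + k) \<omega>)" by (rule pred_intros_logic(2))
    with iso show "Measurable.pred D (\<lambda>\<omega>. i \<in> isolated \<xi> u (m + k) \<omega> \<longleftrightarrow> i \<in> L)"
      by (cases "i \<in> L") simp_all
  qed simp
  then have "{\<omega> \<in> space M. \<forall>i\<in>{m + 1..m + k}. i \<in> isolated \<xi> u (m + k) \<omega> \<longleftrightarrow> i \<in> L} \<in> sets D"
    by (simp add: pred_def assms(1))
  also have "{\<omega> \<in> space M. \<forall>i\<in>{m + 1..m + k}. i \<in> isolated \<xi> u (m + k) \<omega> \<longleftrightarrow> i \<in> L} =
      {\<omega> \<in> space M. fresh m k \<omega> = L}"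
    using True by (auto simp: fresh_def)
  finally show ?thesis .
next
  case False
  then have "{\<omega> \<in> space M. fresh m k \<omega> = L} = {}" using fresh_subset by auto
  then show ?thesis by (simp only: sets.empty_sets)
qed

lemma fresh_events: "{\<omega> \<in> space M. fresh m k \<omega> = L} \<in> events"
  by (rule fresh_measurable) (auto intro: \<xi>_measurable u_measurable)

text \<open>
  The set \<open>fresh m k \<omega>\<close> takes finitely many values.
\<close>

lemma integral_fresh:
  fixes \<phi> :: "nat set \<Rightarrow> real"
  assumes A: "A \<in> events"
  shows "integrable M (\<lambda>\<omega>. \<phi> (fresh m k \<omega>))"
    and "(\<integral>\<omega>\<in>A. \<phi> (fresh m k \<omega>) \<partial>M) =
      (\<Sum>L\<in>Pow {m + 1..m + k}. \<phi> L * prob (A \<inter> {\<omega> \<in> space M. fresh m k \<omega> = L}))"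
proof -
  let ?S = "Pow {m + 1..m + k}" and ?E = "\<lambda>L. {\<omega> \<in> space M. fresh m k \<omega> = L}"
  have eq: "indicator A \<omega> * \<phi> (fresh m k \<omega>) = (\<Sum>L\<in>?S. \<phi> L * indicator (A \<inter> ?E L) \<omega>)"
    if \<omega>: "\<omega> \<in> space M" for \<omega> A
  proof -
    have "(\<Sum>L\<in>?S. \<phi> L * indicator (A \<inter> ?E L) \<omega>) =
        (\<Sum>L\<in>?S. if L = fresh m k \<omega> then \<phi> (fresh m k \<omega>) * indicator A \<omega> else 0)"
      using \<omega> by (intro sum.cong) (auto simp: indicator_def)
    also have "\<dots> = indicator A \<omega> * \<phi> (fresh m k \<omega>)"
      using fresh_subset[of m k \<omega>] by (simp add: mult.commute)
    finally show ?thesis ..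
  qed
  have int: "integrable M (\<lambda>\<omega>. \<Sum>L\<in>?S. \<phi> L * indicator (A \<inter> ?E L) \<omega>)" if "A \<in> events" for A
    by (intro Bochner_Integration.integrable_sum integral_scaled_indicator(1) sets.Int that fresh_events)
  have "integrable M (\<lambda>\<omega>. indicator (space M) \<omega> * \<phi> (fresh m k \<omega>))"
    using int[OF sets.top] by (subst Bochner_Integration.integrable_cong[OF refl eq]) auto
  then show "integrable M (\<lambda>\<omega>. \<phi> (fresh m k \<omega>))"
    by (rule Bochner_Integration.integrable_cong[THEN iffD1, rotated -1]) auto
  have "(\<integral>\<omega>\<in>A. \<phi> (fresh m k \<omega>) \<partial>M) = (\<integral>\<omega>. (\<Sum>L\<in>?S. \<phi> L * indicator (A \<inter> ?E L) \<omega>) \<partial>M)"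
    unfolding set_lebesgue_integral_def
    by (rule Bochner_Integration.integral_cong) (simp_all add: eq)
  also have "\<dots> = (\<Sum>L\<in>?S. \<phi> L * prob (A \<inter> ?E L))"
    by (simp only: Bochner_Integration.integral_sum[OF integral_scaled_indicator(1)[OF sets.Int[OF A fresh_events]]]
        integral_scaled_indicator(2)[OF sets.Int[OF A fresh_events]])
  finally show "(\<integral>\<omega>\<in>A. \<phi> (fresh m k \<omega>) \<partial>M) = (\<Sum>L\<in>?S. \<phi> L * prob (A \<inter> ?E L))" .
qed

lemma coin_prob:
  assumes "2 \<le> j"
  shows "prob (\<xi> j -` {True} \<inter> space M) = \<alpha>" "prob (\<xi> j -` {False} \<inter> space M) = 1 - \<alpha>"
proof -
  have "prob (\<xi> j -` {b} \<inter> space M) = pmf (bernoulli_pmf \<alpha>) b" for b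
    using measure_distr[OF \<xi>_measurable[OF assms], of "{b}"] \<xi>_law[OF assms]
    by (simp add: measure_pmf_single)
  then show "prob (\<xi> j -` {True} \<inter> space M) = \<alpha>" "prob (\<xi> j -` {False} \<inter> space M) = 1 - \<alpha>"
    using \<alpha> by auto
qed

lemma target_prob:
  assumes j: "2 \<le> j" and L: "L \<subseteq> {1..<j}"
  shows "prob (u j -` L \<inter> space M) = real (card L) / real (j - 1)"
    and "prob (u j -` (- L) \<inter> space M) = 1 - real (card L) / real (j - 1)"
proof -
  have u: "prob (u j -` L \<inter> space M) = measure (measure_pmf (pmf_of_set {1..<j})) L" for L
    using measure_distr[OF u_measurable[OF j], of L] u_law[OF j] by simp
  show 1: "prob (u j -` L \<inter> space M) = real (card L) / real (j - 1)"
    unfolding u using j L by (subst measure_pmf_of_set) (auto simp: Int_absorb1)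
  have "u j -` (- L) \<inter> space M = space M - (u j -` L \<inter> space M)" by auto
  then show "prob (u j -` (- L) \<inter> space M) = 1 - real (card L) / real (j - 1)"
    using 1 prob_compl[of "u j -` L \<inter> space M"] measurable_sets[OF u_measurable[OF j], of L] by simp
qed

text \<open>
  The coin and the target of a vertex are independent of each other and of all other sources.
\<close>

lemma new_edge_prob:
  assumes j: "2 \<le> j" and D: "D \<in> sets (info (sources - {Coin j, Target j}))"
  shows "prob (D \<inter> (\<xi> j -` C \<inter> space M \<inter> (u j -` L \<inter> space M))) =
    prob D * (prob (\<xi> j -` C \<inter> space M) * prob (u j -` L \<inter> space M))"
proof -
  have s: "{Coin j, Target j} \<subseteq> sources" using j by (auto simp: sources_def)
  have x: "\<xi> j -` C \<inter> space M \<in> sets (info {Coin j})" "\<xi> j -` C \<inter> space M \<in> sets (info {Coin j, Target j})"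
    using measurable_sets[OF info_measurable(3), of j "{Coin j}" C]
      measurable_sets[OF info_measurable(3), of j "{Coin j, Target j}" C] by auto
  have y: "u j -` L \<inter> space M \<in> sets (info {Target j})" "u j -` L \<inter> space M \<in> sets (info {Coin j, Target j})"
    using measurable_sets[OF info_measurable(4), of j "{Target j}" L]
      measurable_sets[OF info_measurable(4), of j "{Coin j, Target j}" L] by auto
  have "prob (D \<inter> (\<xi> j -` C \<inter> space M \<inter> (u j -` L \<inter> space M))) =
      prob D * prob (\<xi> j -` C \<inter> space M \<inter> (u j -` L \<inter> space M))"
    by (rule info_indep[OF _ _ s D sets.Int[OF x(2) y(2)]]) auto
  also have "prob (\<xi> j -` C \<inter> space M \<inter> (u j -` L \<inter> space M)) =
      prob (\<xi> j -` C \<inter> space M) * prob (u j -` L \<inter> space M)"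
    by (rule info_indep[OF _ _ _ x(1) y(1)]) (use s in auto)
  finally show ?thesis .
qed

text \<open>
  On each event \<open>fresh m k = L\<close> inside \<open>A\<close> the coin and the target of the next vertex are independent
  of what has happened, so the conditional expectation is given by \<open>one_step_bound\<close>.
\<close>

lemma fresh_one_step:
  assumes A: "A \<in> sets (info (past m))" and z: "0 \<le> z" "z < 1" and t: "1 \<le> m + k"
  shows "(\<integral>\<omega>\<in>A. (1 - z) ^ card (fresh m (Suc k) \<omega>) \<partial>M)
    \<le> (1 - (1 - \<alpha>) * z) * (\<integral>\<omega>\<in>A. (1 - (z - z / real (m + k))) ^ card (fresh m k \<omega>) \<partial>M)"
proof -
  define j where "j = m + Suc k"
  let ?t = "real (m + k)"
  let ?S = "Pow {m + 1..m + k}"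
  define R where "R = (\<lambda>L. A \<inter> {\<omega> \<in> space M. fresh m k \<omega> = L})"
  define C where "C = (\<lambda>b L. \<xi> j -` {b} \<inter> space M \<inter> (u j -` L \<inter> space M))"
  have j: "2 \<le> j" and jt: "real (j - 1) = ?t" using t by (simp_all add: j_def)
  have AM: "A \<in> events" by (rule past_event[OF A])
  have RI: "R L \<in> sets (info (sources - {Coin j, Target j}))" for L
    unfolding R_def
  proof (rule sets.Int)
    have sub: "past m \<subseteq> sources - {Coin j, Target j}" by (auto simp: past_def sources_def j_def)
    show "A \<in> sets (info (sources - {Coin j, Target j}))" using info_mono[OF sub] A by auto
    show "{\<omega> \<in> space M. fresh m k \<omega> = L} \<in> sets (info (sources - {Coin j, Target j}))"
      by (rule fresh_measurable) (auto intro!: info_measurable simp: sources_def j_def)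
  qed
  have RC: "R L \<inter> C b L' \<in> events" for b L L'
  proof -
    have "R L \<in> events" unfolding R_def by (intro sets.Int AM fresh_events)
    moreover have "C b L' \<in> events"
      using measurable_sets[OF \<xi>_measurable[OF j], of "{b}"] measurable_sets[OF u_measurable[OF j], of L']
      by (simp add: C_def)
    ultimately show ?thesis by (rule sets.Int)
  qed
  \<comment> \<open>\<open>w L\<close> is the conditional expectation given \<open>fresh m k = L\<close>; the three terms of \<open>h L\<close> are the cases
    of a new isolated vertex, of an edge to another vertex and of an edge into \<open>L\<close>.\<close>
  define w where "w = (\<lambda>L :: nat set. (1 - \<alpha>) * (1 - z) ^ Suc (card L)
      + \<alpha> * ((1 - real (card L) / ?t) * (1 - z) ^ card L + real (card L) / ?t * (1 - z) ^ (card L - 1)))"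
  define h where "h = (\<lambda>(L :: nat set) \<omega>. (1 - z) ^ Suc (card L) * indicator (R L \<inter> C False UNIV) \<omega>
      + (1 - z) ^ card L * indicator (R L \<inter> C True (- L)) \<omega>
      + (1 - z) ^ (card L - 1) * indicator (R L \<inter> C True L) \<omega>)"
  note i = integral_scaled_indicator(1)[OF RC]
  have h_int: "integrable M (h L)" for L
    unfolding h_def by (intro Bochner_Integration.integrable_add i)
  have h_eq: "(\<integral>\<omega>. h L \<omega> \<partial>M) = w L * prob (R L)" if L: "L \<in> ?S" for L
  proof -
    have Lj: "L \<subseteq> {1..<j}" using L by (auto simp: j_def)
    have "(\<integral>\<omega>. h L \<omega> \<partial>M) = (1 - z) ^ Suc (card L) * prob (R L \<inter> C False UNIV)
        + (1 - z) ^ card L * prob (R L \<inter> C True (- L)) + (1 - z) ^ (card L - 1) * prob (R L \<inter> C True L)"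
      unfolding h_def
      by (simp only: Bochner_Integration.integral_add[OF Bochner_Integration.integrable_add[OF i i] i]
          Bochner_Integration.integral_add[OF i i] integral_scaled_indicator(2)[OF RC])
    also have "prob (R L \<inter> C False UNIV) = prob (R L) * (1 - \<alpha>)"
      unfolding C_def new_edge_prob[OF j RI] coin_prob[OF j] by (simp add: prob_space)
    also have "prob (R L \<inter> C True (- L)) = prob (R L) * (\<alpha> * (1 - real (card L) / ?t))"
      unfolding C_def new_edge_prob[OF j RI] coin_prob[OF j] target_prob[OF j Lj] jt ..
    also have "prob (R L \<inter> C True L) = prob (R L) * (\<alpha> * (real (card L) / ?t))"
      unfolding C_def new_edge_prob[OF j RI] coin_prob[OF j] target_prob[OF j Lj] jt ..
    finally show "(\<integral>\<omega>. h L \<omega> \<partial>M) = w L * prob (R L)"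
      by (simp add: w_def algebra_simps)
  qed
  have "(\<integral>\<omega>\<in>A. (1 - z) ^ card (fresh m (Suc k) \<omega>) \<partial>M) = (\<integral>\<omega>. (\<Sum>L\<in>?S. h L \<omega>) \<partial>M)"
    unfolding set_lebesgue_integral_def
  proof (rule Bochner_Integration.integral_cong[OF refl])
    fix \<omega> assume \<omega>: "\<omega> \<in> space M"
    let ?L = "fresh m k \<omega>"
    have "(\<Sum>L\<in>?S. h L \<omega>) = (\<Sum>L\<in>?S. if L = ?L then h ?L \<omega> else 0)"
      by (rule sum.cong) (auto simp: h_def R_def)
    also have "\<dots> = h ?L \<omega>" using fresh_subset[of m k \<omega>] by simp
    also have "\<dots> = indicator A \<omega> * (1 - z) ^ card (fresh m (Suc k) \<omega>)"
    proof -
      have "j \<notin> ?L" using fresh_subset[of m k \<omega>] by (auto simp: j_def)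
      then have "card (fresh m (Suc k) \<omega>) = (if \<not> \<xi> j \<omega> then Suc (card ?L) else if u j \<omega> \<in> ?L then card ?L - 1 else card ?L)"
        using j finite_fresh[of m k \<omega>] by (simp add: fresh_Suc[OF \<omega>, of m k, folded j_def])
      moreover have "\<omega> \<in> R ?L \<inter> C b L' \<longleftrightarrow> \<omega> \<in> A \<and> \<xi> j \<omega> = b \<and> u j \<omega> \<in> L'" for b L'
        using \<omega> by (auto simp: R_def C_def)
      ultimately show ?thesis by (simp add: h_def indicator_def)
    qed
    finally show "indicator A \<omega> *\<^sub>R (1 - z) ^ card (fresh m (Suc k) \<omega>) = (\<Sum>L\<in>?S. h L \<omega>)" by simp
  qed
  also have "\<dots> = (\<Sum>L\<in>?S. w L * prob (R L))"
    using h_int by (subst Bochner_Integration.integral_sum) (simp_all add: h_eq)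
  also have "\<dots> \<le> (\<Sum>L\<in>?S. ((1 - (1 - \<alpha>) * z) * (1 - (z - z / ?t)) ^ card L) * prob (R L))"
  proof (intro sum_mono mult_right_mono)
    have "0 < ?t" using t by simp
    then show "w L \<le> (1 - (1 - \<alpha>) * z) * (1 - (z - z / ?t)) ^ card L" for L
      using one_step_bound[OF z, of "1 - \<alpha>" ?t "card L"] \<alpha> by (simp add: w_def)
  qed simp
  also have "\<dots> = (1 - (1 - \<alpha>) * z) * (\<integral>\<omega>\<in>A. (1 - (z - z / ?t)) ^ card (fresh m k \<omega>) \<partial>M)"
    unfolding integral_fresh(2)[OF AM, of "\<lambda>L. (1 - (z - z / ?t)) ^ card L"]
    by (simp add: R_def sum_distrib_left mult.assoc)
  finally show ?thesis .
qed

text \<open>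
  With \<open>p = 1 - \<alpha>\<close>, \<open>t = m + k\<close> and \<open>v = z - z / t\<close>, the induction step produces the exponent
  \<open>- (p z + p v k / 2)\<close>, which is at most \<open>- p z (k + 1) / 2\<close> because \<open>k \<le> t\<close>. So the worst case is \<open>m = 0\<close>, where no past
  vertices divert the edges from the block.
\<close>

lemma fresh_laplace_bound:
  assumes A: "A \<in> sets (info (past m))" and z: "0 \<le> z" "z < 1"
  shows "(\<integral>\<omega>\<in>A. (1 - z) ^ card (fresh m k \<omega>) \<partial>M) \<le> prob A * exp (- (1 - \<alpha>) * z * real k / 2)"
  using z
proof (induction k arbitrary: z)
  case 0
  have "A \<in> events" by (rule past_event[OF A])
  then show ?case by (simp add: set_lebesgue_integral_def)
next
  case (Suc k)
  let ?p = "1 - \<alpha>"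
  have AM: "A \<in> events" by (rule past_event[OF A])
  have p: "0 \<le> ?p" "?p \<le> 1" using \<alpha> by auto
  show ?case
  proof (cases "m + k = 0")
    case True
    \<comment> \<open>The vertex \<open>1\<close> has no coin and is always new.\<close>
    have "(\<integral>\<omega>\<in>A. (1 - z) ^ card (fresh m (Suc k) \<omega>) \<partial>M) = (\<integral>\<omega>\<in>A. 1 - z \<partial>M)"
      unfolding set_lebesgue_integral_def
      by (rule Bochner_Integration.integral_cong) (use True fresh_Suc[of _ 0 0] in auto)
    also have "\<dots> = prob A * (1 - z)" using AM by (simp add: set_lebesgue_integral_def)
    also have "\<dots> \<le> prob A * exp (- ?p * z * real (Suc k) / 2)"
    proof (rule mult_left_mono)
      have "?p * z \<le> 1 * z" using p Suc.prems by (intro mult_right_mono) auto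
      then have "?p * z * real (Suc k) / 2 \<le> z" using True Suc.prems by simp
      then have "- z \<le> - ?p * z * real (Suc k) / 2" by linarith
      then have "exp (- z) \<le> exp (- ?p * z * real (Suc k) / 2)" by (rule exp_le_cancel_iff[THEN iffD2])
      moreover have "1 - z \<le> exp (- z)" using exp_ge_add_one_self[of "- z"] by simp
      ultimately show "1 - z \<le> exp (- ?p * z * real (Suc k) / 2)" by (rule order_trans[rotated])
    qed simp
    finally show ?thesis .
  next
    case False
    let ?t = "real (m + k)" and ?v = "z - z / real (m + k)"
    have t: "1 \<le> ?t" "real k \<le> ?t" using False by auto
    have "z / ?t \<le> z" using t Suc.prems by (simp add: divide_le_eq mult_le_cancel_left1)
    then have v: "0 \<le> ?v" "?v < 1" using Suc.prems t by (auto intro: le_less_trans[of _ z])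
    have pz: "0 \<le> 1 - ?p * z" using p Suc.prems mult_mono[of ?p 1 z 1] by simp
    have "(\<integral>\<omega>\<in>A. (1 - z) ^ card (fresh m (Suc k) \<omega>) \<partial>M)
        \<le> (1 - ?p * z) * (\<integral>\<omega>\<in>A. (1 - ?v) ^ card (fresh m k \<omega>) \<partial>M)"
      using False Suc.prems by (intro fresh_one_step[OF A]) auto
    also have "\<dots> \<le> exp (- (?p * z)) * (prob A * exp (- ?p * ?v * real k / 2))"
      using pz v exp_ge_add_one_self[of "- (?p * z)"]
      by (intro mult_mono Suc.IH) (auto simp: set_lebesgue_integral_def intro!: Bochner_Integration.integral_nonneg)
    also have "\<dots> = prob A * exp (- (?p * z) + - ?p * ?v * real k / 2)"
      by (simp only: exp_add mult_ac)
    also have "\<dots> \<le> prob A * exp (- ?p * z * real (Suc k) / 2)"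
    proof (intro mult_left_mono)
      have "z / ?t * real k \<le> z" using t Suc.prems by (simp add: divide_le_eq mult_left_mono)
      moreover have "?v * real k = z * real k - z / ?t * real k" by (rule left_diff_distrib)
      moreover have "z * real (Suc k) = z * real k + z" by (simp add: algebra_simps)
      moreover have "W / 2 \<le> z + V / 2" if "e \<le> z" "V = Y - e" "W = Y + z" for V W Y e :: real
        using that by (simp add: field_simps)
      ultimately have "z * real (Suc k) / 2 \<le> z + ?v * real k / 2" by blast
      then have "?p * (z * real (Suc k) / 2) \<le> ?p * (z + ?v * real k / 2)" using p by (intro mult_left_mono)
      moreover have "- (a * z) + - a * v * r / 2 = - (a * (z + v * r / 2))"
        and "- a * z * s / 2 = - (a * (z * s / 2))" for a v r s :: real
        by (simp_all add: algebra_simps)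
      ultimately show "exp (- (?p * z) + - ?p * ?v * real k / 2) \<le> exp (- ?p * z * real (Suc k) / 2)"
        by (simp only: exp_le_cancel_iff neg_le_iff_le)
    qed simp
    finally show ?thesis .
  qed
qed

lemma few_fresh_event: "{\<omega> \<in> space M. real (card (fresh m n \<omega>)) < s} \<in> events"
proof -
  have "{\<omega> \<in> space M. real (card (fresh m n \<omega>)) < s} =
      (\<Union>L\<in>{L \<in> Pow {m + 1..m + n}. real (card L) < s}. {\<omega> \<in> space M. fresh m n \<omega> = L})"
    using fresh_subset by auto
  also have "\<dots> \<in> events" using fresh_events by (intro sets.finite_UN) auto
  finally show ?thesis .
qed

text \<open>
  Markov's inequality for \<open>(1 / 4)\<^sup>J\<close>, together with \<open>exp (- 2) \<le> 1 / 4\<close>.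
\<close>

lemma fresh_lower_tail:
  assumes A: "A \<in> sets (info (past m))"
  shows "prob (A \<inter> {\<omega> \<in> space M. real (card (fresh m n \<omega>)) < (1 - \<alpha>) * real n / 8})
    \<le> prob A * exp (- (1 - \<alpha>) * real n / 8)"
proof -
  let ?c = "(1 - \<alpha>) * real n / 8" and ?q = "1 - 3 / 4 :: real"
  let ?T = "{\<omega> \<in> space M. real (card (fresh m n \<omega>)) < ?c}"
  have AM: "A \<in> events" by (rule past_event[OF A])
  have c: "0 \<le> ?c" using \<alpha> by simp
  have T: "?T \<in> events" by (rule few_fresh_event)
  have "exp (- 2 * ?c) * prob (A \<inter> ?T) = (\<integral>\<omega>. exp (- 2 * ?c) * indicator (A \<inter> ?T) \<omega> \<partial>M)"
    using AM T by simp
  also have "\<dots> \<le> (\<integral>\<omega>\<in>A. ?q ^ card (fresh m n \<omega>) \<partial>M)"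
    unfolding set_lebesgue_integral_def
  proof (rule integral_mono)
    show "integrable M (\<lambda>\<omega>. exp (- 2 * ?c) * indicator (A \<inter> ?T) \<omega>)"
      by (rule integral_scaled_indicator(1)[OF sets.Int[OF AM T]])
    show "integrable M (\<lambda>\<omega>. indicator A \<omega> *\<^sub>R ?q ^ card (fresh m n \<omega>))"
      by (rule integrable_mult_indicator[OF AM integral_fresh(1)[OF AM, of "\<lambda>L. ?q ^ card L"]])
    fix \<omega> assume "\<omega> \<in> space M"
    show "exp (- 2 * ?c) * indicator (A \<inter> ?T) \<omega> \<le> indicator A \<omega> *\<^sub>R ?q ^ card (fresh m n \<omega>)"
    proof (cases "\<omega> \<in> A \<inter> ?T")
      case True
      let ?l = "card (fresh m n \<omega>)"
      have "real ?l < ?c" using True by auto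
      then have "- 2 * ?c \<le> - 2 * real ?l" by linarith
      then have "exp (- 2 * ?c) \<le> exp (- 2 * real ?l)" by (rule exp_le_cancel_iff[THEN iffD2])
      also have "\<dots> = exp (- 2) ^ ?l" by (simp add: exp_of_nat_mult[symmetric] mult.commute)
      also have "\<dots> \<le> ?q ^ ?l"
      proof (rule power_mono)
        have "(2::real) * 2 \<le> exp 1 * exp 1" using exp_ge_add_one_self[of 1] by (intro mult_mono) auto
        then have "4 \<le> exp (2 :: real)" by (simp add: exp_add[symmetric])
        then show "exp (- 2) \<le> ?q" by (simp add: exp_minus field_simps)
      qed simp
      finally show ?thesis using True by simp
    next
      case False
      then have 0: "indicator (A \<inter> ?T) \<omega> = (0 :: real)" by (rule indicator_simps(2))
      show ?thesis unfolding 0 by simp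
    qed
  qed
  also have "\<dots> \<le> prob A * exp (- (1 - \<alpha>) * (3 / 4) * real n / 2)"
    by (rule fresh_laplace_bound[OF A]) auto
  also have "\<dots> = exp (- 2 * ?c) * (prob A * exp (- (1 - \<alpha>) * real n / 8))"
  proof -
    have "- (1 - \<alpha>) * (3 / 4) * real n / 2 = - 2 * ?c + - (1 - \<alpha>) * real n / 8"
      by (simp add: field_simps)
    then show ?thesis by (simp only: exp_add mult_ac)
  qed
  finally show ?thesis by (simp only: mult_le_cancel_left_pos[OF exp_gt_zero])
qed

end

section \<open>Square summable functions\<close>

lemma ell2_norm_sq: "(ell2_norm C f)\<^sup>2 = (\<Sum>\<^sub>\<infinity>x\<in>C. (f x)\<^sup>2)"
  unfolding ell2_norm_def by (simp add: infsum_nonneg)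

lemma ell2_norm_nonneg: "0 \<le> ell2_norm C f"
  unfolding ell2_norm_def by (simp add: infsum_nonneg)

lemma ell2_finite_sum_le:
  assumes "f \<in> ell2 C" "finite F" "F \<subseteq> C"
  shows "(\<Sum>x\<in>F. (f x)\<^sup>2) \<le> (ell2_norm C f)\<^sup>2"
  unfolding ell2_norm_sq using assms by (intro finite_sum_le_infsum) (auto simp: ell2_def)

lemma ell2_abs_le:
  assumes "f \<in> ell2 C"
  shows "\<bar>f x\<bar> \<le> ell2_norm C f"
proof (cases "x \<in> C")
  case True
  then have "(f x)\<^sup>2 \<le> (ell2_norm C f)\<^sup>2" using ell2_finite_sum_le[OF assms, of "{x}"] by simp
  then show ?thesis using abs_le_square_iff[of "f x" "ell2_norm C f"] ell2_norm_nonneg[of C f] by simp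
next
  case False
  then show ?thesis using assms ell2_norm_nonneg[of C f] by (simp add: ell2_def)
qed

text \<open>
  Membership and the norm bound are both read off finite partial sums. This reduces the
  contraction properties below to finite sums, without any interchange of infinite sums.
\<close>

lemma ell2I:
  assumes supp: "\<And>x. x \<notin> C \<Longrightarrow> f x = 0" and b: "0 \<le> b"
    and sums: "\<And>F. finite F \<Longrightarrow> F \<subseteq> C \<Longrightarrow> (\<Sum>x\<in>F. (f x)\<^sup>2) \<le> b\<^sup>2"
  shows "f \<in> ell2 C" "ell2_norm C f \<le> b"
proof -
  have s: "(\<lambda>x. (f x)\<^sup>2) summable_on C"
    using sums by (intro nonneg_bdd_above_summable_on) (auto intro!: bdd_aboveI[of _ "b\<^sup>2"])
  then show "f \<in> ell2 C" using supp by (simp add: ell2_def)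
  have "(ell2_norm C f)\<^sup>2 \<le> b\<^sup>2"
    unfolding ell2_norm_sq using s sums by (intro infsum_le_finite_sums) auto
  then show "ell2_norm C f \<le> b" using b by (simp add: power2_le_iff_abs_le ell2_norm_nonneg)
qed

lemma ell2_scale:
  assumes "f \<in> ell2 C"
  shows "(\<lambda>x. c * f x) \<in> ell2 C" "ell2_norm C (\<lambda>x. c * f x) = \<bar>c\<bar> * ell2_norm C f"
proof -
  have "(\<lambda>x. c\<^sup>2 * (f x)\<^sup>2) summable_on C" using assms by (intro summable_on_cmult_right) (auto simp: ell2_def)
  then show "(\<lambda>x. c * f x) \<in> ell2 C" using assms by (simp add: ell2_def power_mult_distrib)
  show "ell2_norm C (\<lambda>x. c * f x) = \<bar>c\<bar> * ell2_norm C f"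
    unfolding ell2_norm_def by (simp add: power_mult_distrib infsum_cmult_right' real_sqrt_mult)
qed

text \<open>
  By Cauchy--Schwarz for the values off \<open>x\<close>, whose sum is \<open>- f x\<close>.
\<close>

lemma mean_zero_abs_le:
  assumes fin: "finite C" and x: "x \<in> C" and f: "f \<in> ell2_mean_zero C"
  shows "\<bar>f x\<bar> \<le> sqrt (1 - 1 / real (card C)) * ell2_norm C f"
proof -
  let ?N = "real (card C)"
  have N: "0 < ?N" using fin x by (auto simp: card_gt_0_iff)
  have f0: "(\<Sum>y\<in>C. f y) = 0" using f by (simp add: ell2_mean_zero_def)
  have sq: "(ell2_norm C f)\<^sup>2 = (\<Sum>y\<in>C. (f y)\<^sup>2)" unfolding ell2_norm_sq using fin by simp
  define s where "s = (\<Sum>y\<in>C - {x}. (f y)\<^sup>2)"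
  have rest: "(\<Sum>y\<in>C - {x}. f y) = - f x" and tot: "(ell2_norm C f)\<^sup>2 = (f x)\<^sup>2 + s"
    using f0 fin x by (simp_all add: sq s_def sum.remove[OF fin x])
  have "(f x)\<^sup>2 = (\<Sum>y\<in>C - {x}. 1 * f y)\<^sup>2" by (simp add: rest)
  also have "\<dots> \<le> (\<Sum>y\<in>C - {x}. 1\<^sup>2) * s" unfolding s_def by (rule Cauchy_Schwarz_ineq_sum)
  also have "(\<Sum>y\<in>C - {x}. 1\<^sup>2 :: real) = ?N - 1" using fin x N by (simp add: of_nat_diff)
  finally have "?N * (f x)\<^sup>2 \<le> (?N - 1) * (ell2_norm C f)\<^sup>2" unfolding tot by (simp add: algebra_simps)
  then have "(f x)\<^sup>2 \<le> (1 - 1 / ?N) * (ell2_norm C f)\<^sup>2" using N by (simp add: field_simps)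
  then have "sqrt ((f x)\<^sup>2) \<le> sqrt ((1 - 1 / ?N) * (ell2_norm C f)\<^sup>2)" by (rule real_sqrt_le_mono)
  then show ?thesis by (simp add: real_sqrt_mult ell2_norm_nonneg)
qed

text \<open>
  The square of the norm is \<open>N c (1 - c) \<le> N / 4\<close>, where \<open>N\<close> is the size of \<open>C\<close>.
\<close>

lemma centred_indicator_norm:
  assumes fin: "finite C" and x: "x \<in> C" and A: "A \<subseteq> C"
  defines "c \<equiv> real (card A) / real (card C)"
  defines "v \<equiv> \<lambda>y. if y \<in> C then indicator A y - c else 0 :: real"
  shows "v \<in> ell2_mean_zero C"
    and "sqrt (1 - 1 / real (card C)) * ell2_norm C v \<le> 1 / 2 * sqrt (real (card C) - 1)"
proof -
  let ?N = "real (card C)"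
  have N: "0 < ?N" "1 \<le> ?N" using fin x card_gt_0_iff[of C] by auto
  have IA: "(\<Sum>y\<in>C. indicator A y) = real (card A)"
    using fin A by (simp add: indicator_def Int_absorb1 flip: sum.inter_restrict of_nat_sum)
  have "(\<Sum>y\<in>C. v y) = (\<Sum>y\<in>C. indicator A y - c)" by (rule sum.cong) (auto simp: v_def)
  also have "\<dots> = real (card A) - ?N * c" by (simp add: sum_subtractf IA)
  also have "\<dots> = 0" using N by (simp add: c_def)
  finally show "v \<in> ell2_mean_zero C" using fin by (auto simp: ell2_mean_zero_def ell2_def v_def)
  have "(ell2_norm C v)\<^sup>2 = (\<Sum>y\<in>C. (v y)\<^sup>2)" unfolding ell2_norm_sq using fin by simp
  also have "\<dots> = (\<Sum>y\<in>C. (1 - 2 * c) * indicator A y + c\<^sup>2)"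
    by (rule sum.cong) (auto simp: v_def indicator_def power2_eq_square algebra_simps)
  also have "\<dots> = (1 - 2 * c) * real (card A) + ?N * c\<^sup>2"
    by (simp add: sum.distrib IA flip: sum_distrib_left)
  also have "\<dots> = ?N * (c - c\<^sup>2)"
  proof -
    have cA: "real (card A) = ?N * c" using N by (simp add: c_def)
    show ?thesis unfolding cA by (simp add: algebra_simps power2_eq_square)
  qed
  also have "\<dots> \<le> ?N * (1 / 4)"
  proof (rule mult_left_mono)
    have "0 \<le> (c - 1 / 2)\<^sup>2" by simp
    then show "c - c\<^sup>2 \<le> 1 / 4" by (simp add: power2_eq_square algebra_simps)
  qed (use N in simp)
  finally have "(1 - 1 / ?N) * (ell2_norm C v)\<^sup>2 \<le> (1 - 1 / ?N) * (?N * (1 / 4))"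
    using N by (intro mult_left_mono) auto
  also have "\<dots> = (?N - 1) / 4" using N by (simp add: field_simps)
  finally have "sqrt ((1 - 1 / ?N) * (ell2_norm C v)\<^sup>2) \<le> sqrt ((?N - 1) / 4)" by (rule real_sqrt_le_mono)
  then show "sqrt (1 - 1 / ?N) * ell2_norm C v \<le> 1 / 2 * sqrt (?N - 1)"
    by (simp add: real_sqrt_mult real_sqrt_divide ell2_norm_nonneg)
qed

section \<open>Averaging operators of a discrete group\<close>

text \<open>
  The operator of a kernel as an integral. On square summable functions it agrees with the
  operator given by a sum over points, see \<open>kernel_operator_eq\<close>.
\<close>

definition kernel_image :: "'a set \<Rightarrow> ('a \<Rightarrow> 'a measure) \<Rightarrow> ('a \<Rightarrow> real) \<Rightarrow> 'a \<Rightarrow> real" where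
  "kernel_image C P f x = (if x \<in> C then \<integral>y. f y \<partial>P x else 0)"

lemma infsum_countable_prob:
  fixes f :: "'a \<Rightarrow> real"
  assumes \<nu>: "prob_space \<nu>" "sets \<nu> = Pow C" and C: "countable C"
    and f: "\<And>x. \<bar>f x\<bar> \<le> b"
  shows "(\<Sum>\<^sub>\<infinity>y\<in>C. measure \<nu> {y} * f y) = (\<integral>y. f y \<partial>\<nu>)"
proof -
  interpret \<nu>: prob_space \<nu> by fact
  have eq: "\<nu> = density (count_space C) (\<lambda>y. ennreal (measure \<nu> {y}))"
  proof (rule measure_eqI_countable[OF \<nu>(2) _ C])
    fix a assume a: "a \<in> C"
    have "emeasure (density (count_space C) (\<lambda>y. ennreal (measure \<nu> {y}))) {a} =
        (\<integral>\<^sup>+y. ennreal (measure \<nu> {y}) * indicator {a} y \<partial>count_space C)"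
      using a by (intro emeasure_density) auto
    also have "\<dots> = (\<integral>\<^sup>+y. ennreal (measure \<nu> {a}) * indicator {a} y \<partial>count_space C)"
      by (rule nn_integral_cong) (auto simp: indicator_def)
    also have "\<dots> = ennreal (measure \<nu> {a})" using a by (subst nn_integral_cmult_indicator) auto
    finally show "emeasure \<nu> {a} = emeasure (density (count_space C) (\<lambda>y. ennreal (measure \<nu> {y}))) {a}"
      by (simp add: \<nu>.emeasure_eq_measure)
  qed simp
  have "f \<in> borel_measurable \<nu>"
    using \<nu>(2) sets_eq_imp_space_eq[of \<nu> "count_space C"] by (auto simp: measurable_def)
  then have int: "integrable \<nu> f" using f by (intro \<nu>.integrable_const_bound[where B = b]) auto
  then have "integrable (density (count_space C) (\<lambda>y. ennreal (measure \<nu> {y}))) f" using eq by simp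
  then have "integrable (count_space C) (\<lambda>y. measure \<nu> {y} *\<^sub>R f y)"
    by (subst (asm) integrable_density) auto
  then have "Infinite_Set_Sum.abs_summable_on (\<lambda>y. measure \<nu> {y} * f y) C" by (simp add: abs_summable_on_def)
  from infsetsum_infsum[OF this]
  have "(\<Sum>\<^sub>\<infinity>y\<in>C. measure \<nu> {y} * f y) = (\<integral>y. measure \<nu> {y} *\<^sub>R f y \<partial>count_space C)"
    by (simp add: infsetsum_def)
  also have "\<dots> = (\<integral>y. f y \<partial>density (count_space C) (\<lambda>y. ennreal (measure \<nu> {y})))"
    by (rule integral_density[symmetric]) auto
  finally show ?thesis using eq by simp
qed

locale discrete_steps = group G for G :: "'a monoid" +
  fixes E \<mu> :: "'a measure"
  assumes E: "sets E = Pow (carrier G)" and \<mu>: "prob_space \<mu>" "sets \<mu> = sets E"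
begin

lemma space_E_discrete: "space E = carrier G" and space_\<mu>_discrete: "space \<mu> = carrier G"
  using E \<mu>(2) sets_eq_imp_space_eq[of _ "count_space (carrier G)"] by auto

lemma measurable_discrete:
  assumes "sets \<nu> = Pow (carrier G)"
  shows "f \<in> \<nu> \<rightarrow>\<^sub>M F \<longleftrightarrow> f \<in> carrier G \<rightarrow> space F"
  using assms sets_eq_imp_space_eq[of \<nu> "count_space (carrier G)"] by (auto simp: measurable_def)

lemma real_measurable_discrete: "sets \<nu> = Pow (carrier G) \<Longrightarrow> (f :: 'a \<Rightarrow> real) \<in> borel_measurable \<nu>"
  by (simp add: measurable_discrete)

lemma mult_kernel_prob:
  assumes "x \<in> carrier G"
  shows "prob_space (mult_kernel G E \<mu> x)" "sets (mult_kernel G E \<mu> x) = Pow (carrier G)"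
proof -
  have "(\<lambda>y. x \<otimes>\<^bsub>G\<^esub> y) \<in> \<mu> \<rightarrow>\<^sub>M E"
    using \<mu>(2) E assms by (subst measurable_discrete) (auto simp: space_E_discrete)
  then show "prob_space (mult_kernel G E \<mu> x)"
    unfolding mult_kernel_def by (rule prob_space.prob_space_distr[OF \<mu>(1)])
qed (simp add: mult_kernel_def E)

lemma kernel_image_mult:
  assumes "x \<in> carrier G"
  shows "kernel_image (carrier G) (mult_kernel G E \<mu>) f x = (\<integral>y. f (x \<otimes>\<^bsub>G\<^esub> y) \<partial>\<mu>)"
proof -
  have "(\<lambda>y. x \<otimes>\<^bsub>G\<^esub> y) \<in> \<mu> \<rightarrow>\<^sub>M E"
    using \<mu>(2) E assms by (subst measurable_discrete) (auto simp: space_E_discrete)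
  moreover have "f \<in> borel_measurable E" using E by (rule real_measurable_discrete)
  ultimately show ?thesis using assms by (simp add: kernel_image_def mult_kernel_def integral_distr)
qed

lemma kernel_image_translation:
  assumes "x \<in> carrier G" "y \<in> carrier G"
  shows "kernel_image (carrier G) (translation_kernel G E y) f x = f (x \<otimes>\<^bsub>G\<^esub> y)"
  using assms by (simp add: kernel_image_def translation_kernel_def integral_return space_E_discrete real_measurable_discrete[OF E])

lemma right_translate_sum_le:
  assumes f: "f \<in> ell2 (carrier G)" and F: "finite F" "F \<subseteq> carrier G" and y: "y \<in> carrier G"
  shows "(\<Sum>x\<in>F. (f (x \<otimes>\<^bsub>G\<^esub> y))\<^sup>2) \<le> (ell2_norm (carrier G) f)\<^sup>2"
proof -
  have inj: "inj_on (\<lambda>x. x \<otimes>\<^bsub>G\<^esub> y) F" using F(2) y by (auto simp: inj_on_def subset_iff)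
  have "(\<Sum>x\<in>F. (f (x \<otimes>\<^bsub>G\<^esub> y))\<^sup>2) = (\<Sum>x\<in>(\<lambda>x. x \<otimes>\<^bsub>G\<^esub> y) ` F. (f x)\<^sup>2)"
    using inj by (simp add: sum.reindex)
  also have "\<dots> \<le> (ell2_norm (carrier G) f)\<^sup>2"
    using F y by (intro ell2_finite_sum_le[OF f]) auto
  finally show ?thesis .
qed

lemma translation_contraction:
  assumes f: "f \<in> ell2 (carrier G)" and y: "y \<in> carrier G"
  shows "kernel_image (carrier G) (translation_kernel G E y) f \<in> ell2 (carrier G)"
    and "ell2_norm (carrier G) (kernel_image (carrier G) (translation_kernel G E y) f) \<le> ell2_norm (carrier G) f"
proof -
  let ?g = "kernel_image (carrier G) (translation_kernel G E y) f"
  have 1: "?g x = 0" if "x \<notin> carrier G" for x using that by (simp add: kernel_image_def)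
  have 2: "(\<Sum>x\<in>F. (?g x)\<^sup>2) \<le> (ell2_norm (carrier G) f)\<^sup>2" if F: "finite F" "F \<subseteq> carrier G" for F
  proof -
    have "(\<Sum>x\<in>F. (?g x)\<^sup>2) = (\<Sum>x\<in>F. (f (x \<otimes>\<^bsub>G\<^esub> y))\<^sup>2)"
      by (rule sum.cong) (use F y kernel_image_translation in auto)
    with right_translate_sum_le[OF f F y] show ?thesis by simp
  qed
  show "?g \<in> ell2 (carrier G)" "ell2_norm (carrier G) ?g \<le> ell2_norm (carrier G) f"
    using ell2I[OF 1 ell2_norm_nonneg 2] by auto
qed

text \<open>
  Jensen's inequality bounds the square of an average by the average of the squares; for a fixed
  increment the sum of the squares is at most the squared norm.
\<close>

lemma averaging_contraction:
  assumes f: "f \<in> ell2 (carrier G)"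
  shows "kernel_image (carrier G) (mult_kernel G E \<mu>) f \<in> ell2 (carrier G)"
    and "ell2_norm (carrier G) (kernel_image (carrier G) (mult_kernel G E \<mu>) f) \<le> ell2_norm (carrier G) f"
proof -
  interpret \<mu>: prob_space \<mu> by (rule \<mu>)
  let ?g = "kernel_image (carrier G) (mult_kernel G E \<mu>) f" and ?b = "ell2_norm (carrier G) f"
  have s\<mu>: "sets \<mu> = Pow (carrier G)" using \<mu>(2) E by simp
  have int1: "integrable \<mu> (\<lambda>y. f (x \<otimes>\<^bsub>G\<^esub> y))" for x
    using ell2_abs_le[OF f] real_measurable_discrete[OF s\<mu>]
    by (intro \<mu>.integrable_const_bound[where B = ?b]) auto
  have int2: "integrable \<mu> (\<lambda>y. (f (x \<otimes>\<^bsub>G\<^esub> y))\<^sup>2)" for x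
  proof (rule \<mu>.integrable_const_bound[where B = "?b\<^sup>2"])
    show "AE y in \<mu>. norm ((f (x \<otimes>\<^bsub>G\<^esub> y))\<^sup>2) \<le> ?b\<^sup>2"
      using ell2_abs_le[OF f] ell2_norm_nonneg[of "carrier G" f] by (intro AE_I2) (simp add: abs_le_square_iff[symmetric])
  qed (rule real_measurable_discrete[OF s\<mu>])
  have 1: "?g x = 0" if "x \<notin> carrier G" for x using that by (simp add: kernel_image_def)
  have 2: "(\<Sum>x\<in>F. (?g x)\<^sup>2) \<le> ?b\<^sup>2" if F: "finite F" "F \<subseteq> carrier G" for F
  proof -
    have "(?g x)\<^sup>2 \<le> (\<integral>y. (f (x \<otimes>\<^bsub>G\<^esub> y))\<^sup>2 \<partial>\<mu>)" if "x \<in> F" for x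
    proof -
      have "x \<in> carrier G" using that F by auto
      then show ?thesis
        using \<mu>.variance_positive[of "\<lambda>y. f (x \<otimes>\<^bsub>G\<^esub> y)"] \<mu>.variance_eq[OF int1 int2, of x]
        by (simp add: kernel_image_mult)
    qed
    then have "(\<Sum>x\<in>F. (?g x)\<^sup>2) \<le> (\<Sum>x\<in>F. \<integral>y. (f (x \<otimes>\<^bsub>G\<^esub> y))\<^sup>2 \<partial>\<mu>)" by (rule sum_mono)
    also have "\<dots> = (\<integral>y. (\<Sum>x\<in>F. (f (x \<otimes>\<^bsub>G\<^esub> y))\<^sup>2) \<partial>\<mu>)"
      using int2 by (subst Bochner_Integration.integral_sum) auto
    also have "\<dots> \<le> (\<integral>y. ?b\<^sup>2 \<partial>\<mu>)"
      using int2 right_translate_sum_le[OF f F] by (intro integral_mono) (auto simp: space_\<mu>_discrete)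
    finally show ?thesis by (simp add: \<mu>.prob_space)
  qed
  show "?g \<in> ell2 (carrier G)" "ell2_norm (carrier G) ?g \<le> ?b"
    using ell2I[OF 1 ell2_norm_nonneg 2] by auto
qed

lemma kernel_operator_eq:
  assumes C: "countable (carrier G)" and f: "f \<in> ell2 (carrier G)"
  shows "kernel_operator (carrier G) (mult_kernel G E \<mu>) f = kernel_image (carrier G) (mult_kernel G E \<mu>) f"
proof
  show "kernel_operator (carrier G) (mult_kernel G E \<mu>) f x = kernel_image (carrier G) (mult_kernel G E \<mu>) f x" for x
    unfolding kernel_operator_def kernel_image_def
    using infsum_countable_prob[OF mult_kernel_prob C ell2_abs_le[OF f], of x] by simp
qed

text \<open>
  The operator norm is a supremum of reals, which bounds the values only because they are
  bounded above; this is where \<open>averaging_contraction\<close> is needed.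
\<close>

lemma averaging_opnorm:
  assumes C: "countable (carrier G)"
    and V: "V \<subseteq> ell2 (carrier G)" "\<And>c f. f \<in> V \<Longrightarrow> (\<lambda>x. c * f x) \<in> V" and f: "f \<in> V"
  shows "0 \<le> ell2_opnorm (carrier G) V (kernel_operator (carrier G) (mult_kernel G E \<mu>))"
    and "ell2_norm (carrier G) (kernel_image (carrier G) (mult_kernel G E \<mu>) f)
      \<le> ell2_opnorm (carrier G) V (kernel_operator (carrier G) (mult_kernel G E \<mu>)) * ell2_norm (carrier G) f"
proof -
  let ?C = "carrier G" and ?K = "kernel_operator (carrier G) (mult_kernel G E \<mu>)"
  let ?S = "{f \<in> V. ell2_norm ?C f \<le> 1}"
  let ?q = "ell2_opnorm ?C V ?K"
  have bdd: "bdd_above ((\<lambda>f. ell2_norm ?C (?K f)) ` ?S)"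
  proof (rule bdd_aboveI2)
    fix f assume "f \<in> ?S"
    then show "ell2_norm ?C (?K f) \<le> 1"
      using V(1) averaging_contraction(2)[of f] kernel_operator_eq[OF C, of f] by auto
  qed
  have upper: "ell2_norm ?C (?K f) \<le> ?q" if "f \<in> V" "ell2_norm ?C f \<le> 1" for f
    unfolding ell2_opnorm_def using that by (intro cSUP_upper[OF _ bdd]) auto
  have "(\<lambda>x. 0 * f x) \<in> V" by (rule V(2)[OF f])
  moreover have "ell2_norm ?C (\<lambda>x. 0 * f x) \<le> 1" by (simp add: ell2_norm_def)
  ultimately show "0 \<le> ?q" using upper ell2_norm_nonneg order_trans by blast
  have fl: "f \<in> ell2 ?C" using f V(1) by auto
  show "ell2_norm ?C (kernel_image ?C (mult_kernel G E \<mu>) f) \<le> ?q * ell2_norm ?C f"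
  proof (cases "ell2_norm ?C f = 0")
    case True
    then show ?thesis using averaging_contraction(2)[OF fl] by simp
  next
    case False
    let ?c = "inverse (ell2_norm ?C f)" and ?w = "\<lambda>x. inverse (ell2_norm ?C f) * f x"
    have c: "0 < ?c" using False ell2_norm_nonneg[of ?C f] by simp
    have w: "?w \<in> V" by (rule V(2)[OF f])
    then have wl: "?w \<in> ell2 ?C" using V(1) by auto
    have "ell2_norm ?C ?w \<le> 1" using ell2_scale(2)[OF fl, of ?c] False c by simp
    from upper[OF w this] have "ell2_norm ?C (kernel_image ?C (mult_kernel G E \<mu>) ?w) \<le> ?q"
      by (simp add: kernel_operator_eq[OF C wl])
    also have "kernel_image ?C (mult_kernel G E \<mu>) ?w = (\<lambda>x. ?c * kernel_image ?C (mult_kernel G E \<mu>) f x)"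
      by (auto simp: kernel_image_def)
    finally have "?c * ell2_norm ?C (kernel_image ?C (mult_kernel G E \<mu>) f) \<le> ?q"
      using ell2_scale(2)[OF averaging_contraction(1)[OF fl], of ?c] c by simp
    then show ?thesis using c by (simp add: field_simps)
  qed
qed

lemma mean_zero_preserved:
  assumes fin: "finite (carrier G)" and f: "f \<in> ell2_mean_zero (carrier G)"
  shows "kernel_image (carrier G) (mult_kernel G E \<mu>) f \<in> ell2_mean_zero (carrier G)"
    and "y \<in> carrier G \<Longrightarrow> kernel_image (carrier G) (translation_kernel G E y) f \<in> ell2_mean_zero (carrier G)"
proof -
  interpret \<mu>: prob_space \<mu> by (rule \<mu>)
  let ?C = "carrier G"
  have s\<mu>: "sets \<mu> = Pow (carrier G)" using \<mu>(2) E by simp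
  have fl: "f \<in> ell2 ?C" and f0: "(\<Sum>x\<in>?C. f x) = 0" using f by (auto simp: ell2_mean_zero_def)
  have tr: "(\<Sum>x\<in>?C. f (x \<otimes>\<^bsub>G\<^esub> y)) = 0" if y: "y \<in> ?C" for y
  proof -
    have "bij_betw (\<lambda>x. x \<otimes>\<^bsub>G\<^esub> y) ?C ?C"
      using y inv_solve_right' by (intro bij_betwI[where g = "\<lambda>x. x \<otimes>\<^bsub>G\<^esub> inv\<^bsub>G\<^esub> y"]) (auto simp: m_assoc)
    from sum.reindex_bij_betw[OF this, of f] show ?thesis using f0 by simp
  qed
  have "(\<Sum>x\<in>?C. kernel_image ?C (mult_kernel G E \<mu>) f x) = (\<Sum>x\<in>?C. \<integral>y. f (x \<otimes>\<^bsub>G\<^esub> y) \<partial>\<mu>)"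
    by (rule sum.cong) (auto simp: kernel_image_mult)
  also have "\<dots> = (\<integral>y. (\<Sum>x\<in>?C. f (x \<otimes>\<^bsub>G\<^esub> y)) \<partial>\<mu>)"
  proof (rule Bochner_Integration.integral_sum[symmetric])
    show "integrable \<mu> (\<lambda>y. f (x \<otimes>\<^bsub>G\<^esub> y))" for x
      using ell2_abs_le[OF fl] real_measurable_discrete[OF s\<mu>]
      by (intro \<mu>.integrable_const_bound[where B = "ell2_norm ?C f"]) auto
  qed
  also have "\<dots> = (\<integral>y. 0 \<partial>\<mu>)" by (rule Bochner_Integration.integral_cong) (auto simp: tr space_\<mu>_discrete)
  finally show "kernel_image ?C (mult_kernel G E \<mu>) f \<in> ell2_mean_zero ?C"
    using averaging_contraction(1)[OF fl] by (simp add: ell2_mean_zero_def)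
  assume y: "y \<in> ?C"
  have "(\<Sum>x\<in>?C. kernel_image ?C (translation_kernel G E y) f x) = (\<Sum>x\<in>?C. f (x \<otimes>\<^bsub>G\<^esub> y))"
    by (rule sum.cong) (auto simp: kernel_image_translation y)
  then show "kernel_image ?C (translation_kernel G E y) f \<in> ell2_mean_zero ?C"
    using translation_contraction(1)[OF fl y] tr[OF y] by (simp add: ell2_mean_zero_def)
qed

end

section \<open>Decay of the law of the walk on a discrete group\<close>

text \<open>
  A function \<open>f\<close> of the last position is replaced by the function \<open>K\<^sub>n f\<close> of the last but one, and so
  on; constants are preserved, so \<open>f - c\<close> is transformed by the same operators. After all steps
  the value at the starting point is controlled by the norm.
\<close>

lemma markov_law_contraction:
  fixes f :: "'a \<Rightarrow> real"
  assumes E: "sets E = Pow C"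
    and K: "\<And>k. 1 \<le> k \<Longrightarrow> k \<le> n \<Longrightarrow> K k \<in> E \<rightarrow>\<^sub>M prob_algebra E" and x: "x \<in> C"
    and r: "\<And>k. 0 \<le> r k"
    and step: "\<And>k v. 1 \<le> k \<Longrightarrow> k \<le> n \<Longrightarrow> v \<in> V \<Longrightarrow> kernel_image C (K k) v \<in> V"
      "\<And>k v. 1 \<le> k \<Longrightarrow> k \<le> n \<Longrightarrow> v \<in> V \<Longrightarrow> ell2_norm C (kernel_image C (K k) v) \<le> r k * ell2_norm C v"
    and base: "\<And>v. v \<in> V \<Longrightarrow> \<bar>v x\<bar> \<le> b * ell2_norm C v" "0 \<le> b"
    and f: "\<And>y. y \<in> C \<Longrightarrow> 0 \<le> f y" "\<And>y. y \<in> C \<Longrightarrow> f y \<le> 1"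
    and V: "(\<lambda>y. if y \<in> C then f y - c else 0) \<in> V"
  shows "\<bar>(\<integral>p. f (p n) \<partial>markov_law E K x n) - c\<bar>
    \<le> b * ((\<Prod>k\<in>{1..n}. r k) * ell2_norm C (\<lambda>y. if y \<in> C then f y - c else 0))"
  using K step f V
proof (induction n arbitrary: f)
  case 0
  have spE: "space E = C" using E sets_eq_imp_space_eq[of E "count_space C"] by simp
  have fm: "f \<in> borel_measurable E" using E spE by (auto simp: measurable_def)
  have proj: "(\<lambda>p. p 0) \<in> path_space E 0 \<rightarrow>\<^sub>M E"
    by (rule measurable_component_singleton) simp
  have "(\<lambda>p. f (p 0)) \<in> borel_measurable (path_space E 0)"
    by (rule measurable_compose[OF proj fm])
  then have "(\<integral>p. f (p 0) \<partial>markov_law E K x 0) = f x"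
    unfolding markov_law.simps using x spE by (subst integral_return) (auto simp: space_PiM)
  then show ?case using base(1)[OF 0(6)] x by simp
next
  case (Suc n)
  have spE: "space E = C" using E sets_eq_imp_space_eq[of E "count_space C"] by simp
  have fm: "f \<in> borel_measurable E" using E spE by (auto simp: measurable_def)
  let ?v = "\<lambda>y. if y \<in> C then f y - c else 0"
  define f' where "f' = (\<lambda>z. \<integral>y. f y \<partial>K (Suc n) z)"
  have f'_props: "0 \<le> f' z" "f' z \<le> 1" "f' z - c = (\<integral>y. ?v y \<partial>K (Suc n) z)" if z: "z \<in> C" for z
  proof -
    have *: "K (Suc n) z \<in> space (prob_algebra E)"
      using measurable_space[OF Suc.prems(1)[of "Suc n"]] z spE by simp
    then interpret \<nu>: prob_space "K (Suc n) z" by (simp add: space_prob_algebra)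
    have s: "sets (K (Suc n) z) = sets E" using * by (simp add: space_prob_algebra)
    have sp: "space (K (Suc n) z) = C" using sets_eq_imp_space_eq[OF s] spE by simp
    have "f \<in> borel_measurable (K (Suc n) z)" using fm measurable_cong_sets[OF s refl] by blast
    then have i: "integrable (K (Suc n) z) f"
      using Suc.prems(4,5) sp by (intro \<nu>.integrable_const_bound[where B = 1]) auto
    show "0 \<le> f' z" unfolding f'_def using Suc.prems(4) sp by (intro Bochner_Integration.integral_nonneg) auto
    have "f' z \<le> (\<integral>y. 1 \<partial>K (Suc n) z)" unfolding f'_def using i Suc.prems(5) sp by (intro integral_mono) auto
    then show "f' z \<le> 1" by (simp add: \<nu>.prob_space)
    have "f' z - c = (\<integral>y. f y - c \<partial>K (Suc n) z)" using i by (simp add: f'_def \<nu>.prob_space)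
    also have "\<dots> = (\<integral>y. ?v y \<partial>K (Suc n) z)" by (rule Bochner_Integration.integral_cong) (auto simp: sp)
    finally show "f' z - c = (\<integral>y. ?v y \<partial>K (Suc n) z)" .
  qed
  have v': "(\<lambda>z. if z \<in> C then f' z - c else 0) = kernel_image C (K (Suc n)) ?v"
    by (auto simp: kernel_image_def f'_props(3))
  have "(\<integral>p. f (p (Suc n)) \<partial>markov_law E K x (Suc n)) = (\<integral>p. f' (p n) \<partial>markov_law E K x n)"
    unfolding f'_def using Suc.prems(4,5) spE x fm by (intro integral_markov_law_Suc[OF Suc.prems(1)]) auto
  also have "\<bar>\<dots> - c\<bar> \<le> b * ((\<Prod>k\<in>{1..n}. r k) * ell2_norm C (\<lambda>z. if z \<in> C then f' z - c else 0))"
    using Suc.prems f'_props(1,2) by (intro Suc.IH) (auto simp: v')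
  also have "\<dots> \<le> b * ((\<Prod>k\<in>{1..n}. r k) * (r (Suc n) * ell2_norm C ?v))"
    unfolding v' using Suc.prems(3)[of "Suc n", OF _ _ Suc.prems(6)] base(2) r
    by (intro mult_left_mono prod_nonneg) auto
  finally show ?case by (simp add: mult_ac)
qed

context measurable_srrw
begin

lemma prod_isolated_factors:
  "(\<Prod>k\<in>{1..n}. if m + k \<in> isolated \<xi> u (m + n) \<omega> then q else 1 :: real) = q ^ card (fresh m n \<omega>)"
proof -
  let ?J = "{k \<in> {1..n}. m + k \<in> isolated \<xi> u (m + n) \<omega>}"
  have "(\<Prod>k\<in>{1..n}. if m + k \<in> isolated \<xi> u (m + n) \<omega> then q else 1) = (\<Prod>k\<in>?J. q)"
    by (rule prod.inter_filter[symmetric]) simp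
  also have "\<dots> = q ^ card ?J" by simp
  also have "card ?J = card ((\<lambda>k. m + k) ` ?J)" by (rule card_image[symmetric]) (simp add: inj_on_def)
  also have "(\<lambda>k. m + k) ` ?J = fresh m n \<omega>"
  proof (rule Set.set_eqI)
    fix i
    have "i \<in> (\<lambda>k. m + k) ` ?J" if "i \<in> fresh m n \<omega>"
      by (rule image_eqI[of _ _ "i - m"]) (use that in \<open>auto simp: fresh_def\<close>)
    then show "i \<in> (\<lambda>k. m + k) ` ?J \<longleftrightarrow> i \<in> fresh m n \<omega>" by (auto simp: fresh_def)
  qed
  finally show ?thesis .
qed

text \<open>
  With \<open>s = (1 - \<alpha>) n / 8\<close>, the contraction yields \<open>q\<^sup>J \<le> q powr s\<close> when \<open>J \<ge> s\<close>. When \<open>J < s\<close> the trivial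
  bound \<open>1\<close> is used, whatever the size of \<open>a\<close>; so the error term is not multiplied by \<open>a\<close>.
\<close>

lemma walk_prob_bound:
  assumes n: "1 \<le> n" and q: "0 \<le> q" "q \<le> 1" and c: "0 \<le> c" "c \<le> 1" and a: "0 \<le> a"
    and A: "A \<in> sets E" and D: "D \<in> sets (\<A> m)"
    and contr: "\<And>\<omega>. \<omega> \<in> space M \<Longrightarrow>
      \<bar>(\<integral>p. indicator A (p n) \<partial>block_law m n n \<omega>) - c\<bar> \<le> a * q ^ card (fresh m n \<omega>)"
  shows "\<bar>prob (D \<inter> {\<omega> \<in> space M. walk G X (m + n) \<omega> \<in> A}) - c * prob D\<bar>
    \<le> prob D * (a * q powr ((1 - \<alpha>) * real n / 8) + exp (- (1 - \<alpha>) * real n / 8))"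
proof -
  let ?P = "path_space E n" and ?s = "(1 - \<alpha>) * real n / 8"
  let ?T = "{\<omega> \<in> space M. real (card (fresh m n \<omega>)) < ?s}"
  have s: "0 < ?s" using n \<alpha> by simp
  have DM: "D \<in> events" using D subalgebra_\<A> by (auto simp: subalgebra_def)
  have DB: "D \<in> sets (block_at m n)" by (rule block_basic(1)[OF space_\<A> D])
  have DI: "D \<in> sets (info (past m))" using \<A>_info[OF order_refl] D by auto
  define F where "F = {p \<in> space ?P. p n \<in> A}"
  have proj: "(\<lambda>p. p n) \<in> ?P \<rightarrow>\<^sub>M E" by (rule measurable_component_singleton) simp
  have F: "F \<in> sets ?P"
    using measurable_sets[OF proj A] by (simp add: F_def vimage_def Int_def conj_commute)
  have path: "block_path m n \<omega> \<in> space ?P" if "\<omega> \<in> space M" for \<omega>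
    using measurable_space[OF block_path_measurable[OF X_measurable] that] by simp
  have L: "block_law m n n \<in> block_at m n \<rightarrow>\<^sub>M prob_algebra ?P" by (rule block_law_measurable) simp
  define h where "h = (\<lambda>\<omega>. measure (block_law m n n \<omega>) F)"
  have h: "h \<omega> = (\<integral>p. indicator A (p n) \<partial>block_law m n n \<omega>)" "0 \<le> h \<omega>" "h \<omega> \<le> 1" if \<omega>: "\<omega> \<in> space M" for \<omega>
  proof -
    have pa: "block_law m n n \<omega> \<in> space (prob_algebra ?P)" using measurable_space[OF L, of \<omega>] \<omega> by simp
    then interpret L: prob_space "block_law m n n \<omega>" by (simp add: space_prob_algebra)
    have se: "sets (block_law m n n \<omega>) = sets ?P" using pa by (simp add: space_prob_algebra)
    have sp: "space (block_law m n n \<omega>) = space ?P" by (rule sets_eq_imp_space_eq[OF se])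
    have "(\<integral>p. indicator A (p n) \<partial>block_law m n n \<omega>) = (\<integral>p. indicator F p \<partial>block_law m n n \<omega> :: real)"
      by (rule Bochner_Integration.integral_cong) (auto simp: F_def sp indicator_def)
    also have "\<dots> = measure (block_law m n n \<omega>) F" using F se by simp
    finally show "h \<omega> = (\<integral>p. indicator A (p n) \<partial>block_law m n n \<omega>)" by (simp add: h_def)
    show "0 \<le> h \<omega>" "h \<omega> \<le> 1" by (simp_all add: h_def L.prob_le_1)
  qed
  have h_meas: "h \<in> borel_measurable M"
    unfolding h_def
    by (rule measurable_from_subalg[OF subalgebra_block_at measurable_compose[OF L measurable_measure_prob_algebra[OF F]]])
  have h_int: "integrable M h"
    using h_meas h(2,3) by (intro integrable_const_bound[where B = 1]) auto
  have T: "?T \<in> events" by (rule few_fresh_event)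
  have pw: "\<bar>h \<omega> - c\<bar> \<le> a * q powr ?s + indicator ?T \<omega>" if \<omega>: "\<omega> \<in> space M" for \<omega>
  proof (cases "\<omega> \<in> ?T")
    case True
    then have ind: "indicator ?T \<omega> = (1 :: real)" by (rule indicator_simps(1))
    have "0 \<le> a * q powr ?s" using a by simp
    with h(2,3)[OF \<omega>] c ind show ?thesis by linarith
  next
    case False
    let ?J = "card (fresh m n \<omega>)"
    have ind: "indicator ?T \<omega> = (0 :: real)" using False by (rule indicator_simps(2))
    have J: "?s \<le> real ?J" using False \<omega> by auto
    have "q ^ ?J \<le> q powr ?s"
    proof (cases "q = 0")
      case True
      \<comment> \<open>Here \<open>q powr s = 0\<close>, and \<open>q\<^sup>J\<close> vanishes as well because \<open>J \<ge> s > 0\<close>.\<close>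
      have "?J \<noteq> 0" using J s by linarith
      with True show ?thesis by (simp add: power_0_left)
    next
      case False
      then have "q ^ ?J = q powr real ?J" using q by (simp add: powr_realpow)
      also have "\<dots> \<le> q powr ?s" using J q by (rule powr_mono')
      finally show ?thesis .
    qed
    then have "a * q ^ ?J \<le> a * q powr ?s" using a by (rule mult_left_mono)
    with contr[OF \<omega>] h(1)[OF \<omega>] ind show ?thesis by linarith
  qed
  have "D \<inter> {\<omega> \<in> space M. walk G X (m + n) \<omega> \<in> A} = D \<inter> {\<omega> \<in> space M. block_path m n \<omega> \<in> F}"
    using path by (auto simp: F_def block_path_def)
  then have "prob (D \<inter> {\<omega> \<in> space M. walk G X (m + n) \<omega> \<in> A}) = (\<integral>\<omega>\<in>D. h \<omega> \<partial>M)"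
    unfolding h_def using block_law_prob[OF DB F] by simp
  moreover have "c * prob D = (\<integral>\<omega>\<in>D. c \<partial>M)" using DM by (simp add: set_lebesgue_integral_def)
  moreover have i1: "integrable M (\<lambda>\<omega>. indicator D \<omega> *\<^sub>R h \<omega>)" "integrable M (\<lambda>\<omega>. indicator D \<omega> *\<^sub>R c)"
    using integrable_mult_indicator[OF DM h_int] integrable_mult_indicator[OF DM, of "\<lambda>_. c"] by simp_all
  ultimately have "prob (D \<inter> {\<omega> \<in> space M. walk G X (m + n) \<omega> \<in> A}) - c * prob D =
      (\<integral>\<omega>. indicator D \<omega> *\<^sub>R h \<omega> - indicator D \<omega> *\<^sub>R c \<partial>M)"
    unfolding set_lebesgue_integral_def using Bochner_Integration.integral_diff[OF i1] by linarith
  also have "\<bar>\<dots>\<bar> \<le> (\<integral>\<omega>. \<bar>indicator D \<omega> *\<^sub>R h \<omega> - indicator D \<omega> *\<^sub>R c\<bar> \<partial>M)"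
    by (rule integral_abs_bound)
  also have "\<dots> \<le> (\<integral>\<omega>. (a * q powr ?s) * indicator D \<omega> + 1 * indicator (D \<inter> ?T) \<omega> \<partial>M)"
  proof (rule integral_mono)
    show "integrable M (\<lambda>\<omega>. \<bar>indicator D \<omega> *\<^sub>R h \<omega> - indicator D \<omega> *\<^sub>R c\<bar>)"
      by (intro integrable_abs Bochner_Integration.integrable_diff i1)
    show "integrable M (\<lambda>\<omega>. (a * q powr ?s) * indicator D \<omega> + 1 * indicator (D \<inter> ?T) \<omega>)"
      by (intro Bochner_Integration.integrable_add integral_scaled_indicator(1) DM sets.Int T)
    show "\<bar>indicator D \<omega> *\<^sub>R h \<omega> - indicator D \<omega> *\<^sub>R c\<bar> \<le> (a * q powr ?s) * indicator D \<omega> + 1 * indicator (D \<inter> ?T) \<omega>"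
      if \<omega>: "\<omega> \<in> space M" for \<omega>
    proof (cases "\<omega> \<in> D")
      case True
      with pw[OF \<omega>] show ?thesis unfolding indicator_inter_arith by simp
    qed (simp add: indicator_inter_arith)
  qed
  also have "\<dots> = (a * q powr ?s) * prob D + 1 * prob (D \<inter> ?T)"
    by (simp only: Bochner_Integration.integral_add[OF integral_scaled_indicator(1)[OF DM]
          integral_scaled_indicator(1)[OF sets.Int[OF DM T]]]
        integral_scaled_indicator(2)[OF DM] integral_scaled_indicator(2)[OF sets.Int[OF DM T]])
  also have "\<dots> \<le> (a * q powr ?s) * prob D + prob D * exp (- (1 - \<alpha>) * real n / 8)"
    unfolding mult_1 using fresh_lower_tail[OF DI, of n] by (rule add_left_mono)
  finally show ?thesis by (simp add: algebra_simps)
qed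

text \<open>
  The lower bound is the upper bound for the negative of the indicator.
\<close>

lemma walk_cond_prob_bound:
  assumes S: "sampled M \<A> B \<tau> Q" and W: "{\<omega> \<in> space M. walk G X (\<tau> \<omega> + n) \<omega> \<in> A} \<in> events"
    and bound: "\<And>m D. D \<in> sets (\<A> m) \<Longrightarrow>
      \<bar>prob (D \<inter> {\<omega> \<in> space M. walk G X (m + n) \<omega> \<in> A}) - c * prob D\<bar> \<le> prob D * \<beta>"
  shows "AE \<omega> in M. \<bar>prob_given M B {\<omega> \<in> space M. walk G X (\<tau> \<omega> + n) \<omega> \<in> A} \<omega> - c\<bar> \<le> \<beta>"
proof -
  let ?W = "{\<omega> \<in> space M. walk G X (\<tau> \<omega> + n) \<omega> \<in> A}"
  have sub: "subalgebra M B" using S by (simp add: sampled_def)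
  interpret sigma_finite_subalgebra M B
    by (rule sigma_finite_subalgebra_of_events[OF sub])
  have int: "integrable M (indicator ?W :: 'w \<Rightarrow> real)"
    using integral_scaled_indicator(1)[OF W, of 1] by simp
  have on_piece: "\<bar>prob (D \<inter> ?W) - c * prob D\<bar> \<le> prob D * \<beta>"
    if D: "D \<in> sets (\<A> m)" "D \<subseteq> Q m" for m D
  proof -
    have "\<tau> \<omega> = m" if "\<omega> \<in> D" for \<omega> using S D(2) that by (auto simp: sampled_def)
    then have "D \<inter> ?W = D \<inter> {\<omega> \<in> space M. walk G X (m + n) \<omega> \<in> A}" by auto
    with bound[OF D(1)] show ?thesis by simp
  qed
  have upper: "AE \<omega> in M. real_cond_exp M B (indicator ?W) \<omega> \<le> c + \<beta>"
  proof (rule sampled_cond_exp_le[OF S int])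
    fix m D assume D: "D \<in> sets (\<A> m)" "D \<in> events" "D \<subseteq> Q m"
    have "(\<integral>\<omega>\<in>D. indicator ?W \<omega> \<partial>M) = prob (D \<inter> ?W)" by (rule set_integral_indicator[OF D(2) W])
    also have "\<dots> \<le> (c + \<beta>) * prob D" using on_piece[OF D(1,3)] by (simp add: algebra_simps abs_le_iff)
    also have "\<dots> = (\<integral>\<omega>\<in>D. c + \<beta> \<partial>M)" using D(2) by (simp add: set_lebesgue_integral_def)
    finally show "(\<integral>\<omega>\<in>D. indicator ?W \<omega> \<partial>M) \<le> (\<integral>\<omega>\<in>D. c + \<beta> \<partial>M)" .
  qed simp_all
  have "AE \<omega> in M. real_cond_exp M B (\<lambda>\<omega>. - 1 * indicator ?W \<omega>) \<omega> \<le> \<beta> - c"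
  proof (rule sampled_cond_exp_le[OF S])
    show "integrable M (\<lambda>\<omega>. - 1 * indicator ?W \<omega> :: real)" by (rule integral_scaled_indicator(1)[OF W])
    fix m D assume D: "D \<in> sets (\<A> m)" "D \<in> events" "D \<subseteq> Q m"
    have "(\<integral>\<omega>\<in>D. - 1 * indicator ?W \<omega> \<partial>M) = - prob (D \<inter> ?W)"
      using set_integral_indicator[OF D(2) W] by (simp add: set_lebesgue_integral_def)
    also have "\<dots> \<le> (\<beta> - c) * prob D" using on_piece[OF D(1,3)] by (simp add: algebra_simps abs_le_iff)
    also have "\<dots> = (\<integral>\<omega>\<in>D. \<beta> - c \<partial>M)" using D(2) by (simp add: set_lebesgue_integral_def)
    finally show "(\<integral>\<omega>\<in>D. - 1 * indicator ?W \<omega> \<partial>M) \<le> (\<integral>\<omega>\<in>D. \<beta> - c \<partial>M)" .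
  qed simp_all
  moreover have "AE \<omega> in M. real_cond_exp M B (\<lambda>\<omega>. - 1 * indicator ?W \<omega>) \<omega> = - 1 * real_cond_exp M B (indicator ?W) \<omega>"
    by (rule real_cond_exp_cmult[OF int])
  ultimately show ?thesis
    using upper unfolding prob_given_def by eventually_elim (simp add: abs_le_iff)
qed

text \<open>
  The steps reveal less than all the sources, so sampling the filtration of the steps is a
  special case of sampling the full filtration.
\<close>

lemma fixed_or_stopping_either:
  assumes "fixed_or_stopping M \<A> B \<tau> \<or> fixed_or_stopping M \<H> B \<tau>"
  obtains Q where "sampled M \<A> B \<tau> Q" "contains_at M (\<lambda>_. M) M \<tau>"
  using assms
proof
  assume "fixed_or_stopping M \<A> B \<tau>"
  from fixed_or_stopping_sampled[OF subalgebra_\<A> \<A>_mono this]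
  obtain Q where Q: "sampled M \<A> B \<tau> Q" "contains_at M \<A> B \<tau>" by auto
  from that[OF Q(1) contains_at_events[OF Q space_\<A>]] show thesis .
next
  assume "fixed_or_stopping M \<H> B \<tau>"
  from fixed_or_stopping_sampled[OF subalgebra_\<H> \<H>_mono this]
  obtain Q where Q: "sampled M \<H> B \<tau> Q" "contains_at M \<H> B \<tau>" by auto
  from Q(1) have "sampled M \<A> B \<tau> Q"
    using subsetD[OF \<H>_\<A>] by (simp add: sampled_def)
  from that[OF this contains_at_events[OF Q space_\<H>]] show thesis .
qed

lemma walk_event_at_time:
  assumes "contains_at M (\<lambda>_. M) M \<tau>" "A \<in> sets E"
  shows "{\<omega> \<in> space M. walk G X (\<tau> \<omega> + n) \<omega> \<in> A} \<in> events"
proof -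
  have "(\<lambda>\<omega>. walk G X (\<tau> \<omega> + n) \<omega>) \<in> M \<rightarrow>\<^sub>M E"
    by (rule measurable_at_random_time[OF refl refl assms(1), of "\<lambda>m. walk G X (m + n)"]) (rule walk_events)
  from measurable_sets[OF this assms(2)] show ?thesis by (simp add: vimage_def Int_def conj_commute)
qed

lemma error_term_le: "exp (- (1 - \<alpha>) * real n / 8) \<le> 2 * exp (- (1 - \<alpha>) * real n / 18)"
proof -
  have "- (1 - \<alpha>) * real n / 8 \<le> - (1 - \<alpha>) * real n / 18"
  proof -
    have "- x * y / 8 \<le> - x * y / 18" if "0 \<le> x * y" for x y :: real using that by simp
    moreover have "0 \<le> (1 - \<alpha>) * real n" using \<alpha> by simp
    ultimately show ?thesis by blast
  qed
  then have "exp (- (1 - \<alpha>) * real n / 8) \<le> exp (- (1 - \<alpha>) * real n / 18)" by (rule exp_le_cancel_iff[THEN iffD2])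
  also have "\<dots> \<le> 2 * exp (- (1 - \<alpha>) * real n / 18)" by simp
  finally show ?thesis .
qed

lemma discrete_block_contraction:
  assumes E: "sets E = Pow (carrier G)" and \<omega>: "\<omega> \<in> space M" and q: "0 \<le> q"
    and V: "V \<subseteq> ell2 (carrier G)"
      "\<And>v. v \<in> V \<Longrightarrow> kernel_image (carrier G) (mult_kernel G E \<mu>) v \<in> V"
      "\<And>v y. v \<in> V \<Longrightarrow> y \<in> carrier G \<Longrightarrow> kernel_image (carrier G) (translation_kernel G E y) v \<in> V"
    and contr: "\<And>v. v \<in> V \<Longrightarrow> ell2_norm (carrier G) (kernel_image (carrier G) (mult_kernel G E \<mu>) v)
      \<le> q * ell2_norm (carrier G) v"
    and base: "\<And>x v. x \<in> carrier G \<Longrightarrow> v \<in> V \<Longrightarrow> \<bar>v x\<bar> \<le> b * ell2_norm (carrier G) v" "0 \<le> b"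
    and f: "(\<lambda>y. if y \<in> carrier G then indicator A y - c else 0) \<in> V"
      "b * ell2_norm (carrier G) (\<lambda>y. if y \<in> carrier G then indicator A y - c else 0) \<le> a"
  shows "\<bar>(\<integral>p. indicator A (p n) \<partial>block_law m n n \<omega>) - c\<bar> \<le> a * q ^ card (fresh m n \<omega>)"
proof -
  interpret discrete_steps G E \<mu> 
    by (rule discrete_steps.intro[OF is_group discrete_steps_axioms.intro[OF E step_law]])
  let ?C = "carrier G" and ?r = "\<lambda>k. if m + k \<in> isolated \<xi> u (m + n) \<omega> then q else 1"
  let ?v = "\<lambda>y. if y \<in> ?C then indicator A y - c else 0"
  have X: "X (m + k) \<omega> \<in> ?C" if "1 \<le> k" for k using X_space[OF \<omega>, of "m + k"] that by (simp add: space_E)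
  have "\<bar>(\<integral>p. indicator A (p n) \<partial>block_law m n n \<omega>) - c\<bar> \<le> b * ((\<Prod>k\<in>{1..n}. ?r k) * ell2_norm ?C ?v)"
    unfolding block_law_def
  proof (rule markov_law_contraction[where V = V and E = E])
    show "block_kernel m n \<omega> k \<in> E \<rightarrow>\<^sub>M prob_algebra E" if "1 \<le> k" for k
      by (rule block_kernel_measurable_at[OF \<omega> that])
    show "walk G X m \<omega> \<in> ?C" using measurable_space[OF walk_events \<omega>] by (simp add: space_E)
    then show "\<bar>v (walk G X m \<omega>)\<bar> \<le> b * ell2_norm ?C v" if "v \<in> V" for v using base(1) that by blast
    show "kernel_image ?C (block_kernel m n \<omega> k) v \<in> V" if "1 \<le> k" "v \<in> V" for k v
      using V(2,3) X that by (simp add: block_kernel_def)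
    show "ell2_norm ?C (kernel_image ?C (block_kernel m n \<omega> k) v) \<le> ?r k * ell2_norm ?C v" if "1 \<le> k" "v \<in> V" for k v
      using contr[OF that(2)] translation_contraction(2)[of v "X (m + k) \<omega>"] V(1) X that
      by (auto simp: block_kernel_def)
  qed (use E q base(2) f(1) in \<open>auto simp: indicator_def\<close>)
  also have "\<dots> = (b * ell2_norm ?C ?v) * q ^ card (fresh m n \<omega>)" 
    unfolding prod_isolated_factors by (simp only: mult_ac)
  also have "\<dots> \<le> a * q ^ card (fresh m n \<omega>)" using f(2) q by (intro mult_right_mono) auto
  finally show ?thesis .
qed

lemma infinite_group_bound:
  assumes E: "sets E = Pow (carrier G)" and C: "countable (carrier G)" and n: "1 \<le> n"
    and B\<tau>: "fixed_or_stopping M \<A> B \<tau> \<or> fixed_or_stopping M \<H> B \<tau>"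
    and q: "q = ell2_opnorm (carrier G) (ell2 (carrier G)) (kernel_operator (carrier G) (mult_kernel G E \<mu>))" "q < 1"
  shows "AE \<omega> in M. (SUP x\<in>carrier G. ereal (prob_given M B {\<omega> \<in> space M. walk G X (\<tau> \<omega> + n) \<omega> = x} \<omega>))
    \<le> ereal (q powr ((1 - \<alpha>) * real n / 8) + 2 * exp (- (1 - \<alpha>) * real n / 18))"
proof -
  interpret D: discrete_steps G E \<mu> 
    by (rule discrete_steps.intro[OF is_group discrete_steps_axioms.intro[OF E step_law]])
  let ?C = "carrier G" and ?\<beta> = "q powr ((1 - \<alpha>) * real n / 8) + 2 * exp (- (1 - \<alpha>) * real n / 18)"
  obtain Q where S: "sampled M \<A> B \<tau> Q" and cM: "contains_at M (\<lambda>_. M) M \<tau>"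
    using fixed_or_stopping_either[OF B\<tau>] .
  note op = D.averaging_opnorm[OF C order_refl ell2_scale(1), folded q(1)]
  have "(\<lambda>_. 0) \<in> ell2 ?C" by (simp add: ell2_def)
  then have q0: "0 \<le> q" using op(1) by blast
  have pt: "AE \<omega> in M. prob_given M B {\<omega> \<in> space M. walk G X (\<tau> \<omega> + n) \<omega> = x} \<omega> \<le> ?\<beta>" if x: "x \<in> ?C" for x
  proof -
    have xE: "{x} \<in> sets E" using x E by simp
    let ?v = "\<lambda>y. if y \<in> ?C then indicator {x} y - 0 else 0 :: real"
    have sums: "(\<Sum>y\<in>F. (?v y)\<^sup>2) \<le> 1\<^sup>2" if "finite F" for F
    proof -
      have "(\<Sum>y\<in>F. (?v y)\<^sup>2) \<le> (\<Sum>y\<in>F. if y = x then 1 else 0)"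
        by (rule sum_mono) (auto simp: indicator_def)
      also have "\<dots> \<le> 1" using that by simp
      finally show ?thesis by simp
    qed
    have v: "?v \<in> ell2 ?C" "ell2_norm ?C ?v \<le> 1"
      using ell2I[of ?C ?v 1] sums by auto
    have "\<bar>prob (D \<inter> {\<omega> \<in> space M. walk G X (m + n) \<omega> \<in> {x}}) - 0 * prob D\<bar> \<le>
        prob D * (1 * q powr ((1 - \<alpha>) * real n / 8) + exp (- (1 - \<alpha>) * real n / 8))"
      if D: "D \<in> sets (\<A> m)" for D m
    proof (rule walk_prob_bound[OF n q0 _ _ _ _ xE D])
      show "\<bar>(\<integral>p. indicator {x} (p n) \<partial>block_law m n n \<omega>) - 0\<bar> \<le> 1 * q ^ card (fresh m n \<omega>)"
        if "\<omega> \<in> space M" for \<omega>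
        by (rule discrete_block_contraction[OF E that q0 order_refl D.averaging_contraction(1)
            D.translation_contraction(1) op(2), where b = 1])
           (use v ell2_abs_le in auto)
    qed (use q in auto)
    moreover have "1 * q powr ((1 - \<alpha>) * real n / 8) + exp (- (1 - \<alpha>) * real n / 8) \<le> ?\<beta>"
      using error_term_le by simp
    ultimately have bound: "\<bar>prob (D \<inter> {\<omega> \<in> space M. walk G X (m + n) \<omega> \<in> {x}}) - 0 * prob D\<bar> \<le> prob D * ?\<beta>"
      if "D \<in> sets (\<A> m)" for D m
      using that by (meson measure_nonneg mult_left_mono order_trans)
    have "AE \<omega> in M. \<bar>prob_given M B {\<omega> \<in> space M. walk G X (\<tau> \<omega> + n) \<omega> \<in> {x}} \<omega> - 0\<bar> \<le> ?\<beta>"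
      by (rule walk_cond_prob_bound[OF S walk_event_at_time[OF cM xE] bound])
    then show ?thesis by eventually_elim simp
  qed
  have "AE \<omega> in M. \<forall>x\<in>?C. prob_given M B {\<omega> \<in> space M. walk G X (\<tau> \<omega> + n) \<omega> = x} \<omega> \<le> ?\<beta>"
    using C pt by (simp add: AE_ball_countable)
  then show ?thesis by eventually_elim (auto intro!: SUP_least)
qed

lemma finite_group_bound:
  assumes E: "sets E = Pow (carrier G)" and fin: "finite (carrier G)" and n: "1 \<le> n"
    and B\<tau>: "fixed_or_stopping M \<A> B \<tau> \<or> fixed_or_stopping M \<H> B \<tau>"
    and q: "0 < q" "q < 1" "ell2_opnorm (carrier G) (ell2_mean_zero (carrier G))
      (kernel_operator (carrier G) (mult_kernel G E \<mu>)) \<le> q"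
  shows "AE \<omega> in M. tv_dist E
      (\<lambda>A. prob_given M B {\<omega> \<in> space M. walk G X (\<tau> \<omega> + n) \<omega> \<in> A} \<omega>)
      (measure (uniform_count_measure (carrier G)))
    \<le> 1 / 2 * sqrt (real (card (carrier G)) - 1) * q powr ((1 - \<alpha>) * real n / 8) + 2 * exp (- (1 - \<alpha>) * real n / 18)"
proof -
  interpret D: discrete_steps G E \<mu> 
    by (rule discrete_steps.intro[OF is_group discrete_steps_axioms.intro[OF E step_law]])
  let ?C = "carrier G"
  let ?N = "real (card ?C)" and ?V = "ell2_mean_zero (carrier G)"
  let ?a = "1 / 2 * sqrt (?N - 1)"
  let ?\<beta> = "?a * q powr ((1 - \<alpha>) * real n / 8) + 2 * exp (- (1 - \<alpha>) * real n / 18)"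
  obtain Q where S: "sampled M \<A> B \<tau> Q" and cM: "contains_at M (\<lambda>_. M) M \<tau>"
    using fixed_or_stopping_either[OF B\<tau>] .
  have N: "1 \<le> ?N" using fin card_gt_0_iff[of ?C] one_closed by auto
  have V: "?V \<subseteq> ell2 ?C" by (auto simp: ell2_mean_zero_def)
  have Vscale: "(\<lambda>x. c * v x) \<in> ?V" if "v \<in> ?V" for c v
    using that ell2_scale(1)[of v ?C c] by (auto simp: ell2_mean_zero_def simp flip: sum_distrib_left)
  have contr: "ell2_norm ?C (kernel_image ?C (mult_kernel G E \<mu>) v) \<le> q * ell2_norm ?C v" if v: "v \<in> ?V" for v
    using D.averaging_opnorm(2)[OF countable_finite[OF fin] V Vscale v] q(3) ell2_norm_nonneg[of ?C v]
    by (meson mult_right_mono order_trans)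
  have pt: "AE \<omega> in M. \<bar>prob_given M B {\<omega> \<in> space M. walk G X (\<tau> \<omega> + n) \<omega> \<in> A} \<omega> - measure (uniform_count_measure ?C) A\<bar> \<le> ?\<beta>"
    if A: "A \<in> sets E" for A
  proof -
    have AC: "A \<subseteq> ?C" using A E by auto
    define c where "c = real (card A) / ?N"
    have c: "measure (uniform_count_measure ?C) A = c"
      unfolding c_def by (rule measure_uniform_count_measure[OF fin AC])
    have c01: "0 \<le> c" "c \<le> 1" using card_mono[OF fin AC] N by (auto simp: c_def divide_le_eq)
    note cent = centred_indicator_norm[OF fin one_closed AC, folded c_def]
    have "\<bar>prob (D \<inter> {\<omega> \<in> space M. walk G X (m + n) \<omega> \<in> A}) - c * prob D\<bar> \<le>
        prob D * (?a * q powr ((1 - \<alpha>) * real n / 8) + exp (- (1 - \<alpha>) * real n / 8))"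
      if D: "D \<in> sets (\<A> m)" for D m
    proof (rule walk_prob_bound[OF n _ _ c01 _ A D])
      show "\<bar>(\<integral>p. indicator A (p n) \<partial>block_law m n n \<omega>) - c\<bar> \<le> ?a * q ^ card (fresh m n \<omega>)"
        if "\<omega> \<in> space M" for \<omega>
      proof (rule discrete_block_contraction[OF E that _ V D.mean_zero_preserved(1)[OF fin] D.mean_zero_preserved(2)[OF fin]
            contr mean_zero_abs_le[OF fin] _ cent])
        show "0 \<le> sqrt (1 - 1 / ?N)" using N by simp
      qed (use q in auto)
    qed (use q N in auto)
    moreover have "?a * q powr ((1 - \<alpha>) * real n / 8) + exp (- (1 - \<alpha>) * real n / 8) \<le> ?\<beta>"
      using error_term_le by simp
    ultimately have "\<bar>prob (D \<inter> {\<omega> \<in> space M. walk G X (m + n) \<omega> \<in> A}) - c * prob D\<bar> \<le> prob D * ?\<beta>"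
      if "D \<in> sets (\<A> m)" for D m
      using that by (meson measure_nonneg mult_left_mono order_trans)
    from walk_cond_prob_bound[OF S walk_event_at_time[OF cM A] this] show ?thesis unfolding c .
  qed
  have "finite (sets E)" using E fin by simp
  then have "AE \<omega> in M. \<forall>A\<in>sets E. \<bar>prob_given M B {\<omega> \<in> space M. walk G X (\<tau> \<omega> + n) \<omega> \<in> A} \<omega> - measure (uniform_count_measure ?C) A\<bar> \<le> ?\<beta>"
    using pt by (simp add: AE_finite_all)
  then show ?thesis
    unfolding tv_dist_def by eventually_elim (rule cSUP_least, use sets.top in blast, blast)
qed

end

section \<open>Groups as state spaces\<close>

lemma state_space_mult_measurable:
  assumes G: "group G" and sp: "space E = carrier G"
    and st: "euclidean_state_space TYPE('d::finite) G E \<or> discrete_state_space G E"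
  shows "(\<lambda>(x, y). x \<otimes>\<^bsub>G\<^esub> y) \<in> E \<Otimes>\<^sub>M E \<rightarrow>\<^sub>M E"
  using st
proof
  interpret group G by fact
  assume "euclidean_state_space TYPE('d) G E"
  then obtain \<phi> :: "'a \<Rightarrow> real ^ 'd" where \<phi>: "\<phi> \<in> iso G vector_group"
    and E: "sets E = sets (vimage_algebra (carrier G) \<phi> borel)"
    by (auto simp: euclidean_state_space_def)
  have hom: "\<phi> (x \<otimes>\<^bsub>G\<^esub> y) = \<phi> x + \<phi> y" if "x \<in> carrier G" "y \<in> carrier G" for x y
    using \<phi> that by (auto simp: iso_def hom_def vector_group_def)
  have "\<phi> \<in> vimage_algebra (carrier G) \<phi> borel \<rightarrow>\<^sub>M borel" by (rule measurable_vimage_algebra1) simp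
  then have \<phi>m: "\<phi> \<in> E \<rightarrow>\<^sub>M borel" using measurable_cong_sets[OF E refl] by blast
  have "(\<lambda>z. \<phi> (fst z) + \<phi> (snd z)) \<in> E \<Otimes>\<^sub>M E \<rightarrow>\<^sub>M borel"
    by (intro borel_measurable_add measurable_compose[OF measurable_fst \<phi>m] measurable_compose[OF measurable_snd \<phi>m])
  then have "(\<lambda>z. \<phi> (fst z \<otimes>\<^bsub>G\<^esub> snd z)) \<in> E \<Otimes>\<^sub>M E \<rightarrow>\<^sub>M borel"
    by (rule measurable_cong[THEN iffD1, rotated]) (auto simp: space_pair_measure sp hom)
  then have "(\<lambda>z. fst z \<otimes>\<^bsub>G\<^esub> snd z) \<in> E \<Otimes>\<^sub>M E \<rightarrow>\<^sub>M vimage_algebra (carrier G) \<phi> borel"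
    by (intro measurable_vimage_algebra2) (auto simp: space_pair_measure sp)
  then show ?thesis by (simp only: case_prod_beta' measurable_cong_sets[OF refl E])
qed (simp add: discrete_state_space_def)

text \<open>
  A Euclidean space is uncountable, so a countable state space falls under the discrete case.
\<close>

lemma countable_state_space_discrete:
  assumes C: "countable (carrier G)"
    and st: "euclidean_state_space TYPE('d::finite) G E \<or> discrete_state_space G E"
  shows "sets E = Pow (carrier G)"
  using st
proof
  assume "euclidean_state_space TYPE('d) G E"
  then obtain \<phi> :: "'a \<Rightarrow> real ^ 'd" where "\<phi> \<in> iso G vector_group"
    by (auto simp: euclidean_state_space_def)
  then have "\<phi> ` carrier G = UNIV" by (auto simp: iso_def bij_betw_def vector_group_def)
  with C have "countable (UNIV :: (real ^ 'd) set)" by (metis countable_image)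
  then have "countable (range (\<lambda>r. (\<chi> i. r) :: real ^ 'd))" by (rule countable_subset[rotated]) simp
  then have "countable (UNIV :: real set)"
    by (rule countable_image_inj_on) (auto simp: inj_on_def vec_eq_iff)
  then show ?thesis using uncountable_UNIV_real by blast
qed (simp add: discrete_state_space_def)

theorem proposition2p3:
  fixes M :: "'w measure" and G :: "'a monoid" and E \<mu> :: "'a measure" and \<alpha> :: real
    and N :: "'t measure" and \<Theta> :: "'w \<Rightarrow> 't"
    and \<T> :: "nat \<Rightarrow> 't \<times> (nat \<Rightarrow> bool \<times> nat) \<times> 'a \<Rightarrow> 'a"
    and g :: "nat \<Rightarrow> 'w \<Rightarrow> 'a" and \<xi> :: "nat \<Rightarrow> 'w \<Rightarrow> bool" and u :: "nat \<Rightarrow> 'w \<Rightarrow> nat"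
    and X :: "nat \<Rightarrow> 'w \<Rightarrow> 'a" and n :: nat
  assumes srrw: "srrw M G E \<mu> \<alpha> N \<Theta> \<T> g \<xi> u X"
    and state_space: "euclidean_state_space TYPE('d::finite) G E \<or> discrete_state_space G E"
    and n: "1 \<le> n"
  shows
    "(\<forall>B \<tau>. fixed_or_stopping M (full_filtration M E N \<Theta> g \<xi> u) B \<tau> \<longrightarrow>
       (\<forall>K A. K \<subseteq> {1..n} \<and> (\<forall>k\<in>K. A k \<in> sets E) \<longrightarrow>
          (AE \<omega> in M. (\<forall>k\<in>K. \<tau> \<omega> + k \<in> isolated \<xi> u (\<tau> \<omega> + n) \<omega>) \<longrightarrow>
             prob_given M (block_sigma M E g \<xi> u B \<tau> n)
               {\<omega> \<in> space M. \<forall>k\<in>K. g (\<tau> \<omega> + k) \<omega> \<in> A k} \<omega> = (\<Prod>k\<in>K. measure \<mu> (A k)))) \<and>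
       (\<forall>k\<in>{1..n}. (\<lambda>\<omega>. X (\<tau> \<omega> + k) \<omega>)
          \<in> restrict_space (block_sigma M E g \<xi> u B \<tau> n)
              {\<omega> \<in> space M. \<tau> \<omega> + k \<notin> isolated \<xi> u (\<tau> \<omega> + n) \<omega>} \<rightarrow>\<^sub>M E) \<and>
       is_cond_law M (block_sigma M E g \<xi> u B \<tau> n)
         (\<lambda>\<omega>. \<lambda>k\<in>{0..n}. walk G X (\<tau> \<omega> + k) \<omega>) (\<Pi>\<^sub>M k\<in>{0..n}. E)
         (\<lambda>\<omega>. markov_law E
            (\<lambda>k. if \<tau> \<omega> + k \<in> isolated \<xi> u (\<tau> \<omega> + n) \<omega>
                 then mult_kernel G E \<mu> else translation_kernel G E (X (\<tau> \<omega> + k) \<omega>))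
            (walk G X (\<tau> \<omega>) \<omega>) n)) \<and>
     (\<forall>B \<tau> q. (fixed_or_stopping M (full_filtration M E N \<Theta> g \<xi> u) B \<tau> \<or>
              fixed_or_stopping M (step_filtration M E X) B \<tau>) \<and>
       countable (carrier G) \<and> infinite (carrier G) \<and>
       q = ell2_opnorm (carrier G) (ell2 (carrier G))
             (kernel_operator (carrier G) (mult_kernel G E \<mu>)) \<and> q < 1 \<longrightarrow>
       (AE \<omega> in M.
          (SUP x\<in>carrier G. ereal (prob_given M B {\<omega> \<in> space M. walk G X (\<tau> \<omega> + n) \<omega> = x} \<omega>))
          \<le> ereal (q powr ((1 - \<alpha>) * real n / 8) + 2 * exp (- (1 - \<alpha>) * real n / 18)))) \<and>
     (\<forall>B \<tau> q\<^sub>0. (fixed_or_stopping M (full_filtration M E N \<Theta> g \<xi> u) B \<tau> \<or>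
               fixed_or_stopping M (step_filtration M E X) B \<tau>) \<and>
       finite (carrier G) \<and> 0 < q\<^sub>0 \<and> q\<^sub>0 < 1 \<and>
       ell2_opnorm (carrier G) (ell2_mean_zero (carrier G))
         (kernel_operator (carrier G) (mult_kernel G E \<mu>)) \<le> q\<^sub>0 \<longrightarrow>
       (AE \<omega> in M.
          tv_dist E
            (\<lambda>A. prob_given M B {\<omega> \<in> space M. walk G X (\<tau> \<omega> + n) \<omega> \<in> A} \<omega>)
            (measure (uniform_count_measure (carrier G)))
          \<le> 1 / 2 * sqrt (real (card (carrier G)) - 1) * q\<^sub>0 powr ((1 - \<alpha>) * real n / 8)
            + 2 * exp (- (1 - \<alpha>) * real n / 18)))"
proof -
  interpret srrw M G E \<mu> \<alpha> N \<Theta> \<T> g \<xi> u X by (rule srrw)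
  interpret measurable_srrw M G E \<mu> \<alpha> N \<Theta> \<T> g \<xi> u X
    by unfold_locales (rule state_space_mult_measurable[OF is_group space_E state_space])
  have path: "(\<lambda>\<omega>. \<lambda>k\<in>{0..n}. walk G X (\<tau> \<omega> + k) \<omega>) = (\<lambda>\<omega>. block_path (\<tau> \<omega>) n \<omega>)" for \<tau>
    by (simp add: block_path_def)
  have law: "(\<lambda>\<omega>. markov_law E
            (\<lambda>k. if \<tau> \<omega> + k \<in> isolated \<xi> u (\<tau> \<omega> + n) \<omega>
                 then mult_kernel G E \<mu> else translation_kernel G E (X (\<tau> \<omega> + k) \<omega>))
            (walk G X (\<tau> \<omega>) \<omega>) n) = (\<lambda>\<omega>. block_law (\<tau> \<omega>) n n \<omega>)" for \<tau>
    by (simp add: block_law_def block_kernel_def[abs_def])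
  show ?thesis
    unfolding path law
  proof (intro conjI allI impI ballI, goal_cases)
    case (1 B \<tau> K A)
    then show ?case by (intro isolated_labels_conditionally_iid) auto
  next
    case (2 B \<tau> k)
    then show ?case by (rule revealed_steps)
  next
    case (3 B \<tau>)
    then show ?case by (rule block_path_cond_law)
  next
    case (4 B \<tau> q)
    then have "sets E = Pow (carrier G)" using countable_state_space_discrete[OF _ state_space] by blast
    with 4 show ?case by (intro infinite_group_bound n) auto
  next
    case (5 B \<tau> q\<^sub>0)
    then have "sets E = Pow (carrier G)"
      using countable_state_space_discrete[OF countable_finite state_space] by blast
    with 5 show ?case by (intro finite_group_bound n) auto
  qed
qed

end
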